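(* For every $\lambda\in\mathbb{R}$, the spectrum of the Thue--Morse Hamiltonian $H_{\mathrm{tm},\lambda}$ has full Hausdorff dimension: $$\dim_H \sigma(H_{\mathrm{tm},\lambda})=1.$$
   Context: Let $\tau$ be the Thue--Morse substitution on the alphabet $\{a,b\}$, $\tau(a)=ab$, $\tau(b)=ba$, extended to finite words by concatenation. Since $\tau^2(a)=abba$ begins and ends with $a$, the pointed words $\tau^{2k}(a)\boldsymbol{\cdot}\tau^{2k}(a)$ (the dot separates the coordinates $-1$ and $0$) agree on increasingly large neighbourhoods of the origin, and their limit defines a two-sided sequence $w_{\mathrm{tm}}=\lim_{k\to\infty}\tau^{2k}(a)\boldsymbol{\cdot}\tau^{2k}(a)\in\{a,b\}^{\mathbb{Z}}$. For $n\in\mathbb{Z}$ put $v_\lambda(n)=\lambda$ if $w_{\mathrm{tm}}(n)=a$ and $v_\lambda(n)=-\lambda$ if $w_{\mathrm{tm}}(n)=b$. The Thue--Morse Hamiltonian with coupling $\lambda$ is the bounded self-adjoint operator on $\ell^2(\mathbb{Z})$ given by $$(H_{\mathrm{tm},\lambda}\psi)(n)=\psi(n+1)+\psi(n-1)+v_\lambda(n)\psi(n).$$ $\sigma(H_{\mathrm{tm},\lambda})\subset\mathbb{R}$ denotes its spectrum and $\dim_H$ denotes Hausdorff dimension. *)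

theory Defs
  imports "HOL-Analysis.Analysis"
begin

datatype letter = La | Lb

fun tm_letter :: "letter \<Rightarrow> letter list" where
  "tm_letter La = [La, Lb]"
| "tm_letter Lb = [Lb, La]"

definition tm_subst :: "letter list \<Rightarrow> letter list" where
  "tm_subst w = concat (map tm_letter w)"

text \<open>The pointed word \<open>u.v\<close>: the first letter of \<open>v\<close> sits at coordinate 0 and the last letter
  of \<open>u\<close> at coordinate -1; coordinates outside the word carry \<^const>\<open>None\<close>.\<close>

definition pointed_word :: "letter list \<Rightarrow> letter list \<Rightarrow> int \<Rightarrow> letter option" where
  "pointed_word u v n =
     (if 0 \<le> n \<and> n < int (length v) then Some (v ! nat n)
      else if - int (length u) \<le> n \<and> n < 0 then Some (u ! nat (int (length u) + n))
      else None)"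

definition tm_pointed :: "nat \<Rightarrow> int \<Rightarrow> letter option" where
  "tm_pointed k = pointed_word ((tm_subst ^^ (2 * k)) [La]) ((tm_subst ^^ (2 * k)) [La])"

text \<open>The limit is taken coordinatewise for the discrete topology on letters;
  \<open>tm_pointed_eventually\<close> below shows that it exists.\<close>

definition w_tm :: "int \<Rightarrow> letter" where
  "w_tm n = (THE c. eventually (\<lambda>k. tm_pointed k n = Some c) sequentially)"

lemma tm_subst_append: "tm_subst (u @ v) = tm_subst u @ tm_subst v"
  by (simp add: tm_subst_def)

lemma tm_subst_pow_append: "(tm_subst ^^ k) (u @ v) = (tm_subst ^^ k) u @ (tm_subst ^^ k) v"
  by (induction k) (simp_all add: tm_subst_append)

lemma length_tm_subst: "length (tm_subst w) = 2 * length w"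
proof (induction w)
  case (Cons c w)
  then show ?case by (cases c) (simp_all add: tm_subst_def)
qed (simp add: tm_subst_def)

lemma length_tm_subst_pow: "length ((tm_subst ^^ k) w) = 2 ^ k * length w"
  by (induction k) (simp_all add: length_tm_subst)

lemma tm_pointed_Suc:
  assumes "tm_pointed k n = Some c"
  shows "tm_pointed (Suc k) n = Some c"
proof -
  let ?u = "(tm_subst ^^ (2 * k)) [La]" and ?m = "(tm_subst ^^ (2 * k)) [Lb, Lb]"
  have "(tm_subst ^^ (2 * Suc k)) [La] = (tm_subst ^^ (2 * k)) ((tm_subst ^^ 2) [La])"
    by (metis add.commute comp_apply funpow_add mult_Suc_right)
  also have "(tm_subst ^^ 2) [La] = [La] @ [Lb, Lb] @ [La]"
    by (simp add: tm_subst_def numeral_2_eq_2)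
  finally have eq: "(tm_subst ^^ (2 * Suc k)) [La] = (?u @ ?m) @ ?u"
    by (simp add: tm_subst_pow_append del: append_Cons append_Nil)
  show ?thesis
  proof (cases "0 \<le> n")
    case True
    then show ?thesis using assms
      unfolding tm_pointed_def pointed_word_def eq
      by (auto simp: nth_append nat_less_iff split: if_splits)
  next
    case False
    then have n: "- int (length ?u) \<le> n" "c = ?u ! nat (int (length ?u) + n)"
      using assms by (auto simp: tm_pointed_def pointed_word_def split: if_splits)
    then have "nat (int (length ((?u @ ?m) @ ?u)) + n)
        = length (?u @ ?m) + nat (int (length ?u) + n)"
      by simp
    then have "((?u @ ?m) @ ?u) ! nat (int (length ((?u @ ?m) @ ?u)) + n) = c"
      using n by (simp only: nth_append_length_plus)
    moreover have "- int (length ((?u @ ?m) @ ?u)) \<le> n"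
      using n by simp
    ultimately show ?thesis using False
      unfolding tm_pointed_def pointed_word_def eq by simp
  qed
qed

lemma tm_pointed_eventually: "eventually (\<lambda>k. tm_pointed k n = Some (w_tm n)) sequentially"
proof -
  define k where "k = nat \<bar>n\<bar>"
  have "k < 2 ^ (2 * k)"
    by (metis less_exp order.strict_trans1 mult_2 le_add1)
  then have "nat \<bar>n\<bar> < length ((tm_subst ^^ (2 * k)) [La])"
    by (simp add: length_tm_subst_pow k_def)
  then have "tm_pointed k n \<noteq> None"
    unfolding tm_pointed_def pointed_word_def by (cases "0 \<le> n") auto
  then obtain c where c: "tm_pointed k n = Some c"
    by auto
  have "tm_pointed j n = Some c" if "k \<le> j" for j
    using that by (induction j rule: dec_induct) (simp_all add: c tm_pointed_Suc)
  then have ev: "eventually (\<lambda>k. tm_pointed k n = Some c) sequentially"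
    by (auto simp: eventually_sequentially)
  have "c' = c" if "eventually (\<lambda>k. tm_pointed k n = Some c') sequentially" for c'
  proof -
    have "eventually (\<lambda>k. c' = c) sequentially"
      using that ev by eventually_elim simp
    then show ?thesis by simp
  qed
  with ev have "w_tm n = c"
    unfolding w_tm_def by blast
  with ev show ?thesis by simp
qed

definition ell2 :: "(int \<Rightarrow> complex) set" where
  "ell2 = {\<psi>. (\<lambda>n. (cmod (\<psi> n))\<^sup>2) summable_on UNIV}"

definition ell2_norm :: "(int \<Rightarrow> complex) \<Rightarrow> real" where
  "ell2_norm \<psi> = sqrt (\<Sum>\<^sub>\<infinity>n. (cmod (\<psi> n))\<^sup>2)"

text \<open>Operators are total functions on all sequences; only their values on \<^const>\<open>ell2\<close> matter.\<close>

definition bounded_op :: "((int \<Rightarrow> complex) \<Rightarrow> (int \<Rightarrow> complex)) \<Rightarrow> bool" where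
  "bounded_op T \<longleftrightarrow>
     (\<forall>\<psi>\<in>ell2. T \<psi> \<in> ell2) \<and>
     (\<forall>\<phi>\<in>ell2. \<forall>\<psi>\<in>ell2. T (\<lambda>n. \<phi> n + \<psi> n) = (\<lambda>n. T \<phi> n + T \<psi> n)) \<and>
     (\<forall>c. \<forall>\<psi>\<in>ell2. T (\<lambda>n. c * \<psi> n) = (\<lambda>n. c * T \<psi> n)) \<and>
     (\<exists>C. \<forall>\<psi>\<in>ell2. ell2_norm (T \<psi>) \<le> C * ell2_norm \<psi>)"

definition op_shift ::
  "((int \<Rightarrow> complex) \<Rightarrow> (int \<Rightarrow> complex)) \<Rightarrow> complex \<Rightarrow> (int \<Rightarrow> complex) \<Rightarrow> (int \<Rightarrow> complex)" where
  "op_shift T z \<psi> = (\<lambda>n. T \<psi> n - z * \<psi> n)"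

definition op_spectrum :: "((int \<Rightarrow> complex) \<Rightarrow> (int \<Rightarrow> complex)) \<Rightarrow> complex set" where
  "op_spectrum T =
     {z. \<not> (\<exists>R. bounded_op R \<and>
                 (\<forall>\<psi>\<in>ell2. R (op_shift T z \<psi>) = \<psi> \<and> op_shift T z (R \<psi>) = \<psi>))}"

definition tm_potential :: "real \<Rightarrow> int \<Rightarrow> real" where
  "tm_potential lam n = (case w_tm n of La \<Rightarrow> lam | Lb \<Rightarrow> - lam)"

definition tm_hamiltonian :: "real \<Rightarrow> (int \<Rightarrow> complex) \<Rightarrow> (int \<Rightarrow> complex)" where
  "tm_hamiltonian lam \<psi> =
     (\<lambda>n. \<psi> (n + 1) + \<psi> (n - 1) + complex_of_real (tm_potential lam n) * \<psi> n)"

lemma bounded_op_tm_hamiltonian: "bounded_op (tm_hamiltonian lam)"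
proof -
  define K where "K = 3 * (2 + lam\<^sup>2)"
  have main: "(\<lambda>n. (cmod (tm_hamiltonian lam \<psi> n))\<^sup>2) summable_on UNIV \<and>
      (\<Sum>\<^sub>\<infinity>n. (cmod (tm_hamiltonian lam \<psi> n))\<^sup>2) \<le> K * (\<Sum>\<^sub>\<infinity>n. (cmod (\<psi> n))\<^sup>2)"
    if "\<psi> \<in> ell2" for \<psi>
  proof -
    define S where "S = (\<Sum>\<^sub>\<infinity>n. (cmod (\<psi> n))\<^sup>2)"
    have S: "((\<lambda>n. (cmod (\<psi> n))\<^sup>2) has_sum S) UNIV"
      using that by (simp add: ell2_def S_def)
    have shift: "((\<lambda>n. (cmod (\<psi> (n + d)))\<^sup>2) has_sum S) UNIV" for d
    proof -
      have "bij_betw (\<lambda>n. n + d) (UNIV :: int set) UNIV"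
        by (intro bij_betwI[where g = "\<lambda>n. n - d"]) auto
      from has_sum_reindex_bij_betw[OF this, of "\<lambda>n. (cmod (\<psi> n))\<^sup>2" S] S show ?thesis by simp
    qed
    let ?g = "\<lambda>n. 3 * ((cmod (\<psi> (n + 1)))\<^sup>2 + (cmod (\<psi> (n + - 1)))\<^sup>2 + lam\<^sup>2 * (cmod (\<psi> n))\<^sup>2)"
    have g: "(?g has_sum 3 * (S + S + lam\<^sup>2 * S)) UNIV"
      by (intro has_sum_cmult_right has_sum_add shift S)
    have le: "(cmod (tm_hamiltonian lam \<psi> n))\<^sup>2 \<le> ?g n" for n
    proof -
      define x y z where "x = cmod (\<psi> (n + 1))" and "y = cmod (\<psi> (n - 1))"
        and "z = \<bar>lam\<bar> * cmod (\<psi> n)"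
      have "cmod (tm_hamiltonian lam \<psi> n) \<le> x + y + z"
        unfolding tm_hamiltonian_def x_def y_def z_def
        by (intro order.trans[OF norm_triangle_ineq] add_mono norm_triangle_ineq)
           (auto simp: norm_mult tm_potential_def split: letter.split)
      then have "(cmod (tm_hamiltonian lam \<psi> n))\<^sup>2 \<le> (x + y + z)\<^sup>2"
        by (intro power_mono) auto
      also have "\<dots> \<le> 3 * (x\<^sup>2 + y\<^sup>2 + z\<^sup>2)"
      proof -
        have "0 \<le> (x - y)\<^sup>2 + (y - z)\<^sup>2 + (x - z)\<^sup>2" by simp
        then show ?thesis by (simp add: power2_eq_square algebra_simps)
      qed
      finally show ?thesis by (simp add: x_def y_def z_def power_mult_distrib)
    qed
    have "(\<lambda>n. (cmod (tm_hamiltonian lam \<psi> n))\<^sup>2) summable_on UNIV"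
      by (rule summable_on_comparison_test[OF has_sum_imp_summable[OF g]]) (use le in auto)
    moreover from this have
      "(\<Sum>\<^sub>\<infinity>n. (cmod (tm_hamiltonian lam \<psi> n))\<^sup>2) \<le> 3 * (S + S + lam\<^sup>2 * S)"
      unfolding infsumI[OF g, symmetric]
      by (intro infsum_mono has_sum_imp_summable[OF g] le)
    ultimately show ?thesis by (simp add: S_def K_def algebra_simps)
  qed
  have "ell2_norm (tm_hamiltonian lam \<psi>) \<le> sqrt K * ell2_norm \<psi>" if "\<psi> \<in> ell2" for \<psi>
    unfolding ell2_norm_def real_sqrt_mult[symmetric] using main[OF that] by simp
  then have "\<exists>C. \<forall>\<psi>\<in>ell2. ell2_norm (tm_hamiltonian lam \<psi>) \<le> C * ell2_norm \<psi>"
    by blast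
  moreover have "\<forall>\<psi>\<in>ell2. tm_hamiltonian lam \<psi> \<in> ell2"
    using main by (auto simp: ell2_def)
  ultimately show ?thesis
    unfolding bounded_op_def by (simp add: tm_hamiltonian_def algebra_simps)
qed

text \<open>The size of a covering set: its diameter to the power \<open>s\<close>, where nonempty sets have size 1
  for \<open>s = 0\<close> (\<open>0 powr 0 = 0\<close> would give singletons size 0).\<close>

definition hausdorff_gauge :: "real \<Rightarrow> 'a::metric_space set \<Rightarrow> ennreal" where
  "hausdorff_gauge s U =
     (if U = {} then 0 else if s = 0 then 1 else ennreal (diameter U powr s))"

text \<open>Covering sets are required to be bounded because \<^const>\<open>diameter\<close> is only meaningful for
  bounded sets.\<close>

definition hausdorff_premeasure :: "real \<Rightarrow> real \<Rightarrow> 'a::metric_space set \<Rightarrow> ennreal" where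
  "hausdorff_premeasure s \<delta> A =
     (INF U \<in> {U :: nat \<Rightarrow> 'a set. A \<subseteq> (\<Union>i. U i) \<and> (\<forall>i. bounded (U i) \<and> diameter (U i) \<le> \<delta>)}.
        \<Sum>i. hausdorff_gauge s (U i))"

definition hausdorff_measure :: "real \<Rightarrow> 'a::metric_space set \<Rightarrow> ennreal" where
  "hausdorff_measure s A = (SUP \<delta>\<in>{0<..}. hausdorff_premeasure s \<delta> A)"

definition hausdorff_dim :: "'a::metric_space set \<Rightarrow> ennreal" where
  "hausdorff_dim A = Inf (ennreal ` {s. 0 \<le> s \<and> hausdorff_measure s A = 0})"

end

theory Submission
  imports Defs
begin

text \<open>
  The lower bound rests on the trace map. Let \<open>x\<^sub>n\<close> be the trace of the transfer matrix over \<open>\<tau>\<^sup>n(a)\<close> as a function of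
  the energy. It satisfies \<open>x\<^sub>n\<^sub>+\<^sub>2 = 2 + x\<^sub>n\<^sup>2 (x\<^sub>n\<^sub>+\<^sub>1 - 2)\<close>; in terms of the defect \<open>d\<^sub>n = x\<^sub>n\<^sub>+\<^sub>1 - x\<^sub>n\<^sup>2 + 2\<close> this is
  \<open>x\<^sub>n\<^sub>+\<^sub>1 = x\<^sub>n\<^sup>2 - 2 + d\<^sub>n\<close>, \<open>d\<^sub>n\<^sub>+\<^sub>1 = (2 - x\<^sub>n\<^sub>+\<^sub>1) d\<^sub>n\<close> with \<open>d\<^sub>1 = - 4 \<lambda>\<^sup>2\<close> (\<open>trace_transfer_eq_orbit\<close>). Defect 0 is
  the free operator, whose trace map is angle doubling \<open>2 cos \<theta> \<mapsto> 2 cos 2\<theta>\<close> and whose spectrum is an interval.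
  The defect plays the role of a renormalised coupling, and the point is that it can be kept small along a
  set of energies of dimension close to 1.

  Which energies are in the spectrum: around the origin the sequence consists of two copies of
  \<open>\<tau>\<^sup>2\<^sup>k(a)\<close>. If \<open>\<bar>x\<^sub>2\<^sub>k\<bar> \<le> 2\<close>, a Bloch solution on these two periods, cut off by a tent, is an approximate
  eigenvector with error of order \<open>4\<^sup>-\<^sup>k\<close>. Hence an energy with \<open>\<bar>x\<^sub>2\<^sub>k\<bar> \<le> 2\<close> for infinitely many \<open>k\<close> is spectral
  (\<open>bounded_trace_in_spectrum\<close>).

  A small defect at the start: near an energy with \<open>x\<^sub>1 = 0\<close> the traces from \<open>x\<^sub>3\<close> on start close to 2, and the defect is
  multiplied by small factors many times before the trace leaves the neighbourhood of 2. This yields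
  intervals of energies on which the trace crosses \<open>[0, 1]\<close> with arbitrarily small defect
  (\<open>trace_orbit_crossing\<close>).

  Keeping it small: follow \<open>q\<close> arbitrary doublings, which multiply the defect by at most \<open>4\<^sup>q\<close>, by \<open>t\<close> doublings that
  start close to trace 2. The latter multiply it by a factor of order \<open>2\<^sup>-\<^sup>t\<^sup>*\<^sup>t\<close>, so \<open>t\<close> of order \<open>\<surd>q\<close> is enough to
  compensate. One block thus has \<open>2\<^sup>q\<close> branches up to a constant, expands by about \<open>2\<^sup>q\<^sup>+\<^sup>t\<close>, and returns to a defect
  no larger than before (\<open>trace_step_horseshoe\<close>). Iterating blocks gives a Cantor set of energies whose
  itineraries, read as base \<open>N\<close> expansions, map it onto \<open>[0, 1]\<close> with Hoelder exponent as close to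
  1 as desired (\<open>holder_onto_unit_interval\<close>). Comparing with Lebesgue measure on \<open>[0, 1]\<close> bounds the dimension
  from below (\<open>hausdorff_dim_ge_1\<close>).

  The upper bound is the inclusion of the spectrum in the real line, that is, the construction of the
  resolvent at nonreal points (\<open>tm_spectrum_real\<close>), together with \<open>hausdorff_dim_Reals_le_1\<close>.
\<close>

section \<open>Hausdorff dimension of subsets of the line\<close>

lemma hausdorff_gauge_antimono:
  assumes "0 \<le> r" "r \<le> s" "diameter U \<le> 1" "bounded U"
  shows "hausdorff_gauge s U \<le> hausdorff_gauge r U"
proof -
  have d: "0 \<le> diameter U" using assms(4) by (rule diameter_ge_0)
  have "diameter U powr s \<le> 1" using assms d by (simp add: powr_le1)
  moreover have "diameter U powr s \<le> diameter U powr r"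
    using assms d by (cases "diameter U = 0") (auto intro: powr_mono')
  ultimately show ?thesis using assms
    by (auto simp: hausdorff_gauge_def ennreal_leI)
qed

text \<open>A cover of \<open>A\<close> is pushed forward by \<open>f\<close> to a cover of the unit interval by intervals of length
  \<open>2 C (diameter U)\<^sup>s\<close>, whose total length is at least 1. This replaces the usual mass distribution
  on \<open>A\<close> by Lebesgue measure on the line. The exponent \<open>r\<close> of the gauge may be smaller than
  the Hoelder exponent because the covering sets have diameter at most 1; this is what handles \<open>r = 0\<close>.\<close>

lemma holder_onto_gauge_sum:
  fixes f :: "'a::metric_space \<Rightarrow> real"
  assumes s: "0 < s" and C: "0 < C" and r: "0 \<le> r" "r \<le> s"
    and onto: "{0..1} \<subseteq> f ` A"
    and holder: "\<And>x y. x \<in> A \<Longrightarrow> y \<in> A \<Longrightarrow> \<bar>f x - f y\<bar> \<le> C * dist x y powr s"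
    and cover: "A \<subseteq> (\<Union>i. U i)" and U: "\<And>i::nat. bounded (U i) \<and> diameter (U i) \<le> 1"
  shows "1 \<le> ennreal (2 * C) * (\<Sum>i. hausdorff_gauge r (U i))"
proof -
  define V where "V i = (if U i \<inter> A = {} then {}
     else cball (f (SOME y. y \<in> U i \<inter> A)) (C * diameter (U i) powr s))" for i
  have V: "emeasure lborel (V i) \<le> ennreal (2 * C) * hausdorff_gauge r (U i)" for i
  proof (cases "U i \<inter> A = {}")
    case False
    have d: "0 \<le> diameter (U i)" using U by (simp add: diameter_ge_0)
    have "emeasure lborel (V i) = ennreal (2 * C * diameter (U i) powr s)"
      using False d C by (simp add: V_def cball_eq_atLeastAtMost)
    also have "\<dots> = ennreal (2 * C) * ennreal (diameter (U i) powr s)"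
      using C by (simp add: ennreal_mult)
    also have "ennreal (diameter (U i) powr s) = hausdorff_gauge s (U i)"
      using False s by (auto simp: hausdorff_gauge_def)
    also have "ennreal (2 * C) * \<dots> \<le> ennreal (2 * C) * hausdorff_gauge r (U i)"
      using U r by (intro mult_left_mono hausdorff_gauge_antimono) auto
    finally show ?thesis .
  qed (simp add: V_def)
  have "{0..1} \<subseteq> (\<Union>i. V i)"
  proof
    fix c :: real assume "c \<in> {0..1}"
    then obtain x where x: "x \<in> A" "c = f x" using onto by blast
    then obtain i where i: "x \<in> U i" using cover by blast
    define y where "y = (SOME y. y \<in> U i \<inter> A)"
    have y: "y \<in> U i \<inter> A" unfolding y_def by (rule someI[of _ x]) (use x i in auto)
    have "\<bar>f x - f y\<bar> \<le> C * dist x y powr s" using holder x y by auto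
    also have "\<dots> \<le> C * diameter (U i) powr s"
      using U[of i] i y C s by (intro mult_left_mono powr_mono2 diameter_bounded_bound) auto
    finally have "c \<in> V i" using x i y
      unfolding V_def y_def[symmetric] by (auto simp: dist_real_def)
    then show "c \<in> (\<Union>i. V i)" by blast
  qed
  moreover have Vm: "range V \<subseteq> sets lborel" by (auto simp: V_def)
  ultimately have "emeasure lborel {0..1::real} \<le> emeasure lborel (\<Union>i. V i)"
    by (intro emeasure_mono) auto
  also have "\<dots> \<le> (\<Sum>i. emeasure lborel (V i))"
    using Vm by (rule emeasure_subadditive_countably)
  also have "\<dots> \<le> (\<Sum>i. ennreal (2 * C) * hausdorff_gauge r (U i))"
    by (intro suminf_le V) auto
  finally show ?thesis by simp
qed

lemma hausdorff_dim_ge_1: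
  fixes A :: "'a::metric_space set"
  assumes "\<And>s. 0 < s \<Longrightarrow> s < 1 \<Longrightarrow> \<exists>(f :: 'a \<Rightarrow> real) C B. 0 < C \<and> B \<subseteq> A \<and> {0..1} \<subseteq> f ` B \<and>
      (\<forall>x\<in>B. \<forall>y\<in>B. \<bar>f x - f y\<bar> \<le> C * dist x y powr s)"
  shows "1 \<le> hausdorff_dim A"
  unfolding hausdorff_dim_def
proof (rule Inf_greatest, clarify)
  fix r :: real assume r: "0 \<le> r" "hausdorff_measure r A = 0"
  show "1 \<le> ennreal r"
  proof (rule ccontr)
    assume "\<not> 1 \<le> ennreal r"
    then have r1: "r < 1" using r(1) by (simp add: not_le)
    \<comment> \<open>the Hoelder exponent must be positive, whereas \<open>r\<close> may be 0\<close>
    define s where "s = max r (1/2)"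
    have s: "0 < s" "s < 1" "r \<le> s" using r1 by (auto simp: s_def)
    from assms[OF s(1,2)] obtain f :: "'a \<Rightarrow> real" and C B where f: "0 < C" "B \<subseteq> A" "{0..1} \<subseteq> f ` B"
      "\<And>x y. x \<in> B \<Longrightarrow> y \<in> B \<Longrightarrow> \<bar>f x - f y\<bar> \<le> C * dist x y powr s" by blast
    have "ennreal (1 / (2 * C)) \<le> hausdorff_premeasure r 1 A"
      unfolding hausdorff_premeasure_def
    proof (rule INF_greatest)
      fix U :: "nat \<Rightarrow> 'a set"
      assume "U \<in> {U. A \<subseteq> (\<Union>i. U i) \<and> (\<forall>i. bounded (U i) \<and> diameter (U i) \<le> 1)}"
      then have "1 \<le> ennreal (2 * C) * (\<Sum>i. hausdorff_gauge r (U i))"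
        using f(2) by (intro holder_onto_gauge_sum[OF s(1) f(1) r(1) s(3) f(3,4)]) auto
      then have "ennreal (1 / (2 * C)) * 1 \<le>
          ennreal (1 / (2 * C)) * (ennreal (2 * C) * (\<Sum>i. hausdorff_gauge r (U i)))"
        by (intro mult_left_mono) auto
      also have "\<dots> = ennreal (1 / (2 * C) * (2 * C)) * (\<Sum>i. hausdorff_gauge r (U i))"
        using f(1) by (subst ennreal_mult) (auto simp: mult.assoc)
      finally show "ennreal (1 / (2 * C)) \<le> (\<Sum>i. hausdorff_gauge r (U i))"
        using f(1) by simp
    qed
    also have "\<dots> \<le> hausdorff_measure r A"
      unfolding hausdorff_measure_def by (rule SUP_upper) simp
    finally show False using r f(1) by (simp add: ennreal_eq_0_iff[symmetric] not_le)
  qed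
qed

text \<open>Divergence of the harmonic series lets intervals of lengths \<open>e, e/2, e/3, \<dots>\<close> laid end to end cover a
  half line, while the sum of their \<open>s\<close>-th powers is finite for each \<open>s > 1\<close>. Even indices cover the
  positive half line and odd indices the negative one.\<close>

lemma harmonic_cover:
  assumes e: "0 < (e::real)"
  shows "\<exists>U :: nat \<Rightarrow> complex set. \<real> \<subseteq> (\<Union>i. U i) \<and> (\<forall>i. U i \<noteq> {} \<and> bounded (U i)
     \<and> diameter (U i) \<le> e * (2 / real (Suc i)))"
proof -
  define h :: "nat \<Rightarrow> real" where "h k = (\<Sum>j<k. e / real (Suc j))" for k
  define I where "I a b = complex_of_real ` {a..b}" for a b
  define U where "U i = (if even i then I (h (i div 2)) (h (Suc (i div 2)))
     else I (- h (Suc (i div 2))) (- h (i div 2)))" for i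
  have hS: "h (Suc k) = h k + e / real (Suc k)" for k by (simp add: h_def)
  have cover: "\<exists>k. x \<in> {h k..h (Suc k)}" if "0 \<le> x" for x
  proof -
    have "\<exists>k. x < h k"
    proof (rule ccontr)
      assume "\<not> (\<exists>k. x < h k)"
      then have le: "h k \<le> x" for k by (simp add: not_less)
      have "summable (\<lambda>j. e / real (Suc j))"
        using e by (intro bounded_imp_summable[where B = x]) (use le[of "Suc _"] in \<open>auto simp: h_def lessThan_Suc_atMost simp del: of_nat_Suc\<close>)
      then have "summable (\<lambda>j. (1/e) * (e / real (Suc j)))" by (rule summable_mult)
      then have "summable (\<lambda>j. inverse (real (Suc j)))" using e by (simp add: field_simps)
      then show False using not_summable_harmonic[where 'a = real] by (subst (asm) summable_Suc_iff) simp
    qed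
    then have ex: "x < h (LEAST k. x < h k)" by (rule LeastI_ex)
    define k where "k = (LEAST k. x < h k)"
    have xk: "x < h k" using ex unfolding k_def .
    have "k \<noteq> 0" using xk that by (cases k) (auto simp: h_def)
    then obtain j where j: "k = Suc j" using not0_implies_Suc by blast
    have "\<not> x < h j" using not_less_Least[of j "\<lambda>k. x < h k"] j k_def by simp
    then show ?thesis using xk j by (intro exI[of _ j]) auto
  qed
  have diam: "bounded (I a b) \<and> diameter (I a b) \<le> b - a" if "a \<le> b" for a b
  proof
    have d: "dist x y \<le> b - a" if xy: "x \<in> I a b" "y \<in> I a b" for x y
    proof -
      obtain s t where st: "x = of_real s" "y = of_real t" "s \<in> {a..b}" "t \<in> {a..b}"
        using xy unfolding I_def by blast
      have "dist x y = \<bar>s - t\<bar>" using st by (simp add: dist_norm flip: of_real_diff)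
      then show ?thesis using st by auto
    qed
    show "bounded (I a b)" using d unfolding bounded_def by (cases "I a b = {}") blast+
    show "diameter (I a b) \<le> b - a"
      by (intro diameter_le) (use \<open>a \<le> b\<close> d in \<open>auto simp flip: dist_norm\<close>)
  qed
  have mono: "h k \<le> h (Suc k)" for k using hS[of k] e by simp
  show ?thesis
  proof (intro exI[of _ U] conjI allI)
    show "\<real> \<subseteq> (\<Union>i. U i)"
    proof
      fix z :: complex assume "z \<in> \<real>"
      then obtain x where x: "z = of_real x" by (auto elim: Reals_cases)
      show "z \<in> (\<Union>i. U i)"
      proof (cases "0 \<le> x")
        case True
        then obtain k where "x \<in> {h k..h (Suc k)}" using cover by blast
        then have "z \<in> U (2 * k)" by (auto simp: U_def I_def x)
        then show ?thesis by blast
      next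
        case False
        then obtain k where "-x \<in> {h k..h (Suc k)}" using cover[of "-x"] by auto
        then have "z \<in> U (2 * k + 1)" by (auto simp: U_def I_def x)
        then show ?thesis by blast
      qed
    qed
  next
    fix i
    have "diameter (U i) \<le> e / real (Suc (i div 2))"
      using diam[OF mono, of "i div 2"] diam[of "- h (Suc (i div 2))" "- h (i div 2)"] mono[of "i div 2"]
        hS[of "i div 2"] by (auto simp: U_def)
    also have "\<dots> \<le> e * (2 / real (Suc i))"
    proof -
      have "Suc i \<le> 2 * Suc (i div 2)" by presburger
      then have "real (Suc i) \<le> 2 * real (Suc (i div 2))" by linarith
      then have "e * real (Suc i) \<le> e * (2 * real (Suc (i div 2)))" using e by (intro mult_left_mono) auto
      then show ?thesis by (simp add: field_simps)
    qed
    finally show "diameter (U i) \<le> e * (2 / real (Suc i))" .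
    show "U i \<noteq> {}" using mono by (auto simp: U_def I_def)
    show "bounded (U i)" using diam mono by (auto simp: U_def)
  qed
qed

text \<open>The \<open>s\<close>-th powers of the diameters in the harmonic cover add up to \<open>e\<^sup>s\<close> times a constant, which tends to 0
  with \<open>e\<close>.\<close>

lemma hausdorff_dim_Reals_le_1:
  fixes A :: "complex set"
  assumes "A \<subseteq> \<real>"
  shows "hausdorff_dim A \<le> 1"
proof -
  have zero: "hausdorff_measure s A = 0" if s: "1 < s" for s
  proof -
    have sm: "summable (\<lambda>i. (2 / real (Suc i)) powr s)"
    proof -
      have "summable (\<lambda>i. real i powr (- s))" using s by (simp add: summable_real_powr_iff)
      then have "summable (\<lambda>i. real (Suc i) powr (- s))" by (subst summable_Suc_iff)
      then have "summable (\<lambda>i. 2 powr s * real (Suc i) powr (- s))" by (rule summable_mult)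
      then show ?thesis by (simp add: powr_divide powr_minus_divide)
    qed
    define Z where "Z = (\<Sum>i. (2 / real (Suc i)) powr s)"
    have Z: "0 \<le> Z" unfolding Z_def by (intro suminf_nonneg sm) auto
    have small: "hausdorff_premeasure s \<delta> A \<le> ennreal (e powr s * Z)" if "0 < \<delta>" "0 < e" "2 * e \<le> \<delta>" for \<delta> e
    proof -
      obtain U :: "nat \<Rightarrow> complex set" where U: "\<real> \<subseteq> (\<Union>i. U i)"
        "\<And>i. U i \<noteq> {} \<and> bounded (U i) \<and> diameter (U i) \<le> e * (2 / real (Suc i))"
        using harmonic_cover[OF \<open>0 < e\<close>] by blast
      have "e * (2 / real (Suc i)) \<le> \<delta>" for i
      proof -
        have "e * (2 / real (Suc i)) \<le> e * 2" using that by (intro mult_left_mono) (auto simp: field_simps)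
        then show ?thesis using that by simp
      qed
      then have "bounded (U i) \<and> diameter (U i) \<le> \<delta>" for i
        using U(2)[of i] by (meson order_trans)
      then have "U \<in> {U. A \<subseteq> (\<Union>i. U i) \<and> (\<forall>i. bounded (U i) \<and> diameter (U i) \<le> \<delta>)}"
        using assms U(1) by blast
      then have "hausdorff_premeasure s \<delta> A \<le> (\<Sum>i. hausdorff_gauge s (U i))"
        unfolding hausdorff_premeasure_def by (rule INF_lower)
      also have "\<dots> \<le> (\<Sum>i. ennreal (e powr s * (2 / real (Suc i)) powr s))"
      proof (intro suminf_le)
        fix i
        have "diameter (U i) powr s \<le> (e * (2 / real (Suc i))) powr s"
          using U(2)[of i] s by (intro powr_mono2) (auto intro: diameter_ge_0)
        also have "\<dots> = e powr s * (2 / real (Suc i)) powr s"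
          using \<open>0 < e\<close> by (subst powr_mult) auto
        finally show "hausdorff_gauge s (U i) \<le> ennreal (e powr s * (2 / real (Suc i)) powr s)"
          using s by (auto simp: hausdorff_gauge_def intro: ennreal_leI)
      qed auto
      also have "\<dots> = ennreal (\<Sum>i. e powr s * (2 / real (Suc i)) powr s)"
        by (intro suminf_ennreal2 summable_mult sm) auto
      also have "\<dots> = ennreal (e powr s * Z)"
        unfolding Z_def using sm by (subst suminf_mult) auto
      finally show ?thesis .
    qed
    have "hausdorff_premeasure s \<delta> A = 0" if d: "0 < \<delta>" for \<delta>
    proof -
      have "hausdorff_premeasure s \<delta> A \<le> ennreal x" if x: "0 < x" for x
      proof -
        \<comment> \<open>the second entry makes \<open>e powr s * Z\<close> at most
          \<open>x\<close>\<close>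
        define e where "e = min (\<delta> / 2) ((x / (Z + 1)) powr (1 / s))"
        have e: "0 < e" "2 * e \<le> \<delta>" using d x Z by (auto simp: e_def)
        have "e powr s \<le> ((x / (Z + 1)) powr (1 / s)) powr s"
          using e s by (intro powr_mono2) (auto simp: e_def)
        also have "\<dots> = x / (Z + 1)" using x Z s by (simp add: powr_powr)
        finally have "e powr s * Z \<le> x / (Z + 1) * Z" using Z by (intro mult_right_mono) auto
        also have "\<dots> \<le> x" using x Z by (simp add: field_simps)
        finally show ?thesis using small[OF d e] by (meson ennreal_leI order_trans)
      qed
      then have "hausdorff_premeasure s \<delta> A \<le> 0 + ennreal x" if "0 < x" for x
        using that by (metis add_0)
      then have "hausdorff_premeasure s \<delta> A \<le> 0" by (rule ennreal_le_epsilon)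
      then show ?thesis by (simp only: le_zero_eq)
    qed
    then have "hausdorff_measure s A \<le> 0"
      unfolding hausdorff_measure_def by (intro SUP_least) auto
    then show ?thesis by (simp only: le_zero_eq)
  qed
  show ?thesis
  proof (rule dense_ge)
    fix c :: ennreal assume c: "1 < c"
    obtain s where s: "1 < s" "ennreal s \<le> c"
    proof (cases c)
      case (real r)
      then show ?thesis using c that[of r] by (metis ennreal_1 ennreal_less_iff order_refl zero_le_one)
    next
      case top
      then show ?thesis using that[of 2] by simp
    qed
    have "hausdorff_dim A \<le> ennreal s"
      unfolding hausdorff_dim_def using zero[OF s(1)] s(1) by (intro Inf_lower) auto
    then show "hausdorff_dim A \<le> c" using s(2) by (rule order_trans)
  qed
qed

section \<open>Reality of the spectrum\<close>

lemma ell2_norm_nonneg: "0 \<le> ell2_norm \<psi>"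
  unfolding ell2_norm_def by (simp add: infsum_nonneg)

lemma L2_set_le_ell2_norm:
  assumes "\<psi> \<in> ell2" "finite F"
  shows "L2_set (\<lambda>n. cmod (\<psi> n)) F \<le> ell2_norm \<psi>"
  unfolding L2_set_def ell2_norm_def
  by (intro real_sqrt_le_mono finite_sum_le_infsum) (use assms in \<open>auto simp: ell2_def\<close>)

text \<open>Membership in \<open>\<ell>\<^sup>2\<close> and norm bounds are tested on finite sets of sites, where Minkowski's inequality
  is available; all norm estimates below go through this criterion.\<close>

lemma ell2_normI:
  assumes "0 \<le> c" "\<And>F. finite F \<Longrightarrow> L2_set (\<lambda>n. cmod (\<psi> n)) F \<le> c"
  shows "\<psi> \<in> ell2 \<and> ell2_norm \<psi> \<le> c"
proof -
  have le: "(\<Sum>n\<in>F. (cmod (\<psi> n))\<^sup>2) \<le> c\<^sup>2" if "finite F" for F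
  proof -
    have "(L2_set (\<lambda>n. cmod (\<psi> n)) F)\<^sup>2 \<le> c\<^sup>2"
      using assms(2)[OF that] by (intro power_mono) auto
    then show ?thesis by (simp add: L2_set_def sum_nonneg)
  qed
  have sm: "(\<lambda>n. (cmod (\<psi> n))\<^sup>2) summable_on UNIV"
    using le by (intro nonneg_bdd_above_summable_on) (auto intro!: bdd_aboveI)
  have "(\<Sum>\<^sub>\<infinity>n. (cmod (\<psi> n))\<^sup>2) \<le> c\<^sup>2"
    using sm le by (rule infsum_le_finite_sums)
  then have "ell2_norm \<psi> \<le> c"
    unfolding ell2_norm_def using assms(1) by (metis real_sqrt_le_mono real_sqrt_pow2_iff real_sqrt_power real_sqrt_unique)
  with sm show ?thesis by (simp add: ell2_def)
qed

lemma cmod_le_ell2_norm: "\<psi> \<in> ell2 \<Longrightarrow> cmod (\<psi> n) \<le> ell2_norm \<psi>"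
  using L2_set_le_ell2_norm[of \<psi> "{n}"] by simp

lemma ell2_norm_sq: "\<psi> \<in> ell2 \<Longrightarrow> ((\<lambda>n. (cmod (\<psi> n))\<^sup>2) has_sum (ell2_norm \<psi>)\<^sup>2) UNIV"
  by (simp add: ell2_def ell2_norm_def infsum_nonneg)

lemma ell2_norm_eq_0D: "\<psi> \<in> ell2 \<Longrightarrow> ell2_norm \<psi> \<le> 0 \<Longrightarrow> \<psi> = (\<lambda>n. 0)"
proof
  fix n assume "\<psi> \<in> ell2" "ell2_norm \<psi> \<le> 0"
  then show "\<psi> n = 0" using cmod_le_ell2_norm[of \<psi> n] by (metis norm_le_zero_iff order_trans)
qed

lemma ell2_add:
  assumes "\<phi> \<in> ell2" "\<psi> \<in> ell2"
  shows "(\<lambda>n. \<phi> n + \<psi> n) \<in> ell2 \<and> ell2_norm (\<lambda>n. \<phi> n + \<psi> n) \<le> ell2_norm \<phi> + ell2_norm \<psi>"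
proof (rule ell2_normI)
  fix F :: "int set" assume F: "finite F"
  have "L2_set (\<lambda>n. cmod (\<phi> n + \<psi> n)) F \<le> L2_set (\<lambda>n. cmod (\<phi> n) + cmod (\<psi> n)) F"
    by (intro L2_set_mono) (auto intro: norm_triangle_ineq)
  also have "\<dots> \<le> L2_set (\<lambda>n. cmod (\<phi> n)) F + L2_set (\<lambda>n. cmod (\<psi> n)) F"
    by (rule L2_set_triangle_ineq)
  finally show "L2_set (\<lambda>n. cmod (\<phi> n + \<psi> n)) F \<le> ell2_norm \<phi> + ell2_norm \<psi>"
    using assms[THEN L2_set_le_ell2_norm, OF F] by linarith
qed (simp add: ell2_norm_nonneg)

lemma ell2_scale:
  assumes "\<psi> \<in> ell2"
  shows "(\<lambda>n. c * \<psi> n) \<in> ell2 \<and> ell2_norm (\<lambda>n. c * \<psi> n) \<le> cmod c * ell2_norm \<psi>"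
proof (rule ell2_normI)
  fix F :: "int set" assume F: "finite F"
  show "L2_set (\<lambda>n. cmod (c * \<psi> n)) F \<le> cmod c * ell2_norm \<psi>"
    using L2_set_le_ell2_norm[OF assms F]
    by (simp add: norm_mult mult_left_mono flip: L2_set_right_distrib)
qed (simp add: ell2_norm_nonneg)

lemma ell2_diff:
  assumes "\<phi> \<in> ell2" "\<psi> \<in> ell2"
  shows "(\<lambda>n. \<phi> n - \<psi> n) \<in> ell2 \<and> ell2_norm (\<lambda>n. \<phi> n - \<psi> n) \<le> ell2_norm \<phi> + ell2_norm \<psi>"
  using ell2_add[OF assms(1), of "\<lambda>n. (-1) * \<psi> n"] ell2_scale[OF assms(2), of "-1"] by simp

text \<open>Only the real part of the inner product is needed: it determines the norm, and the operator
  \<open>A = H - x\<close> with \<open>x\<close> real is symmetric for it.\<close>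

lemma ell2_product_summable:
  assumes "\<phi> \<in> ell2" "\<psi> \<in> ell2"
  shows "(\<lambda>n. Re (cnj (\<phi> n) * \<psi> n)) summable_on UNIV"
proof (rule abs_summable_summable, rule Infinite_Sum.abs_summable_on_comparison_test')
  show "(\<lambda>n. (cmod (\<phi> n))\<^sup>2 + (cmod (\<psi> n))\<^sup>2) summable_on UNIV"
    using assms by (auto simp: ell2_def intro: summable_on_add)
  fix n
  have "\<bar>Re (cnj (\<phi> n) * \<psi> n)\<bar> \<le> cmod (\<phi> n) * cmod (\<psi> n)"
    using abs_Re_le_cmod[of "cnj (\<phi> n) * \<psi> n"] by (simp add: norm_mult)
  also have "\<dots> \<le> (cmod (\<phi> n))\<^sup>2 + (cmod (\<psi> n))\<^sup>2"
    using sum_squares_bound[of "cmod (\<phi> n)" "cmod (\<psi> n)"]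
      mult_nonneg_nonneg[OF norm_ge_zero[of "\<phi> n"] norm_ge_zero[of "\<psi> n"]] by linarith
  finally show "norm (Re (cnj (\<phi> n) * \<psi> n)) \<le> (cmod (\<phi> n))\<^sup>2 + (cmod (\<psi> n))\<^sup>2" by simp
qed

lemma has_sum_int_shift:
  fixes f :: "int \<Rightarrow> 'a::{comm_monoid_add,topological_space}"
  assumes "(f has_sum S) UNIV"
  shows "((\<lambda>n. f (n + d)) has_sum S) UNIV"
proof -
  have "bij_betw (\<lambda>n. n + d) (UNIV :: int set) UNIV"
    by (intro bij_betwI[where g = "\<lambda>n. n - d"]) auto
  from has_sum_reindex_bij_betw[OF this, of f S] assms show ?thesis by simp
qed

lemma ell2_shift: "\<psi> \<in> ell2 \<Longrightarrow> (\<lambda>n. \<psi> (n + d)) \<in> ell2"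
  unfolding ell2_def using has_sum_int_shift[of "\<lambda>n. (cmod (\<psi> n))\<^sup>2" _ d]
  by (auto simp: summable_on_def)

text \<open>Summation by parts: the two hopping terms are exchanged by a unit shift of the lattice, and the diagonal
  term is real.\<close>

lemma tm_hamiltonian_symmetric:
  fixes x lam :: real
  assumes "\<phi> \<in> ell2" "\<psi> \<in> ell2"
  defines "A \<equiv> op_shift (tm_hamiltonian lam) (complex_of_real x)"
  shows "(\<Sum>\<^sub>\<infinity>n. Re (cnj (\<phi> n) * A \<psi> n)) = (\<Sum>\<^sub>\<infinity>n. Re (cnj (A \<phi> n) * \<psi> n))"
proof -
  define w where "w n = tm_potential lam n - x" for n
  have A: "A \<psi> n = \<psi> (n + 1) + \<psi> (n + -1) + w n * \<psi> n" for \<psi> :: "int \<Rightarrow> complex" and n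
    by (simp add: A_def op_shift_def tm_hamiltonian_def w_def algebra_simps)
  have bd: "\<bar>w n\<bar> \<le> \<bar>lam\<bar> + \<bar>x\<bar>" for n
    by (auto simp: w_def tm_potential_def split: letter.split)
  define p where "p d n = Re (cnj (\<phi> n) * \<psi> (n + d))" for d n
  define P where "P d = infsum (p d) UNIV" for d
  have P: "(p d has_sum P d) UNIV" for d
    unfolding P_def p_def[abs_def]
    by (intro has_sum_infsum ell2_product_summable assms(1) ell2_shift assms(2))
  have 0: "(\<lambda>n. norm (p 0 n)) summable_on UNIV"
    using P[of 0] by (intro summable_on_iff_abs_summable_on_real[THEN iffD1]) (auto simp: summable_on_def)
  have "(\<lambda>n. w n * p 0 n) summable_on UNIV"
  proof (rule abs_summable_summable, rule Infinite_Sum.abs_summable_on_comparison_test')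
    show "(\<lambda>n. (\<bar>lam\<bar> + \<bar>x\<bar>) * norm (p 0 n)) summable_on UNIV"
      using 0 by (rule summable_on_cmult_right)
    show "norm (w n * p 0 n) \<le> (\<bar>lam\<bar> + \<bar>x\<bar>) * norm (p 0 n)" for n
      using bd[of n] by (simp add: abs_mult mult_right_mono)
  qed
  then obtain W where W: "((\<lambda>n. w n * p 0 n) has_sum W) UNIV" by (auto simp: summable_on_def)
  have "((\<lambda>n. p 1 n + p (-1) n + w n * p 0 n) has_sum (P 1 + P (-1) + W)) UNIV"
    by (intro has_sum_add P W)
  then have 1: "((\<lambda>n. Re (cnj (\<phi> n) * A \<psi> n)) has_sum (P 1 + P (-1) + W)) UNIV"
    unfolding A p_def by (simp add: algebra_simps)
  have "((\<lambda>n. p 1 (n + -1) + p (-1) (n + 1) + w n * p 0 n) has_sum (P 1 + P (-1) + W)) UNIV"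
    by (intro has_sum_add has_sum_int_shift P W)
  then have 2: "((\<lambda>n. Re (cnj (A \<phi> n) * \<psi> n)) has_sum (P 1 + P (-1) + W)) UNIV"
    unfolding A p_def by (simp add: algebra_simps)
  from 1 2 show ?thesis by (simp add: infsumI)
qed

lemma op_shift_bounded:
  assumes "bounded_op T"
  shows "\<exists>C\<ge>0. \<forall>\<psi>\<in>ell2. op_shift T z \<psi> \<in> ell2 \<and> ell2_norm (op_shift T z \<psi>) \<le> C * ell2_norm \<psi>"
proof -
  obtain C where C: "\<And>\<psi>. \<psi> \<in> ell2 \<Longrightarrow> T \<psi> \<in> ell2 \<and> ell2_norm (T \<psi>) \<le> C * ell2_norm \<psi>"
    using assms unfolding bounded_op_def by blast
  have "op_shift T z \<psi> \<in> ell2 \<and> ell2_norm (op_shift T z \<psi>) \<le> (\<bar>C\<bar> + cmod z) * ell2_norm \<psi>"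
    if "\<psi> \<in> ell2" for \<psi>
  proof -
    have "C * ell2_norm \<psi> \<le> \<bar>C\<bar> * ell2_norm \<psi>" by (intro mult_right_mono ell2_norm_nonneg) auto
    then show ?thesis
      using C[OF that] ell2_scale[OF that, of z] ell2_diff[of "T \<psi>" "\<lambda>n. z * \<psi> n"]
      unfolding op_shift_def by (auto simp: distrib_right)
  qed
  then show ?thesis by (intro exI[of _ "\<bar>C\<bar> + cmod z"]) auto
qed

text \<open>For \<open>z = x + i y\<close> the product \<open>(H - z)(H - cnj z)\<close> equals \<open>P = A\<^sup>2 + y\<^sup>2\<close>. By symmetry of \<open>A\<close> the quadratic
  form of \<open>P\<close> is at least \<open>y\<^sup>2\<close> times the squared norm, so that \<open>1 - t P\<close> is a strict contraction for small \<open>t > 0\<close>.\<close>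

lemma neumann_contraction:
  fixes x y lam :: real and A :: "(int \<Rightarrow> complex) \<Rightarrow> int \<Rightarrow> complex"
  assumes y: "y \<noteq> 0"
  defines "A \<equiv> op_shift (tm_hamiltonian lam) (complex_of_real x)"
  obtains t \<rho> :: real where "0 < t" "0 \<le> \<rho>" "\<rho> < 1"
    "\<And>\<psi> :: int \<Rightarrow> complex. \<psi> \<in> ell2 \<Longrightarrow> (\<lambda>n. \<psi> n - t * (A (A \<psi>) n + y\<^sup>2 * \<psi> n)) \<in> ell2 \<and>
       ell2_norm (\<lambda>n. \<psi> n - t * (A (A \<psi>) n + y\<^sup>2 * \<psi> n)) \<le> \<rho> * ell2_norm \<psi>"
proof -
  obtain C where C: "0 \<le> C" "\<And>\<psi>. \<psi> \<in> ell2 \<Longrightarrow> A \<psi> \<in> ell2 \<and> ell2_norm (A \<psi>) \<le> C * ell2_norm \<psi>"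
    using op_shift_bounded[OF bounded_op_tm_hamiltonian] unfolding A_def by blast
  define P where "P \<psi> n = A (A \<psi>) n + y\<^sup>2 * \<psi> n" for \<psi> :: "int \<Rightarrow> complex" and n
  define Q where "Q = C\<^sup>2 + y\<^sup>2"
  have Q: "0 < y\<^sup>2" "y\<^sup>2 \<le> Q" using y by (auto simp: Q_def)
  have P: "P \<psi> \<in> ell2 \<and> ell2_norm (P \<psi>) \<le> Q * ell2_norm \<psi>" if "\<psi> \<in> ell2" for \<psi>
  proof -
    have "ell2_norm (A (A \<psi>)) \<le> C * (C * ell2_norm \<psi>)"
      using C(2)[OF that] C(2)[of "A \<psi>"] C(1) by (meson mult_left_mono order_trans)
    then show ?thesis
      using ell2_add[of "A (A \<psi>)" "\<lambda>n. y\<^sup>2 * \<psi> n"] C(2)[OF that] C(2)[of "A \<psi>"]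
        ell2_scale[OF that, of "y\<^sup>2"]
      unfolding P_def[abs_def] Q_def by (auto simp: power2_eq_square distrib_right norm_mult)
  qed
  \<comment> \<open>this \<open>t\<close> minimises the bound \<open>1 - 2 t y\<^sup>2 + t\<^sup>2
    Q\<^sup>2\<close> for the squared contraction factor\<close>
  define t where "t = y\<^sup>2 / Q\<^sup>2"
  define \<rho> where "\<rho> = sqrt (1 - (y\<^sup>2)\<^sup>2 / Q\<^sup>2)"
  have "0 < Q" using Q by linarith
  then have "0 < Q\<^sup>2" by simp
  then have t: "0 < t" using Q(1) unfolding t_def by (rule divide_pos_pos[rotated])
  have "(y\<^sup>2)\<^sup>2 \<le> Q\<^sup>2" using Q by (intro power_mono) auto
  then have r0: "0 \<le> 1 - (y\<^sup>2)\<^sup>2 / Q\<^sup>2"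
    using \<open>0 < Q\<^sup>2\<close> by (simp only: diff_ge_0_iff_ge divide_le_eq_1_pos)
  have "0 < (y\<^sup>2)\<^sup>2 / Q\<^sup>2" using \<open>0 < Q\<^sup>2\<close> Q(1)
    by (intro divide_pos_pos) (auto intro: zero_less_power simp del: zero_less_power2)
  then have \<rho>: "0 \<le> \<rho>" "\<rho> < 1" unfolding \<rho>_def using r0 by (simp_all only: real_sqrt_ge_0_iff real_sqrt_lt_1_iff)
  have main: "(\<lambda>n. \<psi> n - t * P \<psi> n) \<in> ell2 \<and> ell2_norm (\<lambda>n. \<psi> n - t * P \<psi> n) \<le> \<rho> * ell2_norm \<psi>"
    if \<psi>: "\<psi> \<in> ell2" for \<psi>
  proof
    show mem: "(\<lambda>n. \<psi> n - t * P \<psi> n) \<in> ell2"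
      using ell2_diff[OF \<psi>] ell2_scale P[OF \<psi>] by blast
    define N where "N = (ell2_norm \<psi>)\<^sup>2"
    have A: "A \<psi> \<in> ell2" "A (A \<psi>) \<in> ell2" using C(2) \<psi> by auto
    define a where "a = (\<Sum>\<^sub>\<infinity>n. Re (cnj (\<psi> n) * A (A \<psi>) n))"
    have "a = (\<Sum>\<^sub>\<infinity>n. Re (cnj (A \<psi> n) * A \<psi> n))"
      unfolding a_def A_def by (rule tm_hamiltonian_symmetric[OF \<psi>]) (use A in \<open>simp add: A_def\<close>)
    also have "\<dots> \<ge> 0" by (intro infsum_nonneg) (simp add: mult.commute[of "cnj _"] complex_mult_cnj)
    finally have a: "0 \<le> a" .
    have "((\<lambda>n. Re (cnj (\<psi> n) * A (A \<psi>) n)) has_sum a) UNIV"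
      using ell2_product_summable[OF \<psi> A(2)] by (simp add: a_def)
    then have "((\<lambda>n. (cmod (\<psi> n))\<^sup>2 + (-2 * t) * (Re (cnj (\<psi> n) * A (A \<psi>) n) + y\<^sup>2 * (cmod (\<psi> n))\<^sup>2)
         + t\<^sup>2 * (cmod (P \<psi> n))\<^sup>2) has_sum
        (N + (-2 * t) * (a + y\<^sup>2 * N) + t\<^sup>2 * (ell2_norm (P \<psi>))\<^sup>2)) UNIV"
      unfolding N_def using ell2_norm_sq[OF \<psi>] ell2_norm_sq[of "P \<psi>"] P[OF \<psi>]
      by (intro has_sum_add has_sum_cmult_right) auto
    moreover have "(cmod (\<psi> n))\<^sup>2 + (-2 * t) * (Re (cnj (\<psi> n) * A (A \<psi>) n) + y\<^sup>2 * (cmod (\<psi> n))\<^sup>2)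
         + t\<^sup>2 * (cmod (P \<psi> n))\<^sup>2 = (cmod (\<psi> n - t * P \<psi> n))\<^sup>2" for n
      unfolding P_def cmod_power2 by (simp add: power2_eq_square algebra_simps)
    ultimately have "(ell2_norm (\<lambda>n. \<psi> n - t * P \<psi> n))\<^sup>2 =
        N + (-2 * t) * (a + y\<^sup>2 * N) + t\<^sup>2 * (ell2_norm (P \<psi>))\<^sup>2"
      using ell2_norm_sq[OF mem] by (metis (no_types, lifting) ext infsumI)
    also have "\<dots> \<le> N + (-2 * t) * (0 + y\<^sup>2 * N) + t\<^sup>2 * (Q * ell2_norm \<psi>)\<^sup>2"
      using P[OF \<psi>] t a by (intro add_mono mult_left_mono mult_left_mono_neg power_mono ell2_norm_nonneg) auto
    also have "\<dots> = (1 - (y\<^sup>2)\<^sup>2 / Q\<^sup>2) * N"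
      using Q by (simp add: t_def N_def field_simps power2_eq_square)
    also have "\<dots> = (\<rho> * ell2_norm \<psi>)\<^sup>2" using r0 by (simp add: \<rho>_def N_def power_mult_distrib)
    finally show "ell2_norm (\<lambda>n. \<psi> n - t * P \<psi> n) \<le> \<rho> * ell2_norm \<psi>"
      by (rule power2_le_imp_le) (simp add: \<rho> ell2_norm_nonneg)
  qed
  show ?thesis by (rule that[OF t \<rho>]) (rule main[unfolded P_def])
qed

text \<open>With \<open>K = 1 - t P\<close>, the Neumann series \<open>S = \<Sum> K\<^sup>j\<close> inverts \<open>t P\<close>, and \<open>t (H - cnj z) S\<close> is the resolvent at \<open>z\<close>.
  The series is summed pointwise: \<open>H\<close> couples each site to its neighbours only, so it commutes with
  pointwise limits.\<close>

lemma tm_spectrum_real: "op_spectrum (tm_hamiltonian lam) \<subseteq> \<real>"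
proof
  fix z assume z: "z \<in> op_spectrum (tm_hamiltonian lam)"
  show "z \<in> \<real>"
  proof (rule ccontr)
    assume "z \<notin> \<real>"
    define x y where "x = Re z" and "y = Im z"
    have y: "y \<noteq> 0" using \<open>z \<notin> \<real>\<close> by (simp add: y_def complex_is_Real_iff)
    have zxy: "z = of_real x + \<i> * of_real y" by (simp add: x_def y_def complex_eq)
    define T where "T = tm_hamiltonian lam"
    define A where "A = op_shift T (complex_of_real x)"
    define B where "B = op_shift T z"
    define B' where "B' = op_shift T (cnj z)"
    obtain t \<rho> :: real where t: "0 < t" "0 \<le> \<rho>" "\<rho> < 1"
      "\<And>\<psi> :: int \<Rightarrow> complex. \<psi> \<in> ell2 \<Longrightarrow> (\<lambda>n. \<psi> n - t * (A (A \<psi>) n + y\<^sup>2 * \<psi> n)) \<in> ell2 \<and>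
       ell2_norm (\<lambda>n. \<psi> n - t * (A (A \<psi>) n + y\<^sup>2 * \<psi> n)) \<le> \<rho> * ell2_norm \<psi>"
      apply (rule neumann_contraction[OF y, of lam x, folded T_def, folded A_def])
      subgoal premises p for t \<rho> by (rule p(1)[OF p(2-5)])
      done
    define K where "K \<psi> n = \<psi> n - t * (A (A \<psi>) n + y\<^sup>2 * \<psi> n)" for \<psi> :: "int \<Rightarrow> complex" and n
    have K: "K \<psi> \<in> ell2 \<and> ell2_norm (K \<psi>) \<le> \<rho> * ell2_norm \<psi>" if "\<psi> \<in> ell2" for \<psi>
      using t(4)[OF that] unfolding K_def[abs_def] .
    have Kj: "(K ^^ j) \<psi> \<in> ell2 \<and> ell2_norm ((K ^^ j) \<psi>) \<le> \<rho> ^ j * ell2_norm \<psi>" if "\<psi> \<in> ell2" for j \<psi>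
    proof (induction j)
      case (Suc j)
      then have "ell2_norm (K ((K ^^ j) \<psi>)) \<le> \<rho> * (\<rho> ^ j * ell2_norm \<psi>)"
        using K[of "(K ^^ j) \<psi>"] t(2) by (meson mult_left_mono order_trans)
      with Suc K show ?case by (simp add: mult.assoc)
    qed (simp add: that)
    have BB: "B (B' \<psi>) n = A (A \<psi>) n + y\<^sup>2 * \<psi> n" "B' (B \<psi>) n = A (A \<psi>) n + y\<^sup>2 * \<psi> n" for \<psi> :: "int \<Rightarrow> complex" and n
      by (simp_all add: B_def B'_def A_def op_shift_def T_def tm_hamiltonian_def zxy algebra_simps
            power2_eq_square)
    \<comment> \<open>\<open>A\<close> and \<open>K\<close> have finite range and hence pass through
      pointwise sums\<close>
    have A_sums: "(\<lambda>j. A (g j) n) sums A G n" if "\<And>m. (\<lambda>j. g j m) sums G m" for g G n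
      unfolding A_def op_shift_def T_def tm_hamiltonian_def
      by (intro sums_add sums_diff sums_mult that)
    have K_sums: "(\<lambda>j. K (g j) n) sums K G n" if "\<And>m. (\<lambda>j. g j m) sums G m" for g G n
      unfolding K_def by (intro sums_add sums_diff sums_mult that A_sums)
    define S where "S f n = (\<Sum>j. (K ^^ j) f n)" for f :: "int \<Rightarrow> complex" and n
    have S: "(\<lambda>j. (K ^^ j) f n) sums S f n" if "f \<in> ell2" for f n
      unfolding S_def
    proof (rule summable_sums, rule summable_comparison_test')
      show "summable (\<lambda>j. \<rho> ^ j * ell2_norm f)"
        using t by (intro summable_mult2 summable_geometric) auto
      show "norm ((K ^^ j) f n) \<le> \<rho> ^ j * ell2_norm f" for j
        using Kj[OF that, of j] cmod_le_ell2_norm by (meson order_trans)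
    qed
    have S_ell2: "S f \<in> ell2 \<and> ell2_norm (S f) \<le> ell2_norm f / (1 - \<rho>)" if f: "f \<in> ell2" for f
    proof (rule ell2_normI)
      show "0 \<le> ell2_norm f / (1 - \<rho>)" using t by (simp add: ell2_norm_nonneg)
      fix F :: "int set" assume F: "finite F"
      have part: "(\<lambda>n. \<Sum>j<J. (K ^^ j) f n) \<in> ell2 \<and>
          ell2_norm (\<lambda>n. \<Sum>j<J. (K ^^ j) f n) \<le> (\<Sum>j<J. \<rho> ^ j * ell2_norm f)" for J
      proof (induction J)
        case 0
        show ?case using ell2_normI[of 0 "\<lambda>n. 0"] by (simp add: L2_set_def)
      next
        case (Suc J)
        then show ?case using ell2_add[of "\<lambda>n. \<Sum>j<J. (K ^^ j) f n" "(K ^^ J) f"] Kj[OF f, of J] by auto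
      qed
      have "(\<Sum>j<J. \<rho> ^ j * ell2_norm f) \<le> ell2_norm f / (1 - \<rho>)" for J
      proof -
        have "(\<Sum>j<J. \<rho> ^ j) \<le> (\<Sum>j. \<rho> ^ j)"
          using t by (intro sum_le_suminf summable_geometric) auto
        then have "(\<Sum>j<J. \<rho> ^ j) \<le> 1 / (1 - \<rho>)" using t by (simp add: suminf_geometric)
        then show ?thesis using mult_right_mono[OF _ ell2_norm_nonneg[of f]]
          by (fastforce simp flip: sum_distrib_right)
      qed
      then have le: "L2_set (\<lambda>n. cmod (\<Sum>j<J. (K ^^ j) f n)) F \<le> ell2_norm f / (1 - \<rho>)" for J
        using part[of J] L2_set_le_ell2_norm[OF _ F, of "\<lambda>n. \<Sum>j<J. (K ^^ j) f n"] by (meson order_trans)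
      have "(\<lambda>J. L2_set (\<lambda>n. cmod (\<Sum>j<J. (K ^^ j) f n)) F) \<longlonglongrightarrow> L2_set (\<lambda>n. cmod (S f n)) F"
        unfolding L2_set_def using S[OF f] by (intro tendsto_intros) (auto simp: sums_def)
      then show "L2_set (\<lambda>n. cmod (S f n)) F \<le> ell2_norm f / (1 - \<rho>)"
        by (rule LIMSEQ_le_const2) (use le in auto)
    qed
    have PS: "t * (A (A (S f)) n + y\<^sup>2 * S f n) = f n" if "f \<in> ell2" for f :: "int \<Rightarrow> complex" and n
    proof -
      have "(\<lambda>j. (K ^^ Suc j) f n) sums K (S f) n" using K_sums[of "\<lambda>j. (K ^^ j) f", OF S[OF that]] by simp
      then have "(\<lambda>j. (K ^^ j) f n) sums (K (S f) n + f n)" by (subst (asm) sums_Suc_iff) simp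
      then have "S f n = K (S f) n + f n" using S[OF that] by (metis sums_unique2)
      then show ?thesis by (simp add: K_def)
    qed
    have K_add: "(K ^^ j) (\<lambda>n. f n + g n) = (\<lambda>n. (K ^^ j) f n + (K ^^ j) g n)" for j f g
      by (induction j) (auto simp: K_def[abs_def] A_def op_shift_def T_def tm_hamiltonian_def algebra_simps)
    have K_scale: "(K ^^ j) (\<lambda>n. c * f n) = (\<lambda>n. c * (K ^^ j) f n)" for j c f
      by (induction j) (auto simp: K_def[abs_def] A_def op_shift_def T_def tm_hamiltonian_def algebra_simps)
    have S_add: "S (\<lambda>n. f n + g n) = (\<lambda>n. S f n + S g n)" if "f \<in> ell2" "g \<in> ell2" for f g
    proof
      fix n
      have "(\<lambda>j. (K ^^ j) (\<lambda>n. f n + g n) n) sums (S f n + S g n)"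
        unfolding K_add by (intro sums_add S that)
      then show "S (\<lambda>n. f n + g n) n = S f n + S g n" unfolding S_def by (rule sums_unique[symmetric])
    qed
    have S_scale: "S (\<lambda>n. c * f n) = (\<lambda>n. c * S f n)" if "f \<in> ell2" for c f
    proof
      fix n
      have "(\<lambda>j. (K ^^ j) (\<lambda>n. c * f n) n) sums (c * S f n)"
        unfolding K_scale by (intro sums_mult S that)
      then show "S (\<lambda>n. c * f n) n = c * S f n" unfolding S_def by (rule sums_unique[symmetric])
    qed
    define R where "R f n = t * B' (S f) n" for f :: "int \<Rightarrow> complex" and n
    obtain C where C: "0 \<le> C" "\<And>\<psi>. \<psi> \<in> ell2 \<Longrightarrow> B' \<psi> \<in> ell2 \<and> ell2_norm (B' \<psi>) \<le> C * ell2_norm \<psi>"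
      using op_shift_bounded[OF bounded_op_tm_hamiltonian] unfolding B'_def T_def by blast
    have B_ell2: "B \<psi> \<in> ell2" if "\<psi> \<in> ell2" for \<psi>
      using op_shift_bounded[OF bounded_op_tm_hamiltonian] that unfolding B_def T_def by blast
    have R_ell2: "R f \<in> ell2 \<and> ell2_norm (R f) \<le> (t * C / (1 - \<rho>)) * ell2_norm f" if "f \<in> ell2" for f
    proof -
      have Sf: "S f \<in> ell2" "ell2_norm (S f) \<le> ell2_norm f / (1 - \<rho>)" using S_ell2[OF that] by auto
      have "ell2_norm (R f) \<le> t * ell2_norm (B' (S f))" "R f \<in> ell2"
        using ell2_scale[of "B' (S f)" "complex_of_real t"] C(2)[OF Sf(1)] t(1) by (auto simp: R_def[abs_def])
      moreover have "t * ell2_norm (B' (S f)) \<le> t * (C * (ell2_norm f / (1 - \<rho>)))"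
        using C(2)[OF Sf(1)] Sf(2) C(1) t(1) by (meson less_imp_le mult_left_mono order_trans)
      ultimately show ?thesis by simp
    qed
    have "bounded_op R"
      unfolding bounded_op_def
    proof (intro conjI ballI allI exI)
      fix f g c assume f: "f \<in> ell2" and g: "g \<in> ell2"
      show "R (\<lambda>n. f n + g n) = (\<lambda>n. R f n + R g n)"
        unfolding R_def[abs_def] S_add[OF f g]
        by (simp add: B'_def op_shift_def T_def tm_hamiltonian_def algebra_simps)
    next
      fix f c assume f: "f \<in> ell2"
      show "R (\<lambda>n. c * f n) = (\<lambda>n. c * R f n)"
        unfolding R_def[abs_def] S_scale[OF f]
        by (simp add: B'_def op_shift_def T_def tm_hamiltonian_def algebra_simps)
    qed (use R_ell2 in blast)+
    moreover have BR: "B (R f) = f" if "f \<in> ell2" for f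
    proof
      fix n
      have "B (R f) n = t * B (B' (S f)) n"
        by (simp add: R_def B_def op_shift_def T_def tm_hamiltonian_def algebra_simps)
      then show "B (R f) n = f n" using PS[OF that, of n] by (simp add: BB)
    qed
    moreover have "R (B f) = f" if f: "f \<in> ell2" for f
    proof -
      \<comment> \<open>\<open>h\<close> is annihilated by \<open>P\<close>, hence fixed by the
        contraction \<open>K\<close>\<close>
      define h where "h n = R (B f) n - f n" for n
      have h: "h \<in> ell2" using ell2_diff[of "R (B f)" f] R_ell2 B_ell2 f by (auto simp: h_def[abs_def])
      have "B h m = B (R (B f)) m - B f m" for m
        by (simp add: h_def B_def op_shift_def T_def tm_hamiltonian_def algebra_simps)
      then have "B h m = 0" for m using BR[OF B_ell2[OF f]] by simp
      then have "B' (B h) n = 0" for n by (simp add: B'_def op_shift_def T_def tm_hamiltonian_def)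
      then have "A (A h) n + y\<^sup>2 * h n = 0" for n using BB(2)[of h n] by simp
      then have "K h = h" unfolding K_def[abs_def] by simp
      then have "ell2_norm h \<le> \<rho> * ell2_norm h" using K[OF h] by simp
      then have "(1 - \<rho>) * ell2_norm h \<le> 0" by (simp add: algebra_simps)
      then have "ell2_norm h \<le> 0" using t(3) by (simp add: mult_le_0_iff)
      then have "h = (\<lambda>n. 0)" by (rule ell2_norm_eq_0D[OF h])
      then show ?thesis by (auto simp: h_def fun_eq_iff)
    qed
    ultimately have "z \<notin> op_spectrum (tm_hamiltonian lam)"
      unfolding op_spectrum_def B_def T_def by blast
    with z show False by simp
  qed
qed

section \<open>Transfer matrices and the trace map\<close>

lemma trace_2: "trace (A :: real^2^2) = A$1$1 + A$2$2"
  by (simp add: trace_def sum_2)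

lemma matrix_mult_2_nth: "((A :: real^2^2) ** B) $ i $ j = A$i$1 * B$1$j + A$i$2 * B$2$j"
  by (simp add: matrix_matrix_mult_def sum_2)

text \<open>The identity behind the trace map. It is Cayley-Hamilton applied to both factors of
  \<open>A\<^sup>2 B\<^sup>2\<close>, whose trace is that of \<open>B A A B\<close>.\<close>

lemma trace_squares_product_2:
  fixes A B :: "real^2^2"
  assumes "det A = 1" "det B = 1"
  shows "trace ((B ** A) ** (A ** B)) = trace A * trace B * trace (B ** A) - (trace A)\<^sup>2 - (trace B)\<^sup>2 + 2"
proof -
  have "trace ((B ** A) ** (A ** B)) = trace A * trace B * trace (B ** A)
      - det B * (trace A)\<^sup>2 - det A * (trace B)\<^sup>2 + 2 * det A * det B"
    unfolding trace_2 matrix_mult_2_nth det_2 by (simp add: power2_eq_square algebra_simps)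
  then show ?thesis by (simp add: assms)
qed

fun letter_potential :: "real \<Rightarrow> letter \<Rightarrow> real" where
  "letter_potential lam La = lam"
| "letter_potential lam Lb = - lam"

definition step_matrix :: "real \<Rightarrow> real \<Rightarrow> letter \<Rightarrow> real^2^2" where
  "step_matrix lam E c = vector [vector [E - letter_potential lam c, -1], vector [1, 0]]"

text \<open>Letters are read from left to right, so later letters multiply on the left.\<close>

fun transfer :: "real \<Rightarrow> real \<Rightarrow> letter list \<Rightarrow> real^2^2" where
  "transfer lam E [] = mat 1"
| "transfer lam E (c # w) = transfer lam E w ** step_matrix lam E c"

lemma transfer_append: "transfer lam E (u @ v) = transfer lam E v ** transfer lam E u"
  by (induction u) (simp_all add: matrix_mul_assoc)

lemma det_transfer: "det (transfer lam E w) = 1"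
proof (induction w)
  case (Cons c w)
  have "det (step_matrix lam E c) = 1" by (simp add: det_2 step_matrix_def)
  with Cons show ?case by (simp add: det_mul)
qed (simp add: det_I)

definition tm_word :: "nat \<Rightarrow> letter \<Rightarrow> letter list" where
  "tm_word n c = (tm_subst ^^ n) [c]"

lemma tm_word_Suc:
  "tm_word (Suc n) La = tm_word n La @ tm_word n Lb"
  "tm_word (Suc n) Lb = tm_word n Lb @ tm_word n La"
proof -
  have "tm_word (Suc n) c = (tm_subst ^^ n) (tm_letter c)" for c
    by (simp add: tm_word_def funpow_swap1 tm_subst_def)
  moreover have "(tm_subst ^^ n) [c, d] = tm_word n c @ tm_word n d" for c d
    using tm_subst_pow_append[of n "[c]" "[d]"] by (simp add: tm_word_def)
  ultimately show "tm_word (Suc n) La = tm_word n La @ tm_word n Lb"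
    "tm_word (Suc n) Lb = tm_word n Lb @ tm_word n La" by simp_all
qed

text \<open>If \<open>x\<^sub>n\<close> is the trace of the transfer matrix over \<open>\<tau>\<^sup>n(a)\<close>, then \<open>x\<^sub>n\<^sub>+\<^sub>2 = 2 + x\<^sub>n\<^sup>2 (x\<^sub>n\<^sub>+\<^sub>1 - 2)\<close> for \<open>n \<ge> 1\<close>. For the
  free operator \<open>x\<^sub>n = 2 cos (2\<^sup>n \<theta>)\<close> and \<open>x\<^sub>n\<^sub>+\<^sub>1 = x\<^sub>n\<^sup>2 - 2\<close>. The second coordinate records the defect
  \<open>d\<^sub>n = x\<^sub>n\<^sub>+\<^sub>1 - x\<^sub>n\<^sup>2 + 2\<close>, in terms of which the recursion reads \<open>d\<^sub>n\<^sub>+\<^sub>1 = (2 - x\<^sub>n\<^sub>+\<^sub>1) d\<^sub>n\<close>.\<close>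

definition trace_step :: "real \<times> real \<Rightarrow> real \<times> real" where
  "trace_step = (\<lambda>(x, d). (x\<^sup>2 - 2 + d, (4 - x\<^sup>2 - d) * d))"

text \<open>Index \<open>n\<close> belongs to the word \<open>\<tau>\<^sup>n\<^sup>+\<^sup>1(a)\<close>: the traces over \<open>\<tau>\<^sup>n(a)\<close> and \<open>\<tau>\<^sup>n(b)\<close> agree only from \<open>n = 1\<close> on.\<close>

definition trace_orbit :: "real \<Rightarrow> real \<Rightarrow> nat \<Rightarrow> real \<times> real" where
  "trace_orbit lam E n = (trace_step ^^ n) (E\<^sup>2 - lam\<^sup>2 - 2, - 4 * lam\<^sup>2)"

lemma trace_orbit_Suc: "trace_orbit lam E (Suc n) = trace_step (trace_orbit lam E n)"
  by (simp add: trace_orbit_def)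

text \<open>The traces over \<open>\<tau>\<^sup>n\<^sup>+\<^sup>1(a) = \<tau>\<^sup>n(a)\<tau>\<^sup>n(b)\<close> and over its mirror agree, since cyclic permutations preserve
  the trace; the identity for \<open>B A A B\<close> then closes the recursion.\<close>

lemma trace_transfer_eq_orbit:
  "trace (transfer lam E (tm_word (Suc n) La)) = fst (trace_orbit lam E n)"
proof -
  define M N where "M n = transfer lam E (tm_word n La)" and "N n = transfer lam E (tm_word n Lb)" for n
  have rec: "M (Suc n) = N n ** M n" "N (Suc n) = M n ** N n" for n
    by (simp_all add: M_def N_def tm_word_Suc transfer_append)
  have comm: "trace (A ** B) = trace (B ** A)" for A B :: "real^2^2"
    unfolding trace_2 matrix_mult_2_nth by algebra
  have dets: "det (M n) = 1" "det (N n) = 1" for n by (simp_all add: M_def N_def det_transfer)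
  have MN0: "M 0 = step_matrix lam E La" "N 0 = step_matrix lam E Lb"
    by (simp_all add: M_def N_def tm_word_def)
  have eq: "trace (N (Suc n)) = trace (M (Suc n))" for n unfolding rec by (rule comm)
  have two: "trace (M (Suc (Suc n))) =
      trace (M n) * trace (N n) * trace (M (Suc n)) - (trace (M n))\<^sup>2 - (trace (N n))\<^sup>2 + 2" for n
  proof -
    have "trace (M (Suc (Suc n))) = trace ((N n ** M n) ** (M n ** N n))"
      by (subst comm) (simp add: rec)
    then show ?thesis using trace_squares_product_2[OF dets] by (simp add: rec)
  qed
  have init: "trace (M 0) = E - lam" "trace (N 0) = E + lam" "trace (M 1) = E\<^sup>2 - lam\<^sup>2 - 2"
    unfolding One_nat_def rec MN0 trace_2 matrix_mult_2_nth by (simp_all add: step_matrix_def power2_eq_square algebra_simps)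
  have "trace (M (Suc n)) = fst (trace_orbit lam E n) \<and>
      trace (M (Suc (Suc n))) = fst (trace_orbit lam E (Suc n))"
  proof (induction n)
    case 0
    have "trace (M (Suc (Suc 0))) =
        (E - lam) * (E + lam) * (E\<^sup>2 - lam\<^sup>2 - 2) - (E - lam)\<^sup>2 - (E + lam)\<^sup>2 + 2"
      using two[of 0] init by simp
    also have "\<dots> = fst (trace_orbit lam E (Suc 0))"
      by (simp add: trace_orbit_def trace_step_def power2_eq_square algebra_simps)
    finally show ?case using init(3) by (simp add: trace_orbit_def)
  next
    case (Suc n)
    obtain x d where xd: "trace_orbit lam E n = (x, d)" by fastforce
    have "trace (M (Suc (Suc (Suc n)))) = (fst (trace_orbit lam E n))\<^sup>2 *
        fst (trace_orbit lam E (Suc n)) - 2 * (fst (trace_orbit lam E n))\<^sup>2 + 2"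
      using two[of "Suc n"] Suc by (simp add: eq power2_eq_square)
    also have "\<dots> = fst (trace_orbit lam E (Suc (Suc n)))"
      by (simp add: trace_orbit_Suc xd trace_step_def) algebra
    finally show ?case using Suc by simp
  qed
  then show ?thesis by (simp add: M_def)
qed

text \<open>The eigenvalues are the roots of \<open>\<mu>\<^sup>2 - x \<mu> + 1\<close> with \<open>x\<close> the trace, which lie on the unit circle as soon as
  \<open>\<bar>x\<bar> \<le> 2\<close>. The case distinction finds an eigenvector among the columns of the adjugate of \<open>M - \<mu>\<close>,
  which vanishes only when \<open>M\<close> is scalar.\<close>

lemma bloch_vector:
  fixes M :: "real^2^2"
  assumes "det M = 1" "\<bar>trace M\<bar> \<le> 2"
  obtains \<mu> p q :: complex where "cmod \<mu> = 1" "p \<noteq> 0 \<or> q \<noteq> 0"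
    "M$1$1 * p + M$1$2 * q = \<mu> * p" "M$2$1 * p + M$2$2 * q = \<mu> * q"
proof -
  define a b c d where "a = complex_of_real (M$1$1)" and "b = complex_of_real (M$1$2)"
    and "c = complex_of_real (M$2$1)" and "d = complex_of_real (M$2$2)"
  define x where "x = trace M"
  define \<mu> where "\<mu> = Complex (x / 2) (sqrt (1 - x\<^sup>2 / 4))"
  have "x\<^sup>2 \<le> 2\<^sup>2" using assms(2) by (metis abs_le_square_iff abs_numeral x_def)
  then have r: "(sqrt (1 - x\<^sup>2 / 4))\<^sup>2 = 1 - x\<^sup>2 / 4" by simp
  have mu1: "cmod \<mu> = 1" unfolding \<mu>_def cmod_def by (simp add: r power_divide)
  have xad: "complex_of_real x = a + d" by (simp add: x_def a_def d_def trace_2)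
  have "\<mu>\<^sup>2 - complex_of_real x * \<mu> + 1 = 0"
    using r by (simp add: \<mu>_def complex_eq_iff power2_eq_square field_simps)
  then have mu: "\<mu> * \<mu> - (a + d) * \<mu> + 1 = 0" by (simp add: xad power2_eq_square)
  have "a * d - b * c = complex_of_real (det M)" by (simp add: det_2 a_def b_def c_def d_def)
  then have det: "a * d - b * c = 1" using assms(1) by simp
  consider "b \<noteq> 0 \<or> \<mu> \<noteq> a" | "b = 0" "\<mu> = a" "c \<noteq> 0 \<or> \<mu> \<noteq> d" | "b = 0" "\<mu> = a" "c = 0" "\<mu> = d"
    by blast
  then show thesis
  proof cases
    case 1
    have "a * b + b * (\<mu> - a) = \<mu> * b" by algebra
    moreover have "c * b + d * (\<mu> - a) = \<mu> * (\<mu> - a)" using mu det by algebra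
    ultimately show ?thesis using 1 by (intro that[OF mu1, of b "\<mu> - a"]) (auto simp: a_def b_def c_def d_def)
  next
    case 2
    have "a * (\<mu> - d) + b * c = \<mu> * (\<mu> - d)" using 2(1,2) by algebra
    moreover have "c * (\<mu> - d) + d * c = \<mu> * c" by algebra
    ultimately show ?thesis using 2 by (intro that[OF mu1, of "\<mu> - d" c]) (auto simp: a_def b_def c_def d_def)
  next
    case 3
    then show ?thesis by (intro that[OF mu1, of 1 0]) (auto simp: a_def b_def c_def d_def)
  qed
qed

text \<open>The property of the sequence on which the cut-off construction rests: around the origin it reads \<open>\<tau>\<^sup>2\<^sup>k(a) \<tau>\<^sup>2\<^sup>k(a)\<close>, two full periods of a
  periodic approximant.\<close>

lemma w_tm_centre:
  assumes "- int (2 ^ (2 * k)) \<le> n" "n < int (2 ^ (2 * k))"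
  shows "w_tm n = (tm_word (2 * k) La @ tm_word (2 * k) La) ! nat (n + int (2 ^ (2 * k)))"
proof -
  let ?w = "tm_word (2 * k) La"
  have len: "length ?w = 2 ^ (2 * k)" by (simp add: tm_word_def length_tm_subst_pow)
  have c: "tm_pointed k n = Some ((?w @ ?w) ! nat (n + int (2 ^ (2 * k))))"
  proof (cases "0 \<le> n")
    case True
    then have "nat (n + int (2 ^ (2 * k))) = length ?w + nat n"
      unfolding len by (simp add: nat_add_distrib nat_power_eq)
    then have "(?w @ ?w) ! nat (n + int (2 ^ (2 * k))) = ?w ! nat n" by (simp only: nth_append_length_plus)
    then show ?thesis using True assms len
      unfolding tm_pointed_def pointed_word_def tm_word_def[symmetric] by simp
  next
    case False
    then have "nat (n + int (2 ^ (2 * k))) < length ?w" unfolding len using assms by auto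
    then show ?thesis using False assms len
      unfolding tm_pointed_def pointed_word_def tm_word_def[symmetric] by (simp add: nth_append add.commute)
  qed
  have stable: "tm_pointed j n = tm_pointed k n" if "k \<le> j" for j
    using that by (induction j rule: dec_induct) (simp_all add: c tm_pointed_Suc)
  obtain J where J: "\<forall>j\<ge>J. tm_pointed j n = Some (w_tm n)"
    using tm_pointed_eventually[of n] unfolding eventually_sequentially by (rule exE)
  have "Some (w_tm n) = tm_pointed (max J k) n" using J by simp
  also have "\<dots> = tm_pointed k n" by (rule stable) simp
  finally show ?thesis unfolding c by (rule option.inject[THEN iffD1])
qed

text \<open>The pair holds the values of a solution at the current site and at the previous one.\<close>

fun run_word :: "real \<Rightarrow> real \<Rightarrow> letter list \<Rightarrow> complex \<times> complex \<Rightarrow> complex \<times> complex" where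
  "run_word lam E [] v = v"
| "run_word lam E (c # w) v =
     run_word lam E w (complex_of_real (E - letter_potential lam c) * fst v - snd v, fst v)"

lemma run_word_append: "run_word lam E (u @ w) v = run_word lam E w (run_word lam E u v)"
  by (induction u arbitrary: v) simp_all

lemma run_word_scale:
  "run_word lam E w (\<mu> * p, \<mu> * q) = (\<mu> * fst (run_word lam E w (p, q)), \<mu> * snd (run_word lam E w (p, q)))"
proof (induction w arbitrary: p q)
  case (Cons c w)
  show ?case using Cons[of "complex_of_real (E - letter_potential lam c) * p - q" p] by (simp add: algebra_simps)
qed simp

lemma run_word_transfer:
  fixes p q :: complex
  shows "run_word lam E w (p, q) = (let M = transfer lam E w in
     (M$1$1 * p + M$1$2 * q, M$2$1 * p + M$2$2 * q))"
proof (induction w arbitrary: p q)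
  case Nil
  show ?case by (simp add: mat_def)
next
  case (Cons c w)
  show ?case by (simp add: Cons Let_def matrix_mult_2_nth step_matrix_def algebra_simps)
qed

lemma sum_lessThan_add: "(\<Sum>j<m + n. f j) = (\<Sum>j<m. f j) + (\<Sum>j<n. f (m + j))"
  for f :: "nat \<Rightarrow> 'a::comm_monoid_add"
  by (induction n) (simp_all add: add.assoc)

text \<open>Starting from a Bloch vector, the solution over two copies of \<open>w\<close> returns with a factor of modulus 1
  after the first copy, so its modulus is periodic.\<close>

lemma bloch_sequence:
  fixes E :: real
  assumes "\<bar>trace (transfer lam E w)\<bar> \<le> 2" "w \<noteq> []"
  obtains s :: "nat \<Rightarrow> complex" where
    "\<And>j. 0 < j \<Longrightarrow> j < 2 * length w \<Longrightarrow>
       s (Suc j) + s (j - 1) + letter_potential lam ((w @ w) ! j) * s j = E * s j"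
    "\<And>j. j \<le> length w \<Longrightarrow> cmod (s (length w + j)) = cmod (s j)"
    "0 < (\<Sum>j<length w. (cmod (s j))\<^sup>2)"
proof -
  obtain \<mu> p q :: complex where bl: "cmod \<mu> = 1" "p \<noteq> 0 \<or> q \<noteq> 0"
    "transfer lam E w$1$1 * p + transfer lam E w$1$2 * q = \<mu> * p"
    "transfer lam E w$2$1 * p + transfer lam E w$2$2 * q = \<mu> * q"
    using bloch_vector[OF det_transfer assms(1)] .
  define L where "L = length w"
  have L: "0 < L" using assms(2) by (simp add: L_def)
  define S where "S j = run_word lam E (take j (w @ w)) (p, q)" for j
  define s where "s j = fst (S j)" for j
  have step: "S (Suc j) = (complex_of_real (E - letter_potential lam ((w @ w) ! j)) * s j - snd (S j), s j)"
    if "j < 2 * L" for j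
    using that by (simp add: S_def s_def L_def take_Suc_conv_app_nth run_word_append del: take_append)
  have run_w: "run_word lam E w (p, q) = (\<mu> * p, \<mu> * q)"
    by (simp add: run_word_transfer Let_def bl)
  have per: "S (L + j) = (\<mu> * fst (S j), \<mu> * snd (S j))" if "j \<le> L" for j
  proof -
    have "take (L + j) (w @ w) = w @ take j (w @ w)" using that by (simp add: L_def)
    then show ?thesis by (simp add: S_def run_word_append run_w run_word_scale)
  qed
  have ps: "snd (S (Suc j)) = s j" if "j < 2 * L" for j using step[OF that] by simp
  show thesis
  proof (rule that[of s])
    fix j assume j: "0 < j" "j < 2 * length w"
    then obtain i where i: "j = Suc i" using gr0_implies_Suc by blast
    have "s (Suc j) = (E - letter_potential lam ((w @ w) ! j)) * s j - s i"
      using step[of j] ps[of i] j by (simp add: s_def i L_def)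
    then show "s (Suc j) + s (j - 1) + letter_potential lam ((w @ w) ! j) * s j = E * s j"
      by (simp add: i algebra_simps)
  next
    fix j assume "j \<le> length w"
    then show "cmod (s (length w + j)) = cmod (s j)"
      using per[of j] bl(1) by (simp add: s_def L_def norm_mult)
  next
    \<comment> \<open>two consecutive zeros would force the initial vector to vanish\<close>
    have nz: "s 0 \<noteq> 0 \<or> s (L - 1) \<noteq> 0"
    proof (rule ccontr)
      assume "\<not> ?thesis"
      then have z: "p = 0" "s (L - 1) = 0" by (auto simp: s_def S_def)
      then have "snd (S (Suc (L - 1))) = 0" using ps[of "L - 1"] L by simp
      then have "\<mu> * q = 0" using per[of 0] L by (simp add: S_def)
      with z bl show False by auto
    qed
    have "{0, L - 1} \<subseteq> {..<length w}" using L by (auto simp: L_def)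
    then show "0 < (\<Sum>j<length w. (cmod (s j))\<^sup>2)"
      using nz by (intro sum_pos2[of _ "if s 0 \<noteq> 0 then 0 else L - 1"]) auto
  qed
qed

section \<open>Energies with bounded traces are spectral\<close>

lemma ell2_norm_shift:
  assumes "\<psi> \<in> ell2"
  shows "ell2_norm (\<lambda>n. \<psi> (n + d)) = ell2_norm \<psi>"
proof -
  have "(\<Sum>\<^sub>\<infinity>n. (cmod (\<psi> (n + d)))\<^sup>2) = (ell2_norm \<psi>)\<^sup>2"
    by (rule infsumI[OF has_sum_int_shift[OF ell2_norm_sq[OF assms]]])
  then show ?thesis
    unfolding ell2_norm_def[of "\<lambda>n. \<psi> (n + d)"]
    by (simp only: real_sqrt_abs abs_of_nonneg[OF ell2_norm_nonneg])
qed

text \<open>The approximate eigenvector is a Bloch solution on the two periods around the origin, multiplied by the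
  tent \<open>L - \<bar>n\<bar>\<close>. The slope of the tent is 1, so the error is controlled by the solution itself, while
  \<open>j\<^sup>2 + (L - j)\<^sup>2 \<ge> L\<^sup>2 / 2\<close> shows that the product is larger by a factor of order \<open>L\<close>. Two periods
  suffice, which is essential because no nonempty word occurs three times in a row in the sequence.\<close>

lemma tm_hamiltonian_tent:
  fixes lam E :: real
  assumes k: "\<bar>trace (transfer lam E (tm_word (2 * k) La))\<bar> \<le> 2"
  defines "L \<equiv> (2::nat) ^ (2 * k)"
  obtains \<psi> where "\<psi> \<in> ell2" "0 < ell2_norm \<psi>"
    "real L * ell2_norm (op_shift (tm_hamiltonian lam) E \<psi>) \<le> 5 * ell2_norm \<psi>"
proof -
  define w where "w = tm_word (2 * k) La"
  have len: "length w = L" by (simp add: w_def L_def tm_word_def length_tm_subst_pow)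
  have L: "0 < L" by (simp add: L_def)
  then have "w \<noteq> []" using len by auto
  then obtain s :: "nat \<Rightarrow> complex" where s:
    "\<And>j. 0 < j \<Longrightarrow> j < 2 * L \<Longrightarrow>
       s (Suc j) + s (j - 1) + letter_potential lam ((w @ w) ! j) * s j = E * s j"
    "\<And>j. j \<le> L \<Longrightarrow> cmod (s (L + j)) = cmod (s j)"
    "0 < (\<Sum>j<L. (cmod (s j))\<^sup>2)"
    using bloch_sequence[OF k[folded w_def]] unfolding len by blast
  define Q where "Q = (\<Sum>j<L. (cmod (s j))\<^sup>2)"
  have Q: "0 < Q" using s(3) by (simp add: Q_def)
  define pos where "pos j = int j - int L" for j :: nat
  have inj: "inj_on pos A" for A by (auto simp: pos_def inj_on_def)
  define u where "u n = (if - int L \<le> n \<and> n \<le> int L then s (nat (n + int L)) else 0)" for n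
  define tent where "tent n = real_of_int (max 0 (int L - \<bar>n\<bar>))" for n
  define \<psi> where "\<psi> n = complex_of_real (tent n) * u n" for n
  have u_pos: "u (pos j) = s j" if "j \<le> 2 * L" for j
    using that by (auto simp: u_def pos_def)
  have u_eq: "u (n + 1) + u (n - 1) + tm_potential lam n * u n = E * u n"
    if "- int L < n" "n < int L" for n
  proof -
    define j where "j = nat (n + int L)"
    have j: "0 < j" "j < 2 * L" using that by (auto simp: j_def)
    have "nat (n + 1 + int L) = Suc j" "nat (n - 1 + int L) = j - 1" using that by (auto simp: j_def)
    moreover have "tm_potential lam n = letter_potential lam ((w @ w) ! j)"
      using w_tm_centre[of k n] that
      by (auto simp: tm_potential_def w_def j_def L_def split: letter.split)
    ultimately show ?thesis using s(1)[OF j] that by (simp add: u_def j_def)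
  qed
  have res: "cmod (op_shift (tm_hamiltonian lam) E \<psi> n) \<le> cmod (u (n + 1)) + cmod (u (n + -1))" for n
  proof (cases "- int L < n \<and> n < int L")
    case True
    have "op_shift (tm_hamiltonian lam) E \<psi> n = complex_of_real (tent (n + 1) - tent n) * u (n + 1)
        + complex_of_real (tent (n - 1) - tent n) * u (n - 1)
        + tent n * (u (n + 1) + u (n - 1) + tm_potential lam n * u n - E * u n)"
      by (simp add: op_shift_def tm_hamiltonian_def \<psi>_def algebra_simps)
    also have "\<dots> = complex_of_real (tent (n + 1) - tent n) * u (n + 1)
        + complex_of_real (tent (n - 1) - tent n) * u (n - 1)"
      using u_eq True by simp
    also have "cmod \<dots> \<le> \<bar>tent (n + 1) - tent n\<bar> * cmod (u (n + 1)) + \<bar>tent (n - 1) - tent n\<bar> * cmod (u (n - 1))"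
      by (intro order.trans[OF norm_triangle_ineq]) (simp add: norm_mult del: of_real_diff)
    also have "\<dots> \<le> 1 * cmod (u (n + 1)) + 1 * cmod (u (n - 1))"
      by (intro add_mono mult_right_mono) (auto simp: tent_def)
    finally show ?thesis by simp
  next
    case False
    then have z: "tent n = 0" by (auto simp: tent_def)
    have "\<bar>tent (n + 1)\<bar> \<le> 1" "\<bar>tent (n - 1)\<bar> \<le> 1" using False by (auto simp: tent_def)
    then have le: "cmod (\<psi> (n + 1)) \<le> cmod (u (n + 1))" "cmod (\<psi> (n - 1)) \<le> cmod (u (n - 1))"
      by (simp_all add: \<psi>_def norm_mult mult_left_le_one_le)
    have "op_shift (tm_hamiltonian lam) E \<psi> n = \<psi> (n + 1) + \<psi> (n - 1)"
      using z by (simp add: op_shift_def tm_hamiltonian_def \<psi>_def)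
    then show ?thesis using le norm_triangle_ineq[of "\<psi> (n + 1)" "\<psi> (n - 1)"] by simp
  qed
  have hs: "((\<lambda>n. (cmod (f n))\<^sup>2) has_sum (\<Sum>j<L + L. (cmod (f (pos j)))\<^sup>2) + (cmod (f (pos (L + L))))\<^sup>2) UNIV"
    if supp: "\<And>n. n < - int L \<or> int L < n \<Longrightarrow> f n = 0" for f :: "int \<Rightarrow> complex"
  proof (rule has_sum_finite_neutralI[of "pos ` {..L + L}"])
    show "(cmod (f n))\<^sup>2 = 0" if n: "n \<in> UNIV - pos ` {..L + L}" for n
    proof -
      have "n < - int L \<or> int L < n"
      proof (rule ccontr)
        assume "\<not> ?thesis"
        then have "n = pos (nat (n + int L))" "nat (n + int L) \<le> L + L" by (auto simp: pos_def)
        with n show False by blast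
      qed
      then show ?thesis using supp by simp
    qed
    show "(\<Sum>j<L + L. (cmod (f (pos j)))\<^sup>2) + (cmod (f (pos (L + L))))\<^sup>2 = (\<Sum>n\<in>pos ` {..L + L}. (cmod (f n))\<^sup>2)"
      by (simp add: sum.reindex[OF inj] flip: lessThan_Suc_atMost)
  qed auto
  have u: "u \<in> ell2 \<and> (ell2_norm u)\<^sup>2 \<le> 3 * Q"
  proof
    have h: "((\<lambda>n. (cmod (u n))\<^sup>2) has_sum (\<Sum>j<L + L. (cmod (u (pos j)))\<^sup>2) + (cmod (u (pos (L + L))))\<^sup>2) UNIV"
      by (rule hs) (auto simp: u_def)
    then show mem: "u \<in> ell2" unfolding ell2_def summable_on_def by blast
    \<comment> \<open>two periods contribute equally; the extra end point is bounded by one more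
      period\<close>
    have "(\<Sum>j<L + L. (cmod (u (pos j)))\<^sup>2) = (\<Sum>j<L. (cmod (s j))\<^sup>2) + (\<Sum>j<L. (cmod (s (L + j)))\<^sup>2)"
      by (simp add: sum_lessThan_add u_pos)
    also have "\<dots> = 2 * Q" using s(2) by (simp add: Q_def)
    finally have 1: "(\<Sum>j<L + L. (cmod (u (pos j)))\<^sup>2) = 2 * Q" .
    have "cmod (u (pos (L + L))) = cmod (s 0)" using s(2)[of L] s(2)[of 0] u_pos[of "L + L"] by simp
    moreover have "(cmod (s 0))\<^sup>2 \<le> Q" unfolding Q_def using L by (intro member_le_sum) auto
    ultimately show "(ell2_norm u)\<^sup>2 \<le> 3 * Q"
      using has_sum_unique[OF ell2_norm_sq[OF mem] h] 1 by simp
  qed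
  have mem: "\<psi> \<in> ell2"
  proof -
    have "((\<lambda>n. (cmod (\<psi> n))\<^sup>2) has_sum (\<Sum>j<L + L. (cmod (\<psi> (pos j)))\<^sup>2) + (cmod (\<psi> (pos (L + L))))\<^sup>2) UNIV"
      by (rule hs) (auto simp: \<psi>_def u_def)
    then show ?thesis unfolding ell2_def summable_on_def by blast
  qed
  have lower: "(real L)\<^sup>2 * Q \<le> 2 * (ell2_norm \<psi>)\<^sup>2"
  proof -
    have "((\<lambda>n. (cmod (\<psi> n))\<^sup>2) has_sum (\<Sum>j<L + L. (cmod (\<psi> (pos j)))\<^sup>2) + (cmod (\<psi> (pos (L + L))))\<^sup>2) UNIV"
      by (rule hs) (auto simp: \<psi>_def u_def)
    then have "(ell2_norm \<psi>)\<^sup>2 = (\<Sum>j<L + L. (cmod (\<psi> (pos j)))\<^sup>2) + (cmod (\<psi> (pos (L + L))))\<^sup>2"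
      by (rule has_sum_unique[OF ell2_norm_sq[OF mem]])
    then have "(\<Sum>j<L + L. (cmod (\<psi> (pos j)))\<^sup>2) \<le> (ell2_norm \<psi>)\<^sup>2" by simp
    also have "(\<Sum>j<L + L. (cmod (\<psi> (pos j)))\<^sup>2) = (\<Sum>j<L. ((real j)\<^sup>2 + (real L - real j)\<^sup>2) * (cmod (s j))\<^sup>2)"
      unfolding sum_lessThan_add sum.distrib[symmetric]
    proof (rule sum.cong[OF refl])
      fix j assume "j \<in> {..<L}"
      then have j: "j < L" by simp
      have "tent (pos j) = real j" "tent (pos (L + j)) = real L - real j"
        using j by (auto simp: tent_def pos_def)
      then have "cmod (\<psi> (pos j)) = real j * cmod (s j)"
        "cmod (\<psi> (pos (L + j))) = (real L - real j) * cmod (s j)"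
        using j s(2)[of j] by (simp_all add: \<psi>_def u_pos norm_mult del: of_real_diff)
      then show "(cmod (\<psi> (pos j)))\<^sup>2 + (cmod (\<psi> (pos (L + j))))\<^sup>2 =
          ((real j)\<^sup>2 + (real L - real j)\<^sup>2) * (cmod (s j))\<^sup>2"
        by (simp only: power_mult_distrib distrib_right)
    qed
    also have "\<dots> \<ge> (\<Sum>j<L. ((real L)\<^sup>2 / 2) * (cmod (s j))\<^sup>2)"
    proof (intro sum_mono mult_right_mono)
      fix j
      have "0 \<le> (2 * real j - real L)\<^sup>2" by simp
      then show "(real L)\<^sup>2 / 2 \<le> (real j)\<^sup>2 + (real L - real j)\<^sup>2"
        by (simp add: power2_eq_square algebra_simps)
    qed simp
    finally have "(real L)\<^sup>2 / 2 * Q \<le> (ell2_norm \<psi>)\<^sup>2"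
      unfolding Q_def sum_distrib_left .
    then show ?thesis by simp
  qed
  have upper: "ell2_norm (op_shift (tm_hamiltonian lam) E \<psi>) \<le> 2 * ell2_norm u"
  proof (rule ell2_normI[THEN conjunct2])
    fix F :: "int set" assume F: "finite F"
    have sh: "L2_set (\<lambda>n. cmod (u (n + d))) F \<le> ell2_norm u" for d
      using L2_set_le_ell2_norm[OF ell2_shift[OF u[THEN conjunct1], of d] F]
      unfolding ell2_norm_shift[OF u[THEN conjunct1]] .
    have "L2_set (\<lambda>n. cmod (op_shift (tm_hamiltonian lam) E \<psi> n)) F
        \<le> L2_set (\<lambda>n. cmod (u (n + 1)) + cmod (u (n + -1))) F"
      using res by (intro L2_set_mono) auto
    also have "\<dots> \<le> L2_set (\<lambda>n. cmod (u (n + 1))) F + L2_set (\<lambda>n. cmod (u (n + -1))) F"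
      by (rule L2_set_triangle_ineq)
    finally show "L2_set (\<lambda>n. cmod (op_shift (tm_hamiltonian lam) E \<psi> n)) F \<le> 2 * ell2_norm u"
      using sh[of 1] sh[of "-1"] by linarith
  qed (simp add: ell2_norm_nonneg)
  show thesis
  proof (rule that[OF mem])
    have "0 < (real L)\<^sup>2 * Q" using L Q by simp
    then have "0 < (ell2_norm \<psi>)\<^sup>2" using lower by linarith
    then show "0 < ell2_norm \<psi>" using ell2_norm_nonneg[of \<psi>] by (simp add: less_le)
    have "(real L * ell2_norm (op_shift (tm_hamiltonian lam) E \<psi>))\<^sup>2 \<le> (real L * (2 * ell2_norm u))\<^sup>2"
      using upper by (intro power_mono mult_left_mono mult_nonneg_nonneg ell2_norm_nonneg) auto
    also have "\<dots> = 4 * ((real L)\<^sup>2 * (ell2_norm u)\<^sup>2)" by (simp add: power_mult_distrib)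
    also have "\<dots> \<le> 4 * ((real L)\<^sup>2 * (3 * Q))" using u by (intro mult_left_mono) auto
    also have "\<dots> \<le> 24 * (ell2_norm \<psi>)\<^sup>2" using lower by linarith
    also have "\<dots> \<le> (5 * ell2_norm \<psi>)\<^sup>2"
      unfolding power_mult_distrib by (intro mult_right_mono) auto
    finally show "real L * ell2_norm (op_shift (tm_hamiltonian lam) E \<psi>) \<le> 5 * ell2_norm \<psi>"
      by (rule power2_le_imp_le) (simp add: ell2_norm_nonneg)
  qed
qed

text \<open>A bounded inverse would bound the norm of a vector by a fixed multiple of the norm of its image, against
  the tents.\<close>

lemma bounded_trace_in_spectrum:
  fixes lam E :: real
  assumes "infinite {k. \<bar>trace (transfer lam E (tm_word (2 * k) La))\<bar> \<le> 2}"
  shows "complex_of_real E \<in> op_spectrum (tm_hamiltonian lam)"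
proof (rule ccontr)
  assume "\<not> ?thesis"
  then obtain R where R: "bounded_op R"
    "\<And>\<psi>. \<psi> \<in> ell2 \<Longrightarrow> R (op_shift (tm_hamiltonian lam) E \<psi>) = \<psi>"
    unfolding op_spectrum_def by blast
  obtain C where C: "\<And>\<psi>. \<psi> \<in> ell2 \<Longrightarrow> ell2_norm (R \<psi>) \<le> C * ell2_norm \<psi>"
    using R(1) unfolding bounded_op_def by blast
  obtain k0 where k0: "5 * \<bar>C\<bar> < real k0" using reals_Archimedean2 by blast
  obtain k where k: "k0 < k" "\<bar>trace (transfer lam E (tm_word (2 * k) La))\<bar> \<le> 2"
    using assms unfolding infinite_nat_iff_unbounded by blast
  define L where "L = (2::nat) ^ (2 * k)"
  obtain \<psi> where \<psi>: "\<psi> \<in> ell2" "0 < ell2_norm \<psi>"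
    "real L * ell2_norm (op_shift (tm_hamiltonian lam) E \<psi>) \<le> 5 * ell2_norm \<psi>"
    unfolding L_def by (rule tm_hamiltonian_tent[OF k(2)])
  have "k < L" unfolding L_def by (metis less_exp order.strict_trans1 mult_2 le_add1)
  then have L: "5 * \<bar>C\<bar> < real L" using k0 k(1) by simp
  have "op_shift (tm_hamiltonian lam) E \<psi> \<in> ell2"
    using op_shift_bounded[OF bounded_op_tm_hamiltonian] \<psi>(1) by blast
  then have "ell2_norm \<psi> \<le> C * ell2_norm (op_shift (tm_hamiltonian lam) E \<psi>)"
    using C R(2)[OF \<psi>(1)] by metis
  also have "\<dots> \<le> \<bar>C\<bar> * ell2_norm (op_shift (tm_hamiltonian lam) E \<psi>)"
    by (intro mult_right_mono ell2_norm_nonneg) simp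
  finally have "real L * ell2_norm \<psi> \<le> real L * (\<bar>C\<bar> * ell2_norm (op_shift (tm_hamiltonian lam) E \<psi>))"
    by (rule mult_left_mono) simp
  also have "\<dots> = \<bar>C\<bar> * (real L * ell2_norm (op_shift (tm_hamiltonian lam) E \<psi>))"
    by simp
  also have "\<dots> \<le> \<bar>C\<bar> * (5 * ell2_norm \<psi>)" using \<psi>(3) by (intro mult_left_mono) auto
  finally have "(real L - 5 * \<bar>C\<bar>) * ell2_norm \<psi> \<le> 0" by (simp add: algebra_simps)
  then show False using L \<psi>(2) by (simp add: mult_le_0_iff)
qed

section \<open>Topological horseshoes and Hoelder coding\<close>

text \<open>Take the first point where \<open>g\<close> reaches \<open>v\<close>, and then the last point before it where \<open>g\<close> is at most \<open>u\<close>.\<close>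

lemma crossing_interval_up:
  fixes g :: "real \<Rightarrow> real"
  assumes "a \<le> b" "continuous_on {a..b} g" "u \<le> v" "g a \<le> u" "v \<le> g b"
  shows "\<exists>a' b'. a \<le> a' \<and> a' \<le> b' \<and> b' \<le> b \<and> g a' = u \<and> g b' = v \<and> (\<forall>x\<in>{a'..b'}. g x \<in> {u..v})"
proof -
  let ?S = "{a..b} \<inter> g -` {v..}"
  have "closed ?S" using assms(2) by (intro continuous_closed_preimage) auto
  then have "compact ?S" by (simp add: compact_eq_bounded_closed bounded_Int)
  moreover have "b \<in> ?S" using assms by auto
  ultimately obtain b' where b': "b' \<in> ?S" "\<forall>x\<in>?S. b' \<le> x"
    using compact_attains_inf[of ?S] by (metis empty_iff)
  have cont: "continuous_on {x..y} g" if "a \<le> x" "y \<le> b" for x y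
    using assms(2) by (rule continuous_on_subset) (use that in auto)
  obtain x where x: "a \<le> x" "x \<le> b'" "g x = v"
    using IVT'[of g a v b'] cont[of a b'] b' assms by auto
  have "x \<in> ?S" using x b'(1) by auto
  then have "x = b'" using b'(2) x(2) by (metis order_antisym)
  then have gb': "g b' = v" using x by simp
  let ?T = "{a..b'} \<inter> g -` {..u}"
  have "closed ?T" using cont[of a b'] b' by (intro continuous_closed_preimage) auto
  then have "compact ?T" by (simp add: compact_eq_bounded_closed bounded_Int)
  moreover have "a \<in> ?T" using assms b' by auto
  ultimately obtain a' where a': "a' \<in> ?T" "\<forall>x\<in>?T. x \<le> a'"
    using compact_attains_sup[of ?T] by (metis empty_iff)
  obtain y where y: "a' \<le> y" "y \<le> b'" "g y = u"
    using IVT'[of g a' u b'] cont[of a' b'] a' b' gb' assms by auto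
  have "y \<in> ?T" using y a'(1) by auto
  then have "y = a'" using a'(2) y(1) by (metis order_antisym)
  then have ga': "g a' = u" using y by simp
  have "g x \<in> {u..v}" if "x \<in> {a'..b'}" for x
  proof -
    have "x \<in> ?S \<longleftrightarrow> v \<le> g x" "x \<in> ?T \<longleftrightarrow> g x \<le> u" using that a'(1) b'(1) by auto
    then have "v \<le> g x \<longrightarrow> x = b'" "g x \<le> u \<longrightarrow> x = a'"
      using that a'(2) b'(2) by (metis atLeastAtMost_iff order_antisym)+
    then show ?thesis using ga' gb' assms(3) by auto
  qed
  then show ?thesis using a' b' ga' gb' by (intro exI[of _ a'] exI[of _ b']) auto
qed

lemma crossing_interval:
  fixes g :: "real \<Rightarrow> real"
  assumes "a \<le> b" "continuous_on {a..b} g" "u \<le> v" "g a \<le> u \<and> v \<le> g b \<or> v \<le> g a \<and> g b \<le> u"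
  shows "\<exists>a' b'. a \<le> a' \<and> a' \<le> b' \<and> b' \<le> b \<and> (g a' = u \<and> g b' = v \<or> g a' = v \<and> g b' = u)
    \<and> (\<forall>x\<in>{a'..b'}. g x \<in> {u..v})"
  using assms(4)
proof
  assume "g a \<le> u \<and> v \<le> g b"
  then show ?thesis using crossing_interval_up[of a b g u v] assms(1-3) by blast
next
  assume "v \<le> g a \<and> g b \<le> u"
  then obtain a' b' where "a \<le> a'" "a' \<le> b'" "b' \<le> b" "- g a' = - v" "- g b' = - u"
    "\<forall>x\<in>{a'..b'}. - g x \<in> {-v..-u}"
    using crossing_interval_up[of a b "\<lambda>x. - g x" "-v" "-u"] assms(1-3)
    by (auto simp: continuous_on_minus)
  then show ?thesis by (intro exI[of _ a'] exI[of _ b']) auto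
qed

definition weighted_dist :: "real \<Rightarrow> real \<times> real \<Rightarrow> real \<times> real \<Rightarrow> real" where
  "weighted_dist \<kappa> z w = \<bar>fst z - fst w\<bar> + \<bar>snd z - snd w\<bar> / \<kappa>"

definition digit_value :: "nat \<Rightarrow> (nat \<Rightarrow> nat) \<Rightarrow> real" where
  "digit_value N e = (\<Sum>n. real (e n) / real N ^ Suc n)"

lemma digit_value_tail:
  assumes N: "2 \<le> N" and e: "\<And>n. e n < N"
  shows "summable (\<lambda>n. real (e n) / real N ^ Suc n)" "digit_value N e \<in> {0..1}"
proof -
  have geo: "(\<lambda>n. (1 / real N) ^ n) sums (1 / (1 - 1 / real N))"
    using N by (intro geometric_sums) auto
  have "(\<lambda>n. (real N - 1) / real N * (1 / real N) ^ n) sums ((real N - 1) / real N * (1 / (1 - 1 / real N)))"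
    by (intro sums_mult geo)
  moreover have "(real N - 1) / real N * (1 / (1 - 1 / real N)) = 1" using N by (simp add: field_simps)
  ultimately have one: "(\<lambda>n. (real N - 1) / real N ^ Suc n) sums 1"
    using N by (simp add: power_divide)
  have le: "real (e n) / real N ^ Suc n \<le> (real N - 1) / real N ^ Suc n" for n
    using e[of n] N by (intro divide_right_mono) auto
  show sm: "summable (\<lambda>n. real (e n) / real N ^ Suc n)"
    by (rule summable_comparison_test'[OF sums_summable[OF one]]) (use le in auto)
  show "digit_value N e \<in> {0..1}"
    unfolding digit_value_def using suminf_le[OF le sm sums_summable[OF one]] sums_unique[OF one] sm
    by (auto intro!: suminf_nonneg)
qed

lemma digit_value_diff_le:
  assumes N: "2 \<le> N" and e: "\<And>n. e n < N" "\<And>n. e' n < N" and eq: "\<And>k. k < n \<Longrightarrow> e k = e' k"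
  shows "\<bar>digit_value N e - digit_value N e'\<bar> \<le> (1 / real N) ^ n"
proof -
  have split: "digit_value N e = (\<Sum>k<n. real (e k) / real N ^ Suc k) + (1 / real N) ^ n * digit_value N (\<lambda>k. e (k + n))"
    if "\<And>n. e n < N" for e
  proof -
    have "digit_value N e = (\<Sum>k. real (e (k + n)) / real N ^ Suc (k + n)) + (\<Sum>k<n. real (e k) / real N ^ Suc k)"
      unfolding digit_value_def using digit_value_tail(1)[OF N that] by (rule suminf_split_initial_segment)
    also have "(\<Sum>k. real (e (k + n)) / real N ^ Suc (k + n))
        = (\<Sum>k. (1 / real N) ^ n * (real (e (k + n)) / real N ^ Suc k))"
      by (simp add: power_add power_divide ac_simps)
    also have "\<dots> = (1 / real N) ^ n * digit_value N (\<lambda>k. e (k + n))"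
      unfolding digit_value_def by (intro suminf_mult digit_value_tail(1) N that)
    finally show ?thesis by simp
  qed
  have "(\<Sum>k<n. real (e k) / real N ^ Suc k) = (\<Sum>k<n. real (e' k) / real N ^ Suc k)"
    using eq by (intro sum.cong) auto
  then have eq1: "digit_value N e - digit_value N e' = (1 / real N) ^ n *
      (digit_value N (\<lambda>k. e (k + n)) - digit_value N (\<lambda>k. e' (k + n)))"
    by (simp only: split[of e, OF e(1)] split[of e', OF e(2)] right_diff_distrib add_diff_cancel_left)
  have "\<bar>digit_value N e - digit_value N e'\<bar> =
      \<bar>(1 / real N) ^ n\<bar> * \<bar>digit_value N (\<lambda>k. e (k + n)) - digit_value N (\<lambda>k. e' (k + n))\<bar>"
    unfolding eq1 by (rule abs_mult)
  also have "\<bar>(1 / real N) ^ n\<bar> = (1 / real N) ^ n" by simp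
  also have "(1 / real N) ^ n * \<bar>digit_value N (\<lambda>k. e (k + n)) - digit_value N (\<lambda>k. e' (k + n))\<bar>
      \<le> (1 / real N) ^ n * 1"
    using digit_value_tail(2)[OF N, of "\<lambda>k. e (k + n)"] digit_value_tail(2)[OF N, of "\<lambda>k. e' (k + n)"] e
    by (intro mult_left_mono) auto
  finally show ?thesis by simp
qed

text \<open>The greedy expansion; capping the digit at \<open>N - 1\<close> makes it work for \<open>c = 1\<close> as well.\<close>

lemma digit_expansion_exists:
  assumes N: "2 \<le> N" and c: "c \<in> {0..1}"
  obtains e where "\<And>n. e n < N" "digit_value N e = c"
proof -
  define dig where "dig y = min (N - 1) (nat \<lfloor>real N * y\<rfloor>)" for y
  define r where "r = rec_nat c (\<lambda>_ y. real N * y - real (dig y))"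
  have r: "r 0 = c" "r (Suc n) = real N * r n - real (dig (r n))" for n by (simp_all add: r_def)
  have r01: "r n \<in> {0..1}" for n
  proof (induction n)
    case (Suc n)
    have "0 \<le> real N * r n" "real N * r n \<le> real N"
      using Suc by (auto intro: mult_left_le)
    then show ?case using N unfolding r dig_def
      by (auto simp: min_def of_nat_diff not_le) linarith+
  qed (use c r in simp)
  define e where "e n = dig (r n)" for n
  have e: "e n < N" for n using N by (simp add: e_def dig_def)
  have part: "c = (\<Sum>k<n. real (e k) / real N ^ Suc k) + r n / real N ^ n" for n
  proof (induction n)
    case (Suc n)
    have "r n / real N ^ n = real (e n) / real N ^ Suc n + r (Suc n) / real N ^ Suc n"
      using N by (simp add: r e_def field_simps)
    then show ?case using Suc by simp
  qed (simp add: r)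
  have "(\<lambda>n. (1 / real N) ^ n) \<longlonglongrightarrow> 0" using N by (intro LIMSEQ_power_zero) auto
  then have "(\<lambda>n. r n / real N ^ n) \<longlonglongrightarrow> 0"
  proof (rule tendsto_sandwich[rotated 2, OF tendsto_const])
    show "eventually (\<lambda>n. 0 \<le> r n / real N ^ n) sequentially" using r01 by (intro always_eventually allI) auto
    show "eventually (\<lambda>n. r n / real N ^ n \<le> (1 / real N) ^ n) sequentially"
    proof (intro always_eventually allI)
      fix n
      have "r n / real N ^ n \<le> 1 / real N ^ n" using r01[of n] by (intro divide_right_mono) auto
      then show "r n / real N ^ n \<le> (1 / real N) ^ n" by (simp add: power_divide)
    qed
  qed
  then have "(\<lambda>n. c - r n / real N ^ n) \<longlonglongrightarrow> c - 0" by (intro tendsto_intros)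
  then have "(\<lambda>n. real (e n) / real N ^ Suc n) sums c"
    unfolding sums_def using part by (metis (no_types, lifting) add_diff_cancel_right' diff_zero ext)
  then have "digit_value N e = c" unfolding digit_value_def by (rule sums_unique[symmetric])
  with that e show thesis by blast
qed

text \<open>A topological horseshoe: on each of the \<open>N\<close> cells (vertical strips of height \<open>2 \<delta>\<close>) the first coordinate of
  \<open>F\<close> stretches the cell across \<open>[0, 1]\<close>, while the second coordinate stays below \<open>\<delta>\<close>. The stretching makes every
  itinerary occur, by the intermediate value theorem; the upper bound \<open>D\<close> for the expansion, together with the
  gaps between cells, keeps parameters with different itineraries apart.\<close>

locale horseshoe =
  fixes F :: "real \<times> real \<Rightarrow> real \<times> real" and N :: nat and D gap \<delta> \<kappa> :: real and lo hi :: "nat \<Rightarrow> real"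
  assumes cont: "continuous_on UNIV F"
    and N: "2 \<le> N" and D: "1 \<le> D" and gap: "0 < gap" and \<kappa>: "0 < \<kappa>"
    and cells: "\<And>i. i < N \<Longrightarrow> 0 \<le> lo i \<and> lo i \<le> hi i \<and> hi i \<le> 1"
    and separated: "\<And>i j x y. \<lbrakk>i < N; j < N; i \<noteq> j; x \<in> {lo i..hi i}; y \<in> {lo j..hi j}\<rbrakk> \<Longrightarrow> gap \<le> \<bar>x - y\<bar>"
    and covers: "\<And>i d. i < N \<Longrightarrow> \<bar>d\<bar> \<le> \<delta> \<Longrightarrow> fst (F (lo i, d)) \<le> 0 \<and> 1 \<le> fst (F (hi i, d))"
    and contracts: "\<And>i x d. \<lbrakk>i < N; x \<in> {lo i..hi i}; \<bar>d\<bar> \<le> \<delta>\<rbrakk> \<Longrightarrow> \<bar>snd (F (x, d))\<bar> \<le> \<delta>"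
    and expands: "\<And>i z w. \<lbrakk>i < N; fst z \<in> {lo i..hi i}; fst w \<in> {lo i..hi i}; \<bar>snd z\<bar> \<le> \<delta>; \<bar>snd w\<bar> \<le> \<delta>\<rbrakk>
      \<Longrightarrow> weighted_dist \<kappa> (F z) (F w) \<le> D * weighted_dist \<kappa> z w"
begin

definition code :: "real \<times> real \<Rightarrow> nat" where
  "code z = (SOME i. i < N \<and> fst z \<in> {lo i..hi i})"

definition coded :: "real \<times> real \<Rightarrow> bool" where
  "coded z \<longleftrightarrow> (\<exists>i<N. fst z \<in> {lo i..hi i}) \<and> \<bar>snd z\<bar> \<le> \<delta>"

lemma code: "coded z \<Longrightarrow> code z < N \<and> fst z \<in> {lo (code z)..hi (code z)}"
  unfolding code_def coded_def by (rule someI_ex) blast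

lemma code_unique:
  assumes "i < N" "fst z \<in> {lo i..hi i}" "\<bar>snd z\<bar> \<le> \<delta>"
  shows "coded z" "code z = i"
proof -
  show c: "coded z" using assms by (auto simp: coded_def)
  show "code z = i"
    using separated[of "code z" i "fst z" "fst z"] code[OF c] assms gap by auto
qed

definition crosses :: "(real \<Rightarrow> real \<times> real) \<Rightarrow> real \<Rightarrow> real \<Rightarrow> bool" where
  "crosses g a b \<longleftrightarrow> a \<le> b \<and> continuous_on {a..b} g \<and>
     (fst (g a) = 0 \<and> fst (g b) = 1 \<or> fst (g a) = 1 \<and> fst (g b) = 0) \<and>
     (\<forall>E\<in>{a..b}. fst (g E) \<in> {0..1} \<and> \<bar>snd (g E)\<bar> \<le> \<delta>)"

text \<open>Crossing is the invariant that a block reproduces: the curve is cut to a piece crossing the cell, whose image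
  overshoots \<open>[0, 1]\<close> by the stretching, and is then cut once more.\<close>

lemma crosses_step:
  assumes "crosses g a b" "i < N"
  obtains a' b' where "{a'..b'} \<subseteq> {a..b}" "crosses (\<lambda>E. F (g E)) a' b'"
    "\<And>E. E \<in> {a'..b'} \<Longrightarrow> coded (g E) \<and> code (g E) = i"
proof -
  have g: "a \<le> b" "continuous_on {a..b} g"
    "fst (g a) = 0 \<and> fst (g b) = 1 \<or> fst (g a) = 1 \<and> fst (g b) = 0"
    "\<And>E. E \<in> {a..b} \<Longrightarrow> fst (g E) \<in> {0..1} \<and> \<bar>snd (g E)\<bar> \<le> \<delta>"
    using assms(1) by (auto simp: crosses_def)
  have ends: "fst (g a) \<le> lo i \<and> hi i \<le> fst (g b) \<or> hi i \<le> fst (g a) \<and> fst (g b) \<le> lo i"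
    using g(3) cells[OF assms(2)] by auto
  obtain a1 b1 where 1: "a \<le> a1" "a1 \<le> b1" "b1 \<le> b"
    "fst (g a1) = lo i \<and> fst (g b1) = hi i \<or> fst (g a1) = hi i \<and> fst (g b1) = lo i"
    "\<forall>E\<in>{a1..b1}. fst (g E) \<in> {lo i..hi i}"
    using crossing_interval[OF g(1) continuous_on_fst[OF g(2)] _ ends] cells[OF assms(2)] by blast
  have cF: "continuous_on {a..b} (\<lambda>E. F (g E))"
    using continuous_on_compose2[OF cont g(2)] by auto
  have d: "\<bar>snd (g E)\<bar> \<le> \<delta>" if "E \<in> {a1..b1}" for E using g(4)[of E] that 1 by auto
  have "fst (F (g a1)) \<le> 0 \<and> 1 \<le> fst (F (g b1)) \<or> 1 \<le> fst (F (g a1)) \<and> fst (F (g b1)) \<le> 0"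
    using 1(4) covers[OF assms(2) d[of a1]] covers[OF assms(2) d[of b1]] 1(2)
    by (metis atLeastAtMost_iff order_refl prod.collapse)
  note ends1 = this
  have "continuous_on {a1..b1} (\<lambda>E. F (g E))"
    using cF by (rule continuous_on_subset) (use 1 in auto)
  from crossing_interval[OF 1(2) continuous_on_fst[OF this], of 0 1] ends1
  obtain a' b' where 2: "a1 \<le> a'" "a' \<le> b'" "b' \<le> b1"
    "fst (F (g a')) = 0 \<and> fst (F (g b')) = 1 \<or> fst (F (g a')) = 1 \<and> fst (F (g b')) = 0"
    "\<forall>E\<in>{a'..b'}. fst (F (g E)) \<in> {0..1}"
    by auto
  have cell: "fst (g E) \<in> {lo i..hi i} \<and> \<bar>snd (g E)\<bar> \<le> \<delta>" if "E \<in> {a'..b'}" for E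
    using that 1(5) d[of E] 2 by auto
  show thesis
  proof (rule that)
    show "{a'..b'} \<subseteq> {a..b}" using 1 2 by auto
    have "\<bar>snd (F (g E))\<bar> \<le> \<delta>" if "E \<in> {a'..b'}" for E
      using contracts[OF assms(2), of "fst (g E)" "snd (g E)"] cell[OF that] by simp
    then show "crosses (\<lambda>E. F (g E)) a' b'"
      unfolding crosses_def using 1 2 continuous_on_subset[OF cF, of "{a'..b'}"] by auto
    show "coded (g E) \<and> code (g E) = i" if "E \<in> {a'..b'}" for E
      using code_unique[OF assms(2)] cell[OF that] by blast
  qed
qed

text \<open>Compactness of nested parameter intervals passes from finite to infinite itineraries.\<close>

lemma itinerary_exists:
  assumes "crosses g a b" "\<And>n. e n < N"
  shows "\<exists>E\<in>{a..b}. \<forall>n. coded ((F ^^ n) (g E)) \<and> code ((F ^^ n) (g E)) = e n"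
proof -
  let ?P = "\<lambda>n (I :: real \<times> real). {fst I..snd I} \<subseteq> {a..b} \<and> crosses (\<lambda>E. (F ^^ n) (g E)) (fst I) (snd I)"
  let ?Q = "\<lambda>n (I :: real \<times> real) J. {fst J..snd J} \<subseteq> {fst I..snd I} \<and>
     (\<forall>E\<in>{fst J..snd J}. coded ((F ^^ n) (g E)) \<and> code ((F ^^ n) (g E)) = e n)"
  have "\<exists>I. \<forall>n. ?P n (I n) \<and> ?Q n (I n) (I (Suc n))"
  proof (rule dependent_nat_choice)
    show "\<exists>I. ?P 0 I" using assms(1) by (intro exI[of _ "(a, b)"]) simp
    fix I n assume I: "?P n I"
    obtain a' b' where "{a'..b'} \<subseteq> {fst I..snd I}" "crosses (\<lambda>E. F ((F ^^ n) (g E))) a' b'"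
      "\<And>E. E \<in> {a'..b'} \<Longrightarrow> coded ((F ^^ n) (g E)) \<and> code ((F ^^ n) (g E)) = e n"
      using crosses_step[OF I[THEN conjunct2] assms(2)[of n]] by blast
    then show "\<exists>J. ?P (Suc n) J \<and> ?Q n I J" using I by (intro exI[of _ "(a', b')"]) auto
  qed
  then obtain I where I: "\<And>n. ?P n (I n)" "\<And>n. ?Q n (I n) (I (Suc n))" by blast
  define K where "K n = {fst (I n)..snd (I n)}" for n
  have "K (Suc n) \<subseteq> K n" for n using I(2) by (simp add: K_def)
  then have anti: "K n \<subseteq> K m" if "m \<le> n" for m n using that by (rule lift_Suc_antimono_le)
  have "\<Inter> (range K) \<noteq> {}"
  proof (rule compact_nest)
    show "compact (K n)" "K n \<noteq> {}" for n using I(1)[of n] by (auto simp: K_def crosses_def)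
  qed (rule anti)
  then obtain E where E: "\<And>n. E \<in> K n" by blast
  show ?thesis
  proof (intro bexI allI)
    show "E \<in> {a..b}" using E[of 0] I(1)[of 0] by (auto simp: K_def)
    show "coded ((F ^^ n) (g E)) \<and> code ((F ^^ n) (g E)) = e n" for n
      using E[of "Suc n"] I(2)[of n] by (auto simp: K_def)
  qed
qed

lemma expands_along_itinerary:
  assumes "\<And>k. k < n \<Longrightarrow> coded ((F ^^ k) z) \<and> coded ((F ^^ k) w) \<and> code ((F ^^ k) z) = code ((F ^^ k) w)"
  shows "weighted_dist \<kappa> ((F ^^ n) z) ((F ^^ n) w) \<le> D ^ n * weighted_dist \<kappa> z w"
  using assms
proof (induction n)
  case (Suc n)
  let ?z = "(F ^^ n) z" and ?w = "(F ^^ n) w"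
  have c: "coded ?z" "coded ?w" "code ?z = code ?w" using Suc.prems[of n] by auto
  have "weighted_dist \<kappa> (F ?z) (F ?w) \<le> D * weighted_dist \<kappa> ?z ?w"
    using code[OF c(1)] code[OF c(2)] c by (intro expands[of "code ?z"]) (auto simp: coded_def)
  also have "\<dots> \<le> D * (D ^ n * weighted_dist \<kappa> z w)"
    using Suc D by (intro mult_left_mono) auto
  finally show ?case by (simp add: mult.assoc)
qed simp

text \<open>Reading the itinerary of a parameter as a base \<open>N\<close> expansion maps a Cantor set of parameters onto
  \<open>[0, 1]\<close>. If two itineraries first differ at time \<open>n\<close>, the orbits are then \<open>gap\<close> apart, so the parameters differ by
  at least \<open>D\<^sup>-\<^sup>n\<close> up to a constant, whereas the values of the expansions differ by at most \<open>N\<^sup>-\<^sup>n\<close>. Since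
  \<open>D\<^sup>s \<le> N\<close>, the map is \<open>s\<close>-Hoelder.\<close>

theorem holder_onto_unit_interval:
  assumes g: "crosses g a b" and C: "0 < C" "\<And>E E'. E \<in> {a..b} \<Longrightarrow> E' \<in> {a..b} \<Longrightarrow>
      weighted_dist \<kappa> (g E) (g E') \<le> C * \<bar>E - E'\<bar>"
    and s: "0 < s" "D powr s \<le> real N"
  obtains f :: "real \<Rightarrow> real" and A B where "0 < A" "{0..1} \<subseteq> f ` B"
    "\<And>E E'. E \<in> B \<Longrightarrow> E' \<in> B \<Longrightarrow> \<bar>f E - f E'\<bar> \<le> A * dist E E' powr s"
    "\<And>E n. E \<in> B \<Longrightarrow> fst ((F ^^ n) (g E)) \<in> {0..1}"
proof -
  define B where "B = {E \<in> {a..b}. \<forall>n. coded ((F ^^ n) (g E))}"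
  define cd where "cd E n = code ((F ^^ n) (g E))" for E n
  define f where "f E = digit_value N (cd E)" for E
  have cd: "cd E n < N" if "E \<in> B" for E n using code that by (auto simp: B_def cd_def)
  show thesis
  proof (rule that[of "(C / gap) powr s" f B])
    show "0 < (C / gap) powr s" using C gap by simp
    show "{0..1} \<subseteq> f ` B"
    proof
      fix c :: real assume "c \<in> {0..1}"
      then obtain e where e: "\<And>n. e n < N" "digit_value N e = c"
        using digit_expansion_exists[OF N] by blast
      from itinerary_exists[of g a b e, OF g e(1)]
      obtain E where E: "E \<in> {a..b}" "\<forall>n. coded ((F ^^ n) (g E)) \<and> code ((F ^^ n) (g E)) = e n"
        by blast
      have "E \<in> B" using E unfolding B_def by simp
      have "cd E = e" by (rule ext) (simp add: cd_def E(2))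
      then have "c = f E" unfolding f_def using e(2) by simp
      then show "c \<in> f ` B" using \<open>E \<in> B\<close> by (rule image_eqI)
    qed
  next
    fix E E' assume E: "E \<in> B" "E' \<in> B"
    show "\<bar>f E - f E'\<bar> \<le> (C / gap) powr s * dist E E' powr s"
    proof (cases "cd E = cd E'")
      case True
      then show ?thesis by (simp add: f_def)
    next
      case False
      then obtain n0 where "cd E n0 \<noteq> cd E' n0" by auto
      define n where "n = (LEAST n. cd E n \<noteq> cd E' n)"
      have n: "cd E n \<noteq> cd E' n" unfolding n_def by (rule LeastI) fact
      have less: "cd E k = cd E' k" if "k < n" for k
        using not_less_Least[of k "\<lambda>n. cd E n \<noteq> cd E' n"] that unfolding n_def by simp
      have coded: "coded ((F ^^ k) (g E))" "coded ((F ^^ k) (g E'))" for k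
        using E by (simp_all add: B_def)
      have "gap \<le> \<bar>fst ((F ^^ n) (g E)) - fst ((F ^^ n) (g E'))\<bar>"
        by (rule separated[OF cd[OF E(1), of n] cd[OF E(2), of n] n])
          (unfold cd_def, (rule code[THEN conjunct2], rule coded)+)
      also have "\<dots> \<le> weighted_dist \<kappa> ((F ^^ n) (g E)) ((F ^^ n) (g E'))"
        using \<kappa> by (simp add: weighted_dist_def)
      also have "\<dots> \<le> D ^ n * weighted_dist \<kappa> (g E) (g E')"
        by (rule expands_along_itinerary) (use less coded in \<open>simp add: cd_def\<close>)
      also have "\<dots> \<le> D ^ n * (C * \<bar>E - E'\<bar>)"
        by (intro mult_left_mono C(2)) (use E D in \<open>simp_all add: B_def\<close>)
      finally have "1 \<le> D ^ n * (C / gap * dist E E')"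
        using gap by (simp add: dist_real_def field_simps)
      then have "1 powr s \<le> (D ^ n * (C / gap * dist E E')) powr s"
        using s by (intro powr_mono2) auto
      also have "\<dots> = (D powr s) ^ n * ((C / gap) powr s * dist E E' powr s)"
      proof -
        have "(D ^ n) powr s = (D powr s) ^ n"
          using D by (simp add: powr_realpow[symmetric] powr_powr mult.commute)
        then show ?thesis using D C gap by (simp only: powr_mult zero_le_power zero_le_divide_iff
            mult_nonneg_nonneg zero_le_dist less_imp_le order_trans[OF zero_le_one])
      qed
      also have "\<dots> \<le> real N ^ n * ((C / gap) powr s * dist E E' powr s)"
        using s by (intro mult_right_mono power_mono) auto
      finally have "(1 / real N) ^ n \<le> (C / gap) powr s * dist E E' powr s"
        using N by (simp add: power_divide divide_le_eq mult.commute)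
      moreover have "\<bar>f E - f E'\<bar> \<le> (1 / real N) ^ n"
        unfolding f_def using cd E less by (intro digit_value_diff_le N) auto
      ultimately show ?thesis by linarith
    qed
  next
    fix E n assume "E \<in> B"
    then have "coded ((F ^^ n) (g E))" by (simp add: B_def)
    from code[OF this] show "fst ((F ^^ n) (g E)) \<in> {0..1}"
      using cells[of "code ((F ^^ n) (g E))"] by auto
  qed
qed

end

section \<open>The trace map near zero defect\<close>

text \<open>Bounding \<open>f\<close> and its Lipschitz constant together makes the class closed under products.\<close>

definition bounded_lipschitz_on :: "'a::metric_space set \<Rightarrow> ('a \<Rightarrow> real) \<Rightarrow> bool" where
  "bounded_lipschitz_on S f \<longleftrightarrow> (\<exists>L. \<forall>z\<in>S. \<bar>f z\<bar> \<le> L \<and> (\<forall>w\<in>S. \<bar>f z - f w\<bar> \<le> L * dist z w))"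

lemma bounded_lipschitz_onE:
  assumes "bounded_lipschitz_on S f"
  obtains L where "0 \<le> L" "\<And>z. z \<in> S \<Longrightarrow> \<bar>f z\<bar> \<le> L"
    "\<And>z w. z \<in> S \<Longrightarrow> w \<in> S \<Longrightarrow> \<bar>f z - f w\<bar> \<le> L * dist z w"
proof -
  obtain L where L: "\<And>z. z \<in> S \<Longrightarrow> \<bar>f z\<bar> \<le> L"
    "\<And>z w. z \<in> S \<Longrightarrow> w \<in> S \<Longrightarrow> \<bar>f z - f w\<bar> \<le> L * dist z w"
    using assms by (auto simp: bounded_lipschitz_on_def)
  have le: "L * dist z w \<le> \<bar>L\<bar> * dist z w" for z w :: 'a by (intro mult_right_mono) auto
  show thesis
  proof (rule that[of "\<bar>L\<bar>"])
    show "\<bar>f z\<bar> \<le> \<bar>L\<bar>" if "z \<in> S" for z using L(1)[OF that] by linarith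
    show "\<bar>f z - f w\<bar> \<le> \<bar>L\<bar> * dist z w" if "z \<in> S" "w \<in> S" for z w
      using L(2)[OF that] le[of z w] by linarith
  qed simp
qed

lemma bounded_lipschitz_on_const: "bounded_lipschitz_on S (\<lambda>z. c)"
  unfolding bounded_lipschitz_on_def by (intro exI[of _ "\<bar>c\<bar>"]) auto

lemma bounded_lipschitz_on_add:
  assumes "bounded_lipschitz_on S f" "bounded_lipschitz_on S g"
  shows "bounded_lipschitz_on S (\<lambda>z. f z + g z)"
proof -
  obtain L where L: "0 \<le> L" "\<And>z. z \<in> S \<Longrightarrow> \<bar>f z\<bar> \<le> L"
    "\<And>z w. z \<in> S \<Longrightarrow> w \<in> S \<Longrightarrow> \<bar>f z - f w\<bar> \<le> L * dist z w"
    by (rule bounded_lipschitz_onE[OF assms(1)]) blast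
  obtain M where M: "0 \<le> M" "\<And>z. z \<in> S \<Longrightarrow> \<bar>g z\<bar> \<le> M"
    "\<And>z w. z \<in> S \<Longrightarrow> w \<in> S \<Longrightarrow> \<bar>g z - g w\<bar> \<le> M * dist z w"
    by (rule bounded_lipschitz_onE[OF assms(2)]) blast
  show ?thesis unfolding bounded_lipschitz_on_def
  proof (intro exI[of _ "L + M"] ballI conjI)
    fix z w assume zw: "z \<in> S" "w \<in> S"
    show "\<bar>f z + g z - (f w + g w)\<bar> \<le> (L + M) * dist z w"
      using L(3)[OF zw] M(3)[OF zw] by (simp add: distrib_right)
  next
    fix z assume z: "z \<in> S"
    show "\<bar>f z + g z\<bar> \<le> L + M" using L(2)[OF z] M(2)[OF z] by simp
  qed
qed

lemma abs_mult_diff_le: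
  fixes a b c d :: real
  assumes "\<bar>a\<bar> \<le> A" "\<bar>d\<bar> \<le> B" "\<bar>b - d\<bar> \<le> u" "\<bar>a - c\<bar> \<le> v"
  shows "\<bar>a * b - c * d\<bar> \<le> A * u + B * v"
proof -
  have "a * b - c * d = a * (b - d) + d * (a - c)" by (simp add: algebra_simps)
  then have "\<bar>a * b - c * d\<bar> \<le> \<bar>a\<bar> * \<bar>b - d\<bar> + \<bar>d\<bar> * \<bar>a - c\<bar>"
    by (metis abs_mult abs_triangle_ineq)
  also have "\<dots> \<le> A * u + B * v" using assms by (intro add_mono mult_mono) auto
  finally show ?thesis .
qed

lemma bounded_lipschitz_on_mult:
  assumes "bounded_lipschitz_on S f" "bounded_lipschitz_on S g"
  shows "bounded_lipschitz_on S (\<lambda>z. f z * g z)"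
proof -
  obtain L where L: "0 \<le> L" "\<And>z. z \<in> S \<Longrightarrow> \<bar>f z\<bar> \<le> L"
    "\<And>z w. z \<in> S \<Longrightarrow> w \<in> S \<Longrightarrow> \<bar>f z - f w\<bar> \<le> L * dist z w"
    by (rule bounded_lipschitz_onE[OF assms(1)]) blast
  obtain M where M: "0 \<le> M" "\<And>z. z \<in> S \<Longrightarrow> \<bar>g z\<bar> \<le> M"
    "\<And>z w. z \<in> S \<Longrightarrow> w \<in> S \<Longrightarrow> \<bar>g z - g w\<bar> \<le> M * dist z w"
    by (rule bounded_lipschitz_onE[OF assms(2)]) blast
  show ?thesis unfolding bounded_lipschitz_on_def
  proof (intro exI[of _ "2 * (L * M)"] ballI conjI)
    fix z w assume zw: "z \<in> S" "w \<in> S"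
    show "\<bar>f z * g z - f w * g w\<bar> \<le> 2 * (L * M) * dist z w"
      using abs_mult_diff_le[OF L(2)[OF zw(1)] M(2)[OF zw(2)] M(3)[OF zw] L(3)[OF zw]]
      by (simp add: algebra_simps)
  next
    fix z assume z: "z \<in> S"
    have "\<bar>f z * g z\<bar> \<le> L * M" unfolding abs_mult using L(1,2) M(2) z by (intro mult_mono) auto
    also have "\<dots> \<le> 2 * (L * M)" using L(1) M(1) by simp
    finally show "\<bar>f z * g z\<bar> \<le> 2 * (L * M)" .
  qed
qed

lemma bounded_lipschitz_on_diff:
  assumes "bounded_lipschitz_on S f" "bounded_lipschitz_on S g"
  shows "bounded_lipschitz_on S (\<lambda>z. f z - g z)"
  using bounded_lipschitz_on_add[OF assms(1) bounded_lipschitz_on_mult[OF bounded_lipschitz_on_const[of S "-1"] assms(2)]]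
  by simp

lemmas bounded_lipschitz_on_intros = bounded_lipschitz_on_const bounded_lipschitz_on_add
  bounded_lipschitz_on_mult bounded_lipschitz_on_diff

text \<open>The convex region of traces and defects on which the perturbation estimates are made.\<close>

definition trace_box :: "(real \<times> real) set" where "trace_box = {-2..2} \<times> {-1..1}"

lemma bounded_lipschitz_on_coordinates:
  "bounded_lipschitz_on trace_box fst" "bounded_lipschitz_on trace_box snd"
proof -
  have "\<bar>fst z - fst w\<bar> \<le> 2 * dist z w" "\<bar>snd z - snd w\<bar> \<le> 2 * dist z w" for z w :: "real \<times> real"
    using dist_fst_le[of z w] dist_snd_le[of z w] zero_le_dist[of z w]
    unfolding dist_real_def by linarith+
  moreover have "\<bar>fst z\<bar> \<le> 2 \<and> \<bar>snd z\<bar> \<le> 2" if "z \<in> trace_box" for z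
    using that by (auto simp: trace_box_def)
  ultimately show "bounded_lipschitz_on trace_box fst" "bounded_lipschitz_on trace_box snd"
    unfolding bounded_lipschitz_on_def by blast+
qed

definition doubling :: "nat \<Rightarrow> real \<Rightarrow> real" where
  "doubling j = (\<lambda>x. x\<^sup>2 - 2) ^^ j"

lemma doubling_simps: "doubling 0 x = x" "doubling (Suc j) x = (doubling j x)\<^sup>2 - 2"
  by (simp_all add: doubling_def)

lemma doubling_cos: "doubling j (2 * cos \<theta>) = 2 * cos (2 ^ j * \<theta>)"
proof (induction j)
  case (Suc j)
  show ?case using cos_double_cos[of "2 ^ j * \<theta>"]
    by (simp add: doubling_simps Suc power_mult_distrib mult.assoc)
qed (simp add: doubling_simps)

text \<open>Expansion of the trace map around defect 0, where it is angle doubling. The defect after \<open>j\<close> steps is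
  exactly proportional to the initial one, with a factor that is the product of the \<open>2 - x\<^sub>i\<close>.\<close>

lemma trace_step_expansion:
  "\<exists>R P. bounded_lipschitz_on trace_box R \<and> bounded_lipschitz_on trace_box P \<and>
     bounded_lipschitz_on trace_box (\<lambda>z. doubling j (fst z)) \<and>
     (\<forall>x d. (trace_step ^^ j) (x, d) = (doubling j x + d * R (x, d), d * P (x, d))) \<and>
     (\<forall>x. P (x, 0) = (\<Prod>i=1..j. 2 - doubling i x))"
proof (induction j)
  case 0
  show ?case
    by (intro exI[of _ "\<lambda>_. 0"] exI[of _ "\<lambda>_. 1"])
      (simp add: doubling_simps bounded_lipschitz_on_const bounded_lipschitz_on_coordinates)
next
  case (Suc j)
  then obtain R P where RP: "bounded_lipschitz_on trace_box R" "bounded_lipschitz_on trace_box P"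
    "bounded_lipschitz_on trace_box (\<lambda>z. doubling j (fst z))"
    "\<And>x d. (trace_step ^^ j) (x, d) = (doubling j x + d * R (x, d), d * P (x, d))"
    "\<And>x. P (x, 0) = (\<Prod>i=1..j. 2 - doubling i x)" by blast
  define R' where "R' z = 2 * doubling j (fst z) * R z + snd z * (R z * R z) + P z" for z
  define P' where "P' z = (4 - (doubling j (fst z) + snd z * R z) * (doubling j (fst z) + snd z * R z)
     - snd z * P z) * P z" for z
  have "bounded_lipschitz_on trace_box R'" "bounded_lipschitz_on trace_box P'"
    "bounded_lipschitz_on trace_box (\<lambda>z. doubling (Suc j) (fst z))"
    unfolding R'_def P'_def doubling_simps power2_eq_square
    by (intro bounded_lipschitz_on_intros bounded_lipschitz_on_coordinates RP)+
  moreover have "(trace_step ^^ Suc j) (x, d) = (doubling (Suc j) x + d * R' (x, d), d * P' (x, d))" for x d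
    unfolding funpow.simps comp_apply RP(4)
    by (simp add: trace_step_def R'_def P'_def doubling_simps power2_eq_square algebra_simps)
  moreover have "P' (x, 0) = (\<Prod>i=1..Suc j. 2 - doubling i x)" for x
    by (simp add: P'_def RP(5) doubling_simps power2_eq_square)
  ultimately show ?case by blast
qed

lemma two_minus_two_cos_le: "2 - 2 * cos x \<le> x\<^sup>2" for x :: real
proof -
  have "2 - 2 * cos x = (2 * sin (x / 2))\<^sup>2"
    using cos_double_sin[of "x / 2"] by (simp add: power_mult_distrib)
  also have "\<dots> \<le> x\<^sup>2"
    using abs_sin_x_le_abs_x[of "x / 2"] by (subst abs_le_square_iff[symmetric]) (simp add: abs_mult)
  finally show ?thesis .
qed

lemma cos_add_period: "cos (x + 2 * pi * real m) = cos x"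
  using cos_int_2pin[of "int m"] sin_int_2pin[of "int m"] by (simp add: cos_add)

text \<open>The factors \<open>2 - 2 cos (2\<^sup>i \<theta>)\<close> up to \<open>i = q\<close> are at most 4. If \<open>2\<^sup>q \<theta>\<close> exceeds a
  multiple of \<open>2 \<pi>\<close> by at most \<open>\<pi> / 2\<^sup>t\<close>, then the factor at \<open>q + j\<close> is at most \<open>16 * 4\<^sup>j / 4\<^sup>t\<close>. The product of these
  over \<open>j \<le> t\<close> is \<open>2\<^sup>-\<^sup>t\<^sup>*\<^sup>t\<close> up to a factor exponential in \<open>t\<close>, so about \<open>\<surd>q\<close> steps close to trace 2 outweigh \<open>q\<close> arbitrary ones.\<close>

lemma doubling_product_near_2:
  fixes a \<phi> :: real and K :: nat
  assumes a: "2 ^ q * a = 2 * pi * real K" and \<phi>: "0 \<le> \<phi>" "2 ^ (q + t) * \<phi> \<le> pi"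
  shows "(\<Prod>i=1..q + j. \<bar>2 - 2 * cos (2 ^ i * (a + \<phi>))\<bar>) * 4 ^ (t * j) \<le> 4 ^ q * 16 ^ j * 2 ^ (j * (j + 1))"
proof (induction j)
  case 0
  have "(\<Prod>i=1..q. \<bar>2 - 2 * cos (2 ^ i * (a + \<phi>))\<bar>) \<le> (\<Prod>i=1..q. 4)"
  proof (intro prod_mono conjI)
    fix i
    show "\<bar>2 - 2 * cos (2 ^ i * (a + \<phi>))\<bar> \<le> 4"
      using cos_le_one[of "2 ^ i * (a + \<phi>)"] cos_ge_minus_one[of "2 ^ i * (a + \<phi>)"] by linarith
  qed simp
  then show ?case by simp
next
  case (Suc j)
  define \<psi> where "\<psi> = 2 ^ (q + Suc j) * \<phi>"
  have "2 ^ (q + Suc j) * a = 2 ^ Suc j * (2 ^ q * a)" by (simp add: power_add)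
  also have "\<dots> = 2 * pi * real (2 ^ Suc j * K)" unfolding a by simp
  finally have "cos (2 ^ (q + Suc j) * (a + \<phi>)) = cos (\<psi> + 2 * pi * real (2 ^ Suc j * K))"
    unfolding distrib_left \<psi>_def by (simp only: add.commute)
  also have "\<dots> = cos \<psi>" by (rule cos_add_period)
  finally have c: "\<bar>2 - 2 * cos (2 ^ (q + Suc j) * (a + \<phi>))\<bar> = 2 - 2 * cos \<psi>" by simp
  have "0 \<le> \<psi> * 2 ^ t" using \<phi> by (simp add: \<psi>_def)
  moreover have "\<psi> * 2 ^ t \<le> pi * 2 ^ Suc j"
    using mult_right_mono[OF \<phi>(2), of "2 ^ Suc j"] by (simp add: \<psi>_def power_add algebra_simps)
  moreover have "pi * 2 ^ Suc j \<le> 4 * 2 ^ Suc j" using pi_less_4 by (intro mult_right_mono) auto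
  ultimately have "(\<psi> * 2 ^ t)\<^sup>2 \<le> (4 * 2 ^ Suc j)\<^sup>2" by (intro power_mono) linarith+
  moreover have "(2 ^ t :: real)\<^sup>2 = 4 ^ t" "(2 ^ Suc j :: real)\<^sup>2 = 4 ^ Suc j"
    by (simp_all only: power2_eq_square flip: power_mult_distrib) simp_all
  ultimately have "\<psi>\<^sup>2 * 4 ^ t \<le> 16 * 4 ^ Suc j"
    unfolding power_mult_distrib by simp
  moreover have "(2 - 2 * cos \<psi>) * 4 ^ t \<le> \<psi>\<^sup>2 * 4 ^ t"
    by (intro mult_right_mono two_minus_two_cos_le) auto
  ultimately have new: "(2 - 2 * cos \<psi>) * 4 ^ t \<le> 16 * 4 ^ Suc j" by linarith
  have "(\<Prod>i=1..q + Suc j. \<bar>2 - 2 * cos (2 ^ i * (a + \<phi>))\<bar>) * 4 ^ (t * Suc j)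
      = ((\<Prod>i=1..q + j. \<bar>2 - 2 * cos (2 ^ i * (a + \<phi>))\<bar>) * 4 ^ (t * j)) * ((2 - 2 * cos \<psi>) * 4 ^ t)"
    using c by (simp add: power_add algebra_simps)
  also have "\<dots> \<le> (4 ^ q * 16 ^ j * 2 ^ (j * (j + 1))) * (16 * 4 ^ Suc j)"
    by (intro mult_mono Suc new) (auto intro: mult_nonneg_nonneg prod_nonneg)
  also have "\<dots> = 4 ^ q * 16 ^ Suc j * 2 ^ (Suc j * (Suc j + 1))"
  proof -
    have "(4::real) ^ Suc j = 2 ^ (2 * Suc j)" by (subst power_mult) simp
    then have h: "2 ^ (j * (j + 1)) * (4::real) ^ Suc j = 2 ^ (j * (j + 1) + 2 * Suc j)"
      by (simp only: power_add)
    have "4 ^ q * 16 ^ j * 2 ^ (j * (j + 1)) * (16 * (4::real) ^ Suc j)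
        = 4 ^ q * (16 * 16 ^ j) * (2 ^ (j * (j + 1)) * 4 ^ Suc j)"
      by (simp only: mult_ac)
    also have "\<dots> = 4 ^ q * 16 ^ Suc j * 2 ^ (j * (j + 1) + 2 * Suc j)"
      unfolding h by (simp only: power_Suc)
    also have "j * (j + 1) + 2 * Suc j = Suc j * (Suc j + 1)" by simp
    finally show ?thesis .
  qed
  finally show ?case .
qed

text \<open>Away from 0 the angle is a Lipschitz function of the trace, with constant 1 because \<open>2 sin \<ge> 1\<close> there.\<close>

lemma two_cos_lower_lipschitz:
  assumes "pi / 3 \<le> a" "a \<le> b" "b \<le> pi / 2"
  shows "b - a \<le> 2 * cos a - 2 * cos b"
proof -
  have "2 * cos b + b \<le> 2 * cos a + a"
  proof (rule DERIV_nonpos_imp_nonincreasing[OF assms(2)])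
    fix x assume x: "a \<le> x" "x \<le> b"
    have "sin (pi / 6) \<le> sin x" using x assms pi_gt_zero by (intro sin_monotone_2pi_le) auto
    then have "1 - 2 * sin x \<le> 0" by (simp add: sin_30)
    moreover have "((\<lambda>x. 2 * cos x + x) has_real_derivative (1 - 2 * sin x)) (at x)"
      by (auto intro!: derivative_eq_intros)
    ultimately show "\<exists>y. ((\<lambda>x. 2 * cos x + x) has_real_derivative y) (at x) \<and> y \<le> 0" by blast
  qed
  then show ?thesis by simp
qed

lemma abs_cos_diff_le: "\<bar>cos a - cos b\<bar> \<le> \<bar>a - b\<bar>" for a b :: real
proof -
  have "\<bar>cos a - cos b\<bar> \<le> \<bar>a - b\<bar>" if "a \<le> b" for a b :: real
  proof -
    have "cos a + a \<le> cos b + b"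
    proof (rule DERIV_nonneg_imp_nondecreasing[OF that])
      fix x :: real
      have "((\<lambda>x. cos x + x) has_real_derivative (1 - sin x)) (at x)"
        by (auto intro!: derivative_eq_intros)
      then show "\<exists>y. ((\<lambda>x. cos x + x) has_real_derivative y) (at x) \<and> 0 \<le> y"
        using sin_le_one[of x] by (intro exI[of _ "1 - sin x"]) simp
    qed
    moreover have "a - cos a \<le> b - cos b"
    proof (rule DERIV_nonneg_imp_nondecreasing[OF that])
      fix x :: real
      have "((\<lambda>x. x - cos x) has_real_derivative (1 + sin x)) (at x)"
        by (auto intro!: derivative_eq_intros)
      then show "\<exists>y. ((\<lambda>x. x - cos x) has_real_derivative y) (at x) \<and> 0 \<le> y"
        using sin_ge_minus_one[of x] by (intro exI[of _ "1 + sin x"] conjI) (assumption, linarith)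
    qed
    ultimately show ?thesis using that by linarith
  qed
  from this[of a b] this[of b a] show ?thesis by linarith
qed

lemma dist_prod_le: "dist z w \<le> \<bar>fst z - fst w\<bar> + \<bar>snd z - snd w\<bar>" for z w :: "real \<times> real"
  unfolding dist_prod_def dist_real_def using sqrt_sum_squares_le_sum_abs[of "fst z - fst w" "snd z - snd w"]
  by simp

lemma continuous_on_trace_step_funpow: "continuous_on UNIV (trace_step ^^ j)"
proof (induction j)
  case (Suc j)
  have "continuous_on UNIV trace_step"
    unfolding trace_step_def case_prod_beta by (intro continuous_intros)
  then show ?case using continuous_on_compose2[of UNIV trace_step UNIV "trace_step ^^ j"] Suc
    by (simp add: comp_def)
qed (simp add: id_def)

text \<open>A block of \<open>p = q + t\<close> steps with \<open>q = 4 m\<^sup>2\<close> and \<open>t = 4 m\<close>. The cells are the images of angular intervals of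
  length \<open>\<pi> / 2\<^sup>p\<close> whose left ends are multiples of \<open>2 \<pi> / 2\<^sup>q\<close> between \<open>3 \<pi> / 8\<close> and \<open>\<pi> / 2\<close>; there are \<open>N = 2\<^sup>q / 16\<close>
  of them. After \<open>q\<close> doublings such an interval starts at trace 2, and \<open>t\<close> further doublings spread it over all of
  \<open>[-2, 2]\<close> while they shrink the defect. The expansion per block is at most \<open>4 * 2\<^sup>p\<close>, and
  \<open>log N / log (4 * 2\<^sup>p)\<close> tends to 1 since \<open>t / q\<close> tends to 0. All statements are proved for defect 0 and
  carried over to defects up to \<open>\<delta>\<close>, where \<open>\<delta>\<close> is small depending on \<open>p\<close>.\<close>

lemma trace_step_horseshoe:
  assumes r: "0 < r" "r < 1"
  shows "\<exists>p N D gap \<delta> \<kappa> lo hi. even p \<and> 0 < p \<and> 0 < \<delta> \<and> D powr r \<le> real N \<and>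
    horseshoe (trace_step ^^ p) N D gap \<delta> \<kappa> lo hi"
proof -
  obtain m0 :: nat where m0: "2 / (1 - r) \<le> real m0" using real_arch_simple by blast
  define m where "m = max 3 m0"
  have m3: "3 \<le> m" and "2 / (1 - r) \<le> real m" using m0 by (auto simp: m_def)
  then have mr: "2 \<le> (1 - r) * real m" using r by (simp add: field_simps)
  have mm: "3 * m \<le> m * m" using m3 by simp
  define q t p where "q = 4 * (m * m)" and "t = 4 * m" and "p = q + t"
  define N :: nat where "N = 2 ^ (q - 4)"
  have q4: "4 < q" using mm m3 unfolding q_def by linarith
  have "(2::real) ^ q = 2 ^ (4 + (q - 4))" using q4 by simp
  also have "\<dots> = 2 ^ 4 * 2 ^ (q - 4)" by (rule power_add)
  finally have qN: "(2::real) ^ q = 16 * real N" by (simp add: N_def)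
  have N2: "2 \<le> N" unfolding N_def using power_increasing[of 1 "q - 4" "2::nat"] q4 by simp
  have N0: "0 < real N" using N2 by simp
  define e where "e = (2::real) ^ p"
  have e_eq: "e = 16 * real N * 2 ^ t" by (simp add: e_def p_def power_add qN)
  have t1: "(1::real) \<le> 2 ^ t" by simp
  have e1: "1 \<le> e" by (simp add: e_def)
  define ang where "ang i = pi * real (3 * N + i) / (8 * real N)" for i
  define lo hi where "lo i = 2 * cos (ang i + pi / e)" and "hi i = 2 * cos (ang i)" for i
  have e16: "16 * real N \<le> e" unfolding e_eq using mult_left_mono[OF t1, of "16 * real N"] by simp
  have we: "pi / e \<le> pi / (16 * real N)" using e16 N0 by (intro divide_left_mono) auto
  have ang_bounds: "pi / 3 \<le> ang i" "ang i + pi / e \<le> pi / 2" if "i < N" for i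
  proof -
    have "pi / 3 \<le> pi * real (3 * N) / (8 * real N)" using N0 by (simp add: field_simps)
    also have "\<dots> \<le> ang i" unfolding ang_def using N0 by (intro divide_right_mono mult_left_mono) auto
    finally show "pi / 3 \<le> ang i" .
    have "ang i + pi / e \<le> pi * real (3 * N + i) / (8 * real N) + pi / (8 * real N)"
    proof -
      have "pi / (16 * real N) \<le> pi / (8 * real N)" using N0 by (intro divide_left_mono) auto
      then show ?thesis unfolding ang_def using we by linarith
    qed
    also have "\<dots> = pi * real (3 * N + i + 1) / (8 * real N)"
      by (simp add: add_divide_distrib distrib_left)
    also have "\<dots> \<le> pi * real (4 * N) / (8 * real N)"
      using that N0 by (intro divide_right_mono mult_left_mono) auto
    also have "\<dots> = pi / 2" using N0 by simp
    finally show "ang i + pi / e \<le> pi / 2" .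
  qed
  have w0: "0 < pi / e" using e1 by simp
  \<comment> \<open>coordinates on a cell: the offset \<open>\<phi>\<close> of the angle from its left
    end\<close>
  have cell_ang: "\<exists>\<phi>. 0 \<le> \<phi> \<and> \<phi> \<le> pi / e \<and> x = 2 * cos (ang i + \<phi>)" if i: "i < N" and x: "x \<in> {lo i..hi i}" for i x
  proof -
    note b = ang_bounds[OF i]
    have "0 \<le> cos (ang i + pi / e)" using b w0 pi_gt_zero by (intro cos_ge_zero) linarith+
    then have x01: "-1 \<le> x / 2" "x / 2 \<le> 1" using x cos_le_one[of "ang i"]
      unfolding lo_def hi_def atLeastAtMost_iff by linarith+
    define \<theta> where "\<theta> = arccos (x / 2)"
    have \<theta>: "0 \<le> \<theta>" "\<theta> \<le> pi" "cos \<theta> = x / 2"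
      using arccos_bounded[OF x01] cos_arccos[OF x01] by (auto simp: \<theta>_def)
    have "cos \<theta> \<le> cos (ang i)" "cos (ang i + pi / e) \<le> cos \<theta>" using x \<theta> by (auto simp: lo_def hi_def)
    then have "ang i \<le> \<theta>" "\<theta> \<le> ang i + pi / e"
      using \<theta> b w0 pi_gt_zero by (subst (asm) cos_mono_le_eq; linarith)+
    then show ?thesis using \<theta> by (intro exI[of _ "\<theta> - ang i"]) auto
  qed
  have cells: "0 \<le> lo i \<and> lo i \<le> hi i \<and> hi i \<le> 1" if i: "i < N" for i
  proof (intro conjI)
    note b = ang_bounds[OF i]
    show "0 \<le> lo i" unfolding lo_def using b w0 pi_gt_zero by (intro mult_nonneg_nonneg cos_ge_zero) linarith+
    show "lo i \<le> hi i" unfolding lo_def hi_def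
      using b w0 pi_gt_zero by (intro mult_left_mono cos_monotone_0_pi_le) linarith+
    have "cos (ang i) \<le> cos (pi / 3)" using b w0 pi_gt_zero by (intro cos_monotone_0_pi_le) linarith+
    then show "hi i \<le> 1" by (simp add: hi_def cos_60)
  qed
  have cos_sep: "\<bar>a - b\<bar> \<le> \<bar>2 * cos a - 2 * cos b\<bar>" if "pi / 3 \<le> a" "a \<le> pi / 2" "pi / 3 \<le> b" "b \<le> pi / 2" for a b
    using two_cos_lower_lipschitz[of a b] two_cos_lower_lipschitz[of b a] that by linarith
  define gap where "gap = pi / (16 * real N)"
  have separated: "gap \<le> \<bar>x - y\<bar>" if ij: "i < N" "j < N" "i \<noteq> j" and x: "x \<in> {lo i..hi i}" and y: "y \<in> {lo j..hi j}" for i j x y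
  proof -
    obtain \<phi> where \<phi>: "0 \<le> \<phi>" "\<phi> \<le> pi / e" "x = 2 * cos (ang i + \<phi>)" using cell_ang[OF ij(1) x] by blast
    obtain \<psi> where \<psi>: "0 \<le> \<psi>" "\<psi> \<le> pi / e" "y = 2 * cos (ang j + \<psi>)" using cell_ang[OF ij(2) y] by blast
    have "ang i - ang j = pi / (8 * real N) * (real i - real j)"
      by (simp add: ang_def add_divide_distrib diff_divide_distrib distrib_left right_diff_distrib)
    then have "\<bar>ang i - ang j\<bar> = pi / (8 * real N) * \<bar>real i - real j\<bar>" using N0 by (simp add: abs_mult)
    also have "\<dots> \<ge> pi / (8 * real N) * 1" using ij(3) N0 by (intro mult_left_mono) auto
    finally have "pi / (8 * real N) \<le> \<bar>ang i - ang j\<bar>" by simp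
    moreover have "pi / (8 * real N) = 2 * gap" "pi / e \<le> gap" using we by (simp_all add: gap_def)
    ultimately have "gap \<le> \<bar>(ang i + \<phi>) - (ang j + \<psi>)\<bar>" using \<phi> \<psi> by linarith
    also have "\<dots> \<le> \<bar>x - y\<bar>" unfolding \<phi>(3) \<psi>(3)
      using ang_bounds[OF ij(1)] ang_bounds[OF ij(2)] \<phi> \<psi> by (intro cos_sep) linarith+
    finally show ?thesis .
  qed
  have e_ang: "2 ^ q * ang i = 2 * pi * real (3 * N + i)" for i
    using N0 by (simp add: qN ang_def)
  have ep_ang: "e * ang i = 2 * pi * real (2 ^ t * (3 * N + i))" for i
    using e_ang[of i] by (simp add: e_def p_def power_add)
  have ends: "doubling p (hi i) = 2" "doubling p (lo i) = -2" for i
  proof -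
    have "cos (e * ang i) = 1" using cos_add_period[of 0 "2 ^ t * (3 * N + i)"] by (simp only: ep_ang add_0 cos_zero)
    then show "doubling p (hi i) = 2" by (simp add: hi_def doubling_cos e_def)
    have "e * (ang i + pi / e) = pi + 2 * pi * real (2 ^ t * (3 * N + i))"
      using e1 by (simp only: distrib_left ep_ang) simp
    then have "cos (e * (ang i + pi / e)) = -1" using cos_add_period[of pi "2 ^ t * (3 * N + i)"] by (simp only: cos_pi)
    then show "doubling p (lo i) = -2" by (simp add: lo_def doubling_cos e_def)
  qed
  have product: "\<bar>\<Prod>i=1..p. 2 - doubling i x\<bar> \<le> 1 / 4" if i: "i < N" and x: "x \<in> {lo i..hi i}" for i x
  proof -
    obtain \<phi> where \<phi>: "0 \<le> \<phi>" "\<phi> \<le> pi / e" "x = 2 * cos (ang i + \<phi>)" using cell_ang[OF i x] by blast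
    have "2 ^ (q + t) * \<phi> \<le> pi" using \<phi>(2) e1 by (simp add: e_def p_def field_simps)
    from doubling_product_near_2[OF e_ang[of i] \<phi>(1) this, where j = t]
    have "(\<Prod>i=1..p. \<bar>2 - doubling i x\<bar>) * 4 ^ (t * t) \<le> 4 ^ q * 16 ^ t * 2 ^ (t * (t + 1))"
      by (simp add: \<phi>(3) doubling_cos p_def)
    then have "(\<Prod>i=1..p. \<bar>2 - doubling i x\<bar>) * 4 ^ (t * t) * 4 \<le> 4 ^ q * 16 ^ t * 2 ^ (t * (t + 1)) * 4"
      by simp
    also have "\<dots> = 2 ^ (2 * q + 4 * t + t * (t + 1) + 2)"
    proof -
      have "(4::real) ^ q = 2 ^ (2 * q)" "(16::real) ^ t = 2 ^ (4 * t)" by (subst power_mult; simp)+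
      then show ?thesis by (simp only: power_add) simp
    qed
    also have "\<dots> \<le> 2 ^ (2 * (t * t))"
    proof (rule power_increasing)
      have "t * (t + 1) = 16 * (m * m) + 4 * m" "t * t = 16 * (m * m)" by (simp_all add: t_def)
      then show "2 * q + 4 * t + t * (t + 1) + 2 \<le> 2 * (t * t)"
        using mm m3 q_def t_def by linarith
    qed simp
    also have "\<dots> = (4::real) ^ (t * t)" by (subst power_mult) simp
    finally have "((\<Prod>i=1..p. \<bar>2 - doubling i x\<bar>) * 4) * 4 ^ (t * t) \<le> 1 * 4 ^ (t * t)"
      by (simp add: mult_ac)
    then have "(\<Prod>i=1..p. \<bar>2 - doubling i x\<bar>) * 4 \<le> 1" by (rule mult_right_le_imp_le) simp
    then show ?thesis by (simp add: abs_prod)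
  qed
  have lips: "\<bar>doubling p x - doubling p y\<bar> \<le> 2 * e * \<bar>x - y\<bar>"
    if i: "i < N" and x: "x \<in> {lo i..hi i}" and y: "y \<in> {lo i..hi i}" for i x y
  proof -
    obtain \<phi> where \<phi>: "0 \<le> \<phi>" "\<phi> \<le> pi / e" "x = 2 * cos (ang i + \<phi>)" using cell_ang[OF i x] by blast
    obtain \<psi> where \<psi>: "0 \<le> \<psi>" "\<psi> \<le> pi / e" "y = 2 * cos (ang i + \<psi>)" using cell_ang[OF i y] by blast
    let ?a = "ang i + \<phi>" and ?b = "ang i + \<psi>"
    have "\<bar>doubling p x - doubling p y\<bar> = 2 * \<bar>cos (e * ?a) - cos (e * ?b)\<bar>"
      unfolding \<phi>(3) \<psi>(3) doubling_cos e_def right_diff_distrib[symmetric] abs_mult[of 2]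
      by (simp only: abs_numeral)
    also have "\<dots> \<le> 2 * \<bar>e * ?a - e * ?b\<bar>" using abs_cos_diff_le by simp
    also have "\<dots> = 2 * e * \<bar>?a - ?b\<bar>"
      unfolding right_diff_distrib[symmetric] abs_mult using e1 by (simp del: add_diff_cancel_left)
    also have "\<dots> \<le> 2 * e * \<bar>x - y\<bar>"
    proof (rule mult_left_mono)
      show "\<bar>?a - ?b\<bar> \<le> \<bar>x - y\<bar>" unfolding \<phi>(3) \<psi>(3)
        using ang_bounds[OF i] \<phi> \<psi> by (intro cos_sep) linarith+
    qed (use e1 in simp)
    finally show ?thesis .
  qed
  obtain R P where RP: "bounded_lipschitz_on trace_box R" "bounded_lipschitz_on trace_box P"
    "\<And>x d. (trace_step ^^ p) (x, d) = (doubling p x + d * R (x, d), d * P (x, d))"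
    "\<And>x. P (x, 0) = (\<Prod>i=1..p. 2 - doubling i x)"
    using trace_step_expansion[of p] by blast
  obtain L1 where L1: "0 \<le> L1" "\<And>z. z \<in> trace_box \<Longrightarrow> \<bar>R z\<bar> \<le> L1"
    "\<And>z w. z \<in> trace_box \<Longrightarrow> w \<in> trace_box \<Longrightarrow> \<bar>R z - R w\<bar> \<le> L1 * dist z w"
    by (rule bounded_lipschitz_onE[OF RP(1)]) blast
  obtain L2 where L2: "0 \<le> L2" "\<And>z. z \<in> trace_box \<Longrightarrow> \<bar>P z\<bar> \<le> L2"
    "\<And>z w. z \<in> trace_box \<Longrightarrow> w \<in> trace_box \<Longrightarrow> \<bar>P z - P w\<bar> \<le> L2 * dist z w"
    by (rule bounded_lipschitz_onE[OF RP(2)]) blast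
  define L where "L = L1 + L2 + 1"
  have L: "1 \<le> L" using L1(1) L2(1) by (simp add: L_def)
  have RL: "\<bar>R z\<bar> \<le> L" if "z \<in> trace_box" for z using L1(2)[OF that] L2(1) by (simp add: L_def)
  have scale: "M * dist z w \<le> L * (\<bar>fst z - fst w\<bar> + \<bar>snd z - snd w\<bar>)" if "0 \<le> M" "M \<le> L" for M and z w :: "real \<times> real"
    using that dist_prod_le[of z w] by (intro mult_mono) auto
  have RD: "\<bar>R z - R w\<bar> \<le> L * (\<bar>fst z - fst w\<bar> + \<bar>snd z - snd w\<bar>)" if "z \<in> trace_box" "w \<in> trace_box" for z w
    using L1(3)[OF that] scale[of L1 z w] L1(1) L2(1) by (simp add: L_def)
  have PD: "\<bar>P z - P w\<bar> \<le> L * (\<bar>fst z - fst w\<bar> + \<bar>snd z - snd w\<bar>)" if "z \<in> trace_box" "w \<in> trace_box" for z w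
    using L2(3)[OF that] scale[of L2 z w] L1(1) L2(1) by (simp add: L_def)
  \<comment> \<open>\<open>\<kappa>\<close> weighs the defect heavily enough to absorb its influence
    \<open>L\<close> on the trace; then \<open>\<delta> L / \<kappa>\<close> is still small\<close>
  define \<kappa> where "\<kappa> = 1 / L"
  define \<delta> where "\<delta> = 1 / (4 * L * L)"
  have LL: "1 \<le> L * L" using mult_mono[OF L L] L by simp
  have \<delta>: "0 < \<delta>" "\<delta> \<le> 1 / 4" "\<delta> * L = 1 / (4 * L)" "\<delta> * L \<le> 1 / 4"
    using L LL by (auto simp: \<delta>_def divide_simps)
  have box: "(x, d) \<in> trace_box" if "i < N" "x \<in> {lo i..hi i}" "\<bar>d\<bar> \<le> \<delta>" for i x d
    using cells[OF that(1)] that \<delta> unfolding trace_box_def by auto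
  have box0: "(x, 0) \<in> trace_box" if "i < N" "x \<in> {lo i..hi i}" for i x
    using box[OF that, of 0] \<delta> by simp
  have Phalf: "\<bar>P (x, d)\<bar> \<le> 1 / 2" if "i < N" "x \<in> {lo i..hi i}" "\<bar>d\<bar> \<le> \<delta>" for i x d
  proof -
    have "\<bar>P (x, d) - P (x, 0)\<bar> \<le> L * \<bar>d\<bar>" using PD[OF box[OF that] box0[OF that(1,2)]] by simp
    also have "\<dots> \<le> L * \<delta>" using that L by (intro mult_left_mono) auto
    also have "\<dots> \<le> 1 / 4" using \<delta> by (simp add: mult.commute)
    finally show ?thesis using product[OF that(1,2)] unfolding RP(4)[symmetric] by linarith
  qed
  have main: "horseshoe (trace_step ^^ p) N (4 * e) gap \<delta> \<kappa> lo hi"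
  proof
    show "continuous_on UNIV (trace_step ^^ p)" by (rule continuous_on_trace_step_funpow)
    show "2 \<le> N" "1 \<le> 4 * e" "0 < gap" "0 < \<kappa>" using N2 e1 N0 L by (auto simp: gap_def \<kappa>_def)
    show "0 \<le> lo i \<and> lo i \<le> hi i \<and> hi i \<le> 1" if "i < N" for i by (rule cells[OF that])
    show "gap \<le> \<bar>x - y\<bar>" if "i < N" "j < N" "i \<noteq> j" "x \<in> {lo i..hi i}" "y \<in> {lo j..hi j}"
      for i j x y by (rule separated[OF that])
    show "fst ((trace_step ^^ p) (lo i, d)) \<le> 0 \<and> 1 \<le> fst ((trace_step ^^ p) (hi i, d))"
      if "i < N" "\<bar>d\<bar> \<le> \<delta>" for i d
    proof -
      have "\<bar>d * R (x, d)\<bar> \<le> 1 / 4" if x: "x \<in> {lo i..hi i}" for x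
      proof -
        have "\<bar>d * R (x, d)\<bar> \<le> \<delta> * L" unfolding abs_mult
          using RL[OF box[OF \<open>i < N\<close> x \<open>\<bar>d\<bar> \<le> \<delta>\<close>]] \<open>\<bar>d\<bar> \<le> \<delta>\<close> \<delta>(1) by (intro mult_mono) auto
        then show ?thesis using \<delta>(4) by linarith
      qed
      from this[of "lo i"] this[of "hi i"] cells[OF that(1)] show ?thesis
        unfolding RP(3) fst_conv ends by (auto simp: abs_le_iff)
    qed
    show "\<bar>snd ((trace_step ^^ p) (x, d))\<bar> \<le> \<delta>"
      if "i < N" "x \<in> {lo i..hi i}" "\<bar>d\<bar> \<le> \<delta>" for i x d
    proof -
      have "\<bar>d * P (x, d)\<bar> \<le> \<delta> * (1 / 2)" unfolding abs_mult
        using Phalf[OF that] that(3) \<delta>(1) by (intro mult_mono) auto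
      then show ?thesis using \<delta>(1) by (simp add: RP(3))
    qed
    show "weighted_dist \<kappa> ((trace_step ^^ p) z) ((trace_step ^^ p) w) \<le> 4 * e * weighted_dist \<kappa> z w"
      if h: "i < N" "fst z \<in> {lo i..hi i}" "fst w \<in> {lo i..hi i}" "\<bar>snd z\<bar> \<le> \<delta>" "\<bar>snd w\<bar> \<le> \<delta>" for i z w
    proof -
      obtain x d where z: "z = (x, d)" by (cases z)
      obtain x' d' where w: "w = (x', d')" by (cases w)
      define u v where "u = \<bar>x - x'\<bar>" and "v = \<bar>d - d'\<bar>"
      have uv: "0 \<le> u" "0 \<le> v" by (auto simp: u_def v_def)
      have hx: "x \<in> {lo i..hi i}" "x' \<in> {lo i..hi i}" "\<bar>d\<bar> \<le> \<delta>" "\<bar>d'\<bar> \<le> \<delta>" using h by (auto simp: z w)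
      note bz = box[OF h(1) hx(1,3)] and bw = box[OF h(1) hx(2,4)]
      have small: "\<delta> * (L * (u + v)) = (u + v) / (4 * L)" unfolding mult.assoc[symmetric] \<delta>(3) by simp
      have "\<bar>d * R (x, d) - d' * R (x', d')\<bar> \<le> \<delta> * (L * (u + v)) + L * v"
        using hx(3) RL[OF bw] RD[OF bz bw] by (intro abs_mult_diff_le) (auto simp: u_def v_def)
      moreover have "\<bar>doubling p x - doubling p x'\<bar> \<le> 2 * e * u"
        unfolding u_def by (rule lips[OF h(1) hx(1,2)])
      ultimately have X: "\<bar>(doubling p x + d * R (x, d)) - (doubling p x' + d' * R (x', d'))\<bar>
          \<le> 2 * e * u + ((u + v) / (4 * L) + L * v)" unfolding small by linarith
      have "\<bar>d * P (x, d) - d' * P (x', d')\<bar> \<le> \<delta> * (L * (u + v)) + 1 / 2 * v"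
        using hx(3) Phalf[OF h(1) hx(2,4)] PD[OF bz bw] by (intro abs_mult_diff_le) (auto simp: u_def v_def)
      then have "\<bar>d * P (x, d) - d' * P (x', d')\<bar> * L \<le> ((u + v) / (4 * L) + 1 / 2 * v) * L"
        unfolding small using L by (intro mult_right_mono) auto
      also have "\<dots> = (u + v) / 4 + L * v / 2" using L by (simp add: field_simps)
      finally have Y: "\<bar>d * P (x, d) - d' * P (x', d')\<bar> * L \<le> (u + v) / 4 + L * v / 2" .
      have sum_le: "2 * W + (T + Z) + ((u + v) / 4 + Z / 2) \<le> 4 * W + 4 * Y"
        if "T \<le> (u + v) / 4" "v \<le> Z" "u \<le> W" "Z \<le> Y" for T W Y Z using that uv by (simp add: field_simps)
      have "2 * (e * u) + ((u + v) / (4 * L) + L * v) + ((u + v) / 4 + L * v / 2)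
          \<le> 4 * (e * u) + 4 * (e * (L * v))"
      proof (rule sum_le)
        show "(u + v) / (4 * L) \<le> (u + v) / 4" using L uv by (intro divide_left_mono) auto
        show "v \<le> L * v" "u \<le> e * u" "L * v \<le> e * (L * v)"
          using L e1 uv mult_right_mono[of 1 L v] mult_right_mono[of 1 e u] mult_right_mono[of 1 e "L * v"]
          by auto
      qed
      moreover have "4 * e * (u + v * L) = 4 * (e * u) + 4 * (e * (L * v))" "2 * e * u = 2 * (e * u)"
        by (simp_all add: algebra_simps)
      ultimately have "2 * e * u + ((u + v) / (4 * L) + L * v) + ((u + v) / 4 + L * v / 2) \<le> 4 * e * (u + v * L)"
        by simp
      with X Y show ?thesis
        unfolding z w RP(3) weighted_dist_def fst_conv snd_conv \<kappa>_def u_def[symmetric] v_def[symmetric]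
        by simp
    qed
  qed
  have "(4 * e) powr r \<le> real N"
  proof -
    have "4 * e = 2 ^ (p + 2)" by (simp add: e_def power_add)
    then have "(4 * e) powr r = 2 powr (real (p + 2) * r)" by (simp only: powr_powr flip: powr_realpow[of 2])
    also have "\<dots> \<le> 2 powr (real q - 4)"
    proof (rule powr_mono)
      have "r * (4 * real m + 2) \<le> 1 * (4 * real m + 2)" using r by (intro mult_right_mono) auto
      moreover have "4 * real m * 2 \<le> 4 * real m * ((1 - r) * real m)" using mr by (intro mult_left_mono) auto
      moreover have "3 \<le> real m" using m3 by simp
      ultimately show "real (p + 2) * r \<le> real q - 4"
        by (simp add: p_def q_def t_def algebra_simps)
    qed simp
    also have "\<dots> = real N" using q4 by (simp add: N_def powr_realpow[symmetric] of_nat_diff)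
    finally show ?thesis .
  qed
  moreover have "even p" "0 < p" using m3 by (auto simp: p_def q_def t_def)
  ultimately show ?thesis using main \<delta>(1) by blast
qed

section \<open>Energies with small defect, and the dimension of the spectrum\<close>

lemma continuous_on_trace_orbit: "continuous_on S (\<lambda>E. trace_orbit lam E n)"
  unfolding trace_orbit_def
  using continuous_on_compose2[OF continuous_on_trace_step_funpow[of n], of S "\<lambda>E. (E\<^sup>2 - lam\<^sup>2 - 2, - 4 * lam\<^sup>2)"]
  by (simp add: continuous_intros)

text \<open>Curves of energies on which the trace crosses \<open>[0, 1]\<close> with an arbitrarily small defect. At the energy with
  \<open>E\<^sup>2 = \<lambda>\<^sup>2 + 2\<close> the first trace vanishes, hence all traces from the third on equal 2. Slightly above it,
  \<open>y\<^sub>n = 2 - x\<^sub>n\<close> satisfies \<open>y\<^sub>n\<^sub>+\<^sub>1 = y\<^sub>n (4 - y\<^sub>n - d\<^sub>n\<^sub>-\<^sub>1)\<close> with \<open>d \<le> 0\<close>, so it at least doubles as long as it is at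
  most 2. Stopping at the first energy where some \<open>y\<^sub>n\<close> with \<open>2 \<le> n \<le> m\<close>
  (in the indexing of \<open>trace_orbit\<close>) reaches 2, this must happen at \<open>n = m\<close>, all
  earlier \<open>y\<^sub>n\<close> are small, and the defect, being their product up to a constant, is exponentially small in \<open>m\<close>.\<close>

lemma trace_orbit_crossing:
  assumes \<delta>: "0 < \<delta>"
  shows "\<exists>m a b. odd m \<and> a \<le> b \<and>
    (\<forall>E\<in>{a..b}. fst (trace_orbit lam E m) \<in> {0..1} \<and> \<bar>snd (trace_orbit lam E m)\<bar> \<le> \<delta>) \<and>
    (fst (trace_orbit lam a m) = 0 \<and> fst (trace_orbit lam b m) = 1 \<or>
     fst (trace_orbit lam a m) = 1 \<and> fst (trace_orbit lam b m) = 0)"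
proof -
  define x d y where "x E n = fst (trace_orbit lam E n)" and "d E n = snd (trace_orbit lam E n)"
    and "y E n = 2 - x E n" for E n
  have x0: "x E 0 = E\<^sup>2 - lam\<^sup>2 - 2" and d0: "d E 0 = - 4 * lam\<^sup>2" for E
    by (simp_all add: x_def d_def trace_orbit_def)
  have xS: "x E (Suc n) = (x E n)\<^sup>2 - 2 + d E n" and dS: "d E (Suc n) = y E (Suc n) * d E n" for E n
    by (simp_all add: x_def d_def y_def trace_orbit_Suc trace_step_def case_prod_beta)
  have yS: "y E (Suc (Suc n)) = y E (Suc n) * (4 - y E (Suc n) - d E n)" for E n
    unfolding y_def[of E "Suc (Suc n)"] xS[of E "Suc n"] dS by (simp add: y_def power2_eq_square algebra_simps)
  have ysq: "y E (Suc (Suc n)) = y E (Suc n) * (x E n)\<^sup>2" for E n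
    unfolding yS by (simp add: y_def xS)
  define E0 E1 where "E0 = sqrt (lam\<^sup>2 + 2)" and "E1 = sqrt (lam\<^sup>2 + 3)"
  have E01: "E0 \<le> E1" by (simp add: E0_def E1_def)
  have E0sq: "E0\<^sup>2 = lam\<^sup>2 + 2" and E1sq: "E1\<^sup>2 = lam\<^sup>2 + 3" by (simp_all add: E0_def E1_def)
  have range0: "0 \<le> x E 0 \<and> x E 0 \<le> 1" if "E \<in> {E0..E1}" for E
  proof -
    have "0 \<le> E0" by (simp add: E0_def)
    then have "E0\<^sup>2 \<le> E\<^sup>2" "E\<^sup>2 \<le> E1\<^sup>2" using that by (auto intro!: power_mono)
    then show ?thesis by (simp add: x0 E0sq E1sq)
  qed
  have y1: "y E 1 = 4 + 4 * lam\<^sup>2 - (x E 0)\<^sup>2" for E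
    unfolding One_nat_def y_def xS d0 by simp
  have y1_bounds: "3 \<le> y E 1 \<and> y E 1 \<le> 4 + 4 * lam\<^sup>2" if "E \<in> {E0..E1}" for E
  proof -
    have "(x E 0)\<^sup>2 \<le> 1" using range0[OF that] by (simp add: power_le_one)
    then show ?thesis unfolding y1 using zero_le_power2[of lam] zero_le_power2[of "x E 0"] by linarith
  qed
  have ypos: "0 \<le> y E (Suc n)" if "E \<in> {E0..E1}" for E n
  proof (induction n)
    case 0
    then show ?case using y1_bounds[OF that] by simp
  next
    case (Suc n)
    then show ?case unfolding ysq by simp
  qed
  have dneg: "d E n \<le> 0" if "E \<in> {E0..E1}" for E n
  proof (induction n)
    case 0
    then show ?case by (simp add: d0)
  next
    case (Suc n)
    then show ?case unfolding dS using ypos[OF that] by (intro mult_nonneg_nonpos)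
  qed
  have double: "2 * y E (Suc n) \<le> y E (Suc (Suc n))" if "E \<in> {E0..E1}" "y E (Suc n) \<le> 2" for E n
  proof -
    have "y E (Suc n) * 2 \<le> y E (Suc n) * (4 - y E (Suc n) - d E n)"
      using ypos[OF that(1)] dneg[OF that(1), of n] that(2) by (intro mult_left_mono) auto
    then show ?thesis unfolding yS by simp
  qed
  define B where "B = (4 + 4 * lam\<^sup>2) * (4 * lam\<^sup>2)"
  have B: "0 \<le> B" by (simp add: B_def)
  obtain k where k: "(1/2) ^ k < \<delta> / (4 * B + 1)"
    using real_arch_pow_inv[of "\<delta> / (4 * B + 1)" "1/2"] \<delta> B by auto
  \<comment> \<open>odd, so that \<open>\<tau>\<^sup>m\<^sup>+\<^sup>1\<close> is an even power of the
    substitution\<close>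
  define m where "m = Suc (Suc (Suc (2 * k)))"
  have cy: "continuous_on S (\<lambda>E. y E n)" for S n
    unfolding y_def x_def by (intro continuous_intros continuous_on_trace_orbit)
  define S where "S = (\<Union>n\<in>{2..m}. {E0..E1} \<inter> (\<lambda>E. y E n) -` {2..})"
  have "closed ({E0..E1} \<inter> (\<lambda>E. y E n) -` {2..})" for n
    by (rule continuous_closed_preimage[OF cy]) auto
  then have "closed S" unfolding S_def by (intro closed_UN) auto
  then have "compact S" unfolding compact_eq_bounded_closed
    by (auto simp: S_def intro: bounded_subset[of "{E0..E1}"])
  moreover have "S \<noteq> {}"
  proof -
    have "y E1 2 = y E1 1 * (x E1 0)\<^sup>2" using ysq[of E1 0] by (simp add: numeral_2_eq_2)
    then have "3 \<le> y E1 2" using y1_bounds[of E1] E01 by (simp add: x0 E1sq)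
    then have "E1 \<in> S" using E01 unfolding S_def m_def by (intro UN_I[of 2]) auto
    then show ?thesis by blast
  qed
  ultimately obtain Es where Es: "Es \<in> S" "\<forall>E\<in>S. Es \<le> E" by (metis compact_attains_inf)
  have Es01: "Es \<in> {E0..E1}" using Es(1) by (auto simp: S_def)
  have y0: "y E0 (Suc (Suc n)) = 0" for n
  proof (induction n)
    case 0
    show ?case unfolding ysq by (simp add: x0 E0sq)
  next
    case (Suc n)
    then show ?case unfolding ysq[of E0 "Suc n"] by simp
  qed
  have yle2: "y E n \<le> 2" if E: "E \<in> {E0..Es}" and n: "n \<in> {2..m}" for E n
  proof (rule ccontr)
    assume "\<not> y E n \<le> 2"
    moreover have "n = Suc (Suc (n - 2))" using n by auto
    then have "y E0 n = 0" by (metis y0)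
    ultimately obtain F where F: "E0 \<le> F" "F \<le> E" "y F n = 2"
      using IVT'[of "\<lambda>E. y E n" E0 2 E] cy E by auto
    then have "F \<in> S" using E n Es01 unfolding S_def by (intro UN_I[of n]) auto
    then have "Es \<le> F" using Es(2) by blast
    then have "E = F" using E F by auto
    with F \<open>\<not> y E n \<le> 2\<close> show False by simp
  qed
  have sub: "E \<in> {E0..E1}" if "E \<in> {E0..Es}" for E using that Es01 by auto
  \<comment> \<open>if \<open>2\<close> were reached before time \<open>m\<close>, the next value would
    be at least 4\<close>
  have ym: "y Es m = 2"
  proof -
    obtain n where n: "n \<in> {2..m}" "2 \<le> y Es n" using Es(1) by (auto simp: S_def)
    have eq: "y Es n = 2" using yle2[of Es n] n Es01 by auto
    have "n = m"
    proof (rule ccontr)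
      assume "n \<noteq> m"
      then have "Suc n \<in> {2..m}" using n by auto
      then have "y Es (Suc n) \<le> 2" using yle2[of Es "Suc n"] Es01 by auto
      moreover obtain j where "n = Suc j" using n by (cases n) auto
      ultimately show False using double[OF Es01, of j] eq by auto
    qed
    with eq show ?thesis by simp
  qed
  have quarter: "y E (Suc n) \<le> 1 / 2" if E: "E \<in> {E0..Es}" and n: "1 \<le> n" "Suc (Suc (Suc n)) \<le> m" for E n
  proof -
    have le: "y E (Suc n) \<le> 2" "y E (Suc (Suc n)) \<le> 2" "y E (Suc (Suc (Suc n))) \<le> 2"
      using yle2[OF E] n by auto
    show ?thesis using double[OF sub[OF E] le(1)] double[OF sub[OF E] le(2)] le(3) by linarith
  qed
  have dn: "\<bar>d E (Suc n)\<bar> \<le> B * (1/2) ^ n" if E: "E \<in> {E0..Es}" and n: "Suc (Suc (Suc n)) \<le> m" for E n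
    using n
  proof (induction n)
    case 0
    have "\<bar>y E 1\<bar> \<le> 4 + 4 * lam\<^sup>2" using y1_bounds[OF sub[OF E]] by auto
    then have "\<bar>y E 1\<bar> * (4 * lam\<^sup>2) \<le> B" unfolding B_def by (intro mult_right_mono) auto
    then show ?case unfolding dS d0 by (simp add: abs_mult)
  next
    case (Suc n)
    have "0 \<le> y E (Suc (Suc n))" "y E (Suc (Suc n)) \<le> 1 / 2"
      using ypos[OF sub[OF E], of "Suc n"] quarter[OF E, of "Suc n"] Suc.prems by auto
    then have "\<bar>d E (Suc (Suc n))\<bar> \<le> 1 / 2 * \<bar>d E (Suc n)\<bar>"
      unfolding dS[of E "Suc n"] abs_mult by (intro mult_right_mono) auto
    then show ?case using Suc by simp
  qed
  have dm: "\<bar>d E m\<bar> \<le> \<delta>" if E: "E \<in> {E0..Es}" for E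
  proof -
    have "\<bar>y E m\<bar> \<le> 2" "\<bar>y E (Suc (Suc (2 * k)))\<bar> \<le> 2"
      using yle2[OF E, of m] yle2[OF E, of "Suc (Suc (2 * k))"] ypos[OF sub[OF E], of "Suc (Suc (2 * k))"]
        ypos[OF sub[OF E], of "Suc (2 * k)"] by (auto simp: m_def)
    then have "\<bar>y E m\<bar> * (\<bar>y E (Suc (Suc (2 * k)))\<bar> * \<bar>d E (Suc (2 * k))\<bar>) \<le> 2 * (2 * (B * (1/2) ^ (2 * k)))"
      using dn[OF E, of "2 * k"] by (intro mult_mono) (auto simp: m_def)
    also have "\<dots> \<le> 4 * B * (1/2) ^ k"
      using B power_decreasing[of k "2 * k" "1/2 :: real"] by (simp add: mult_left_mono)
    also have "\<dots> \<le> (4 * B + 1) * (1/2) ^ k" by (intro mult_right_mono) auto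
    also have "\<dots> \<le> \<delta>" using k B by (simp add: field_simps)
    finally show ?thesis unfolding m_def dS abs_mult .
  qed
  have cx: "continuous_on {E0..Es} (\<lambda>E. x E m)"
    unfolding x_def by (intro continuous_intros continuous_on_trace_orbit)
  have "x E0 m = 2" using y0[of "Suc (2 * k)"] by (simp add: m_def y_def)
  moreover have "x Es m = 0" using ym by (simp add: y_def)
  ultimately obtain a b where ab: "E0 \<le> a" "a \<le> b" "b \<le> Es"
    "x a m = 0 \<and> x b m = 1 \<or> x a m = 1 \<and> x b m = 0" "\<forall>E\<in>{a..b}. x E m \<in> {0..1}"
    using crossing_interval[of E0 Es "\<lambda>E. x E m" 0 1] cx Es01 by auto
  have "odd m" by (simp add: m_def)
  moreover have "\<bar>d E m\<bar> \<le> \<delta>" if "E \<in> {a..b}" for E using dm[of E] that ab by auto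
  ultimately show ?thesis using ab unfolding x_def d_def by blast
qed

lemma trace_orbit_lipschitz:
  "bounded_lipschitz_on {a..b} (\<lambda>E. fst (trace_orbit lam E n)) \<and>
   bounded_lipschitz_on {a..b} (\<lambda>E. snd (trace_orbit lam E n))"
proof (induction n)
  case 0
  have "bounded_lipschitz_on {a..b} (\<lambda>E. E)"
    unfolding bounded_lipschitz_on_def
  proof (intro exI[of _ "\<bar>a\<bar> + \<bar>b\<bar> + 1"] ballI conjI)
    fix z w assume "z \<in> {a..b}" "w \<in> {a..b}"
    have "1 * dist z w \<le> (\<bar>a\<bar> + \<bar>b\<bar> + 1) * dist z w" by (intro mult_right_mono) auto
    then show "\<bar>z - w\<bar> \<le> (\<bar>a\<bar> + \<bar>b\<bar> + 1) * dist z w" by (simp add: dist_real_def)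
  qed auto
  then show ?case unfolding trace_orbit_def power2_eq_square
    by (simp add: bounded_lipschitz_on_intros)
next
  case (Suc n)
  have "fst (trace_orbit lam E (Suc n)) = fst (trace_orbit lam E n) * fst (trace_orbit lam E n) - 2 + snd (trace_orbit lam E n)"
    "snd (trace_orbit lam E (Suc n)) = (4 - fst (trace_orbit lam E n) * fst (trace_orbit lam E n) - snd (trace_orbit lam E n)) * snd (trace_orbit lam E n)" for E
    by (simp_all add: trace_orbit_Suc trace_step_def case_prod_beta power2_eq_square)
  then show ?case using Suc by (simp add: bounded_lipschitz_on_intros)
qed

theorem theorem1:
  fixes lam :: real
  shows "hausdorff_dim (op_spectrum (tm_hamiltonian lam)) = 1"
proof (rule antisym)
  show "hausdorff_dim (op_spectrum (tm_hamiltonian lam)) \<le> 1"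
    by (rule hausdorff_dim_Reals_le_1[OF tm_spectrum_real])
  show "1 \<le> hausdorff_dim (op_spectrum (tm_hamiltonian lam))"
  proof (rule hausdorff_dim_ge_1)
    fix s :: real assume s: "0 < s" "s < 1"
    obtain p N D gap \<delta> \<kappa> lo hi where p: "even p" "0 < p" "0 < \<delta>" "D powr s \<le> real N"
      and hs: "horseshoe (trace_step ^^ p) N D gap \<delta> \<kappa> lo hi"
      using trace_step_horseshoe[OF s] by blast
    interpret horseshoe "trace_step ^^ p" N D gap \<delta> \<kappa> lo hi by (rule hs)
    obtain m a b where m: "odd m" "a \<le> b"
      "\<forall>E\<in>{a..b}. fst (trace_orbit lam E m) \<in> {0..1} \<and> \<bar>snd (trace_orbit lam E m)\<bar> \<le> \<delta>"
      "fst (trace_orbit lam a m) = 0 \<and> fst (trace_orbit lam b m) = 1 \<or>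
       fst (trace_orbit lam a m) = 1 \<and> fst (trace_orbit lam b m) = 0"
      using trace_orbit_crossing[OF p(3)] by blast
    let ?g = "\<lambda>E. trace_orbit lam E m"
    have cr: "crosses ?g a b"
      unfolding crosses_def using m continuous_on_trace_orbit by blast
    obtain L1 where L1: "0 \<le> L1" "\<And>E E'. E \<in> {a..b} \<Longrightarrow> E' \<in> {a..b} \<Longrightarrow> \<bar>fst (?g E) - fst (?g E')\<bar> \<le> L1 * dist E E'"
      by (rule bounded_lipschitz_onE[OF trace_orbit_lipschitz[THEN conjunct1]]) blast
    obtain L2 where L2: "0 \<le> L2" "\<And>E E'. E \<in> {a..b} \<Longrightarrow> E' \<in> {a..b} \<Longrightarrow> \<bar>snd (?g E) - snd (?g E')\<bar> \<le> L2 * dist E E'"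
      by (rule bounded_lipschitz_onE[OF trace_orbit_lipschitz[THEN conjunct2]]) blast
    \<comment> \<open>the summand 1 only serves to make \<open>C\<close> positive\<close>
    define C where "C = L1 + L2 / \<kappa> + 1"
    have C: "0 < C" using L1(1) L2(1) \<kappa> by (simp add: C_def add_nonneg_pos)
    have lip: "weighted_dist \<kappa> (?g E) (?g E') \<le> C * \<bar>E - E'\<bar>" if "E \<in> {a..b}" "E' \<in> {a..b}" for E E'
    proof -
      have "weighted_dist \<kappa> (?g E) (?g E') \<le> L1 * dist E E' + L2 * dist E E' / \<kappa>"
        unfolding weighted_dist_def using L1(2)[OF that] L2(2)[OF that] \<kappa>
        by (intro add_mono divide_right_mono) auto
      also have "\<dots> \<le> C * \<bar>E - E'\<bar>" by (simp add: C_def dist_real_def distrib_right)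
      finally show ?thesis .
    qed
    obtain f :: "real \<Rightarrow> real" and A B where f: "0 < A" "{0..1} \<subseteq> f ` B"
      "\<And>E E'. E \<in> B \<Longrightarrow> E' \<in> B \<Longrightarrow> \<bar>f E - f E'\<bar> \<le> A * dist E E' powr s"
      "\<And>E n. E \<in> B \<Longrightarrow> fst (((trace_step ^^ p) ^^ n) (?g E)) \<in> {0..1}"
      by (rule holder_onto_unit_interval[OF cr C lip s(1) p(4)]) blast+
    have spec: "complex_of_real E \<in> op_spectrum (tm_hamiltonian lam)" if E: "E \<in> B" for E
    proof (rule bounded_trace_in_spectrum)
      \<comment> \<open>\<open>m + 1\<close> and \<open>p\<close> are even: after each block the word is
        \<open>\<tau>\<^sup>2\<^sup>k(a)\<close> for some \<open>k\<close>\<close>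
      define k where "k n = (Suc m + p * n) div 2" for n
      have k2: "2 * k n = Suc (m + p * n)" for n using m(1) p(1) by (simp add: k_def)
      have "\<bar>trace (transfer lam E (tm_word (2 * k n) La))\<bar> \<le> 2" for n
      proof -
        have "trace_orbit lam E (m + p * n) = ((trace_step ^^ p) ^^ n) (?g E)"
          unfolding trace_orbit_def by (simp add: funpow_mult funpow_add add.commute[of m])
        then show ?thesis unfolding k2 trace_transfer_eq_orbit using f(4)[OF E, of n] by auto
      qed
      then have "range k \<subseteq> {k. \<bar>trace (transfer lam E (tm_word (2 * k) La))\<bar> \<le> 2}" by auto
      moreover have "infinite (range k)"
      proof (rule range_inj_infinite, rule injI)
        fix i j assume "k i = k j"
        then have "Suc (m + p * i) = Suc (m + p * j)" by (metis k2)
        then show "i = j" using p(2) by simp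
      qed
      ultimately show "infinite {k. \<bar>trace (transfer lam E (tm_word (2 * k) La))\<bar> \<le> 2}"
        by (rule infinite_super)
    qed
    show "\<exists>(f :: complex \<Rightarrow> real) C B. 0 < C \<and> B \<subseteq> op_spectrum (tm_hamiltonian lam) \<and> {0..1} \<subseteq> f ` B \<and>
        (\<forall>x\<in>B. \<forall>y\<in>B. \<bar>f x - f y\<bar> \<le> C * dist x y powr s)"
    proof (intro exI[of _ "f \<circ> Re"] exI[of _ A] exI[of _ "complex_of_real ` B"] conjI ballI)
      show "{0..1} \<subseteq> (f \<circ> Re) ` complex_of_real ` B" using f(2) by (simp add: image_image)
      fix x y assume "x \<in> complex_of_real ` B" "y \<in> complex_of_real ` B"
      then show "\<bar>(f \<circ> Re) x - (f \<circ> Re) y\<bar> \<le> A * dist x y powr s" using f(3) by auto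
    qed (use f(1) spec in auto)
  qed
qed

end
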